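(* Let $T:L^2(\mathbf{R}^n)\to H_\Phi(\mathbf{C}^n)$ be a (unitarily normalized) metaplectic FBI transform with the associated canonical transformation $\kappa_T:\mathbf{R}^{2n}\to\Lambda_\Phi$. If $a\in S(\Lambda_\Phi)$, then $$T^*\,\mathrm{Op}_h^w(a)\,T=\mathrm{Op}_h^w(a\circ\kappa_T),$$ where the operator on the right hand side is the $h$-Weyl quantization of the symbol $a\circ\kappa_T\in S(1)$ on $\mathbf{R}^n$.
   Context: Metaplectic FBI transform: let $\varphi$ be a holomorphic quadratic form on $\mathbf{C}^n_x\times\mathbf{C}^n_y$ with $\det\varphi''_{xy}\ne0$, $\operatorname{Im}\varphi''_{yy}>0$; $Tu(x;h)=Ch^{-3n/4}\int_{\mathbf{R}^n}e^{i\varphi(x,y)/h}u(y)\,dy$, $0<h\le1$; $\Phi(x)=\sup_{y\in\mathbf{R}^n}(-\operatorname{Im}\varphi(x,y))$, a strictly pluri-subharmonic real quadratic form on $\mathbf{C}^n$; $H_\Phi(\mathbf{C}^n)=\operatorname{Hol}(\mathbf{C}^n)\cap L^2(\mathbf{C}^n,e^{-2\Phi/h}L(dx))$ with $L(dx)$ Lebesgue measure. The constant $C>0$ (depending only on $\varphi$) is the one for which $T:L^2(\mathbf{R}^n)\to H_\Phi(\mathbf{C}^n)$ is unitary, and $T^*$ is its adjoint. The canonical transformation is the restriction to $\mathbf{R}^{2n}$ of the complex linear map $\mathbf{C}^{2n}\ni(y,-\varphi'_y(x,y))\mapsto(x,\varphi'_x(x,y))\in\mathbf{C}^{2n}$,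 which maps $\mathbf{R}^{2n}$ bijectively onto $\Lambda_\Phi=\{(x,\frac{2}{i}\frac{\partial\Phi}{\partial x}(x));\ x\in\mathbf{C}^n\}$. $S(\Lambda_\Phi)=\{a\in C^\infty(\Lambda_\Phi);\ \partial^\alpha a=\mathcal{O}_\alpha(1)\ \forall\alpha\}$, with $\Lambda_\Phi$ identified linearly with $\mathbf{C}^n_x$; $S(1)$ is the space of $C^\infty$ functions on $\mathbf{R}^{2n}$ with all derivatives bounded. For $a\in S(\Lambda_\Phi)$ and $u\in\operatorname{Hol}(\mathbf{C}^n)$ with $u=\mathcal{O}_{h,N}(1)\langle x\rangle^{-N}e^{\Phi(x)/h}$ for all $N\ge 0$, $$\mathrm{Op}_h^w(a)u(x)=\frac{1}{(2\pi h)^n}\iint_{\Gamma(x)}e^{\frac{i}{h}(x-y)\cdot\theta}a\Big(\frac{x+y}{2},\theta\Big)u(y)\,dy\wedge d\theta,$$ where $\Gamma(x)$ is the contour $\theta=\frac{2}{i}\frac{\partial\Phi}{\partial x}(\frac{x+y}{2})$, $y\in\mathbf{C}^n$, oriented so that $dy\wedge d\theta|_{\Gamma(x)}$ is a positive multiple of $L(dy)$; this extends to a bounded operator on $H_\Phi(\mathbf{C}^n)$. On $\mathbf{R}^n$, for $b\in S(1)$, $\mathrm{Op}_h^w(b)v(x)=\frac{1}{(2\pi h)^n}\iint e^{\frac{i}{h}(x-y)\cdot\eta}b(\frac{x+y}{2},\eta)v(y)\,dy\,d\eta$ (oscillatory integral), a bounded operator on $L^2(\mathbf{R}^n)$. 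*)

theory Defs
  imports "HOL-Analysis.Analysis"
begin

section \<open>Smooth functions, symbols, Schwartz functions\<close>

definition dir_deriv :: "'a::euclidean_space \<Rightarrow> ('a \<Rightarrow> complex) \<Rightarrow> 'a \<Rightarrow> complex" where
  "dir_deriv b f x = frechet_derivative f (at x) b"

text \<open>A list \<open>bs\<close> of basis vectors plays the role of a multi-index \<open>\<alpha>\<close>.\<close>

definition iter_deriv :: "'a::euclidean_space list \<Rightarrow> ('a \<Rightarrow> complex) \<Rightarrow> 'a \<Rightarrow> complex" where
  "iter_deriv bs f = foldr dir_deriv bs f"

definition smooth_fun :: "('a::euclidean_space \<Rightarrow> complex) \<Rightarrow> bool" where
  "smooth_fun f \<longleftrightarrow> (\<forall>bs. set bs \<subseteq> Basis \<longrightarrow> (\<forall>x. iter_deriv bs f differentiable (at x)))"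

definition symbol_class :: "('a::euclidean_space \<Rightarrow> complex) \<Rightarrow> bool" where
  "symbol_class f \<longleftrightarrow> smooth_fun f \<and>
     (\<forall>bs. set bs \<subseteq> Basis \<longrightarrow> bounded (range (iter_deriv bs f)))"

definition japanese :: "'a::real_normed_vector \<Rightarrow> real" where
  "japanese x = sqrt (1 + (norm x)\<^sup>2)"

definition schwartz :: "('a::euclidean_space \<Rightarrow> complex) \<Rightarrow> bool" where
  "schwartz f \<longleftrightarrow> smooth_fun f \<and>
     (\<forall>bs N. set bs \<subseteq> Basis \<longrightarrow>
        bounded (range (\<lambda>x. japanese x ^ N *\<^sub>R iter_deriv bs f x)))"

section \<open>Spaces of square integrable functions and operators between them\<close>

text \<open>
  Elements are functions rather than classes, so equality of elements means equality
  almost everywhere, and an operator is only required to be linear in that sense.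
  Linearity together with boundedness makes an operator respect almost everywhere equality.
\<close>

definition L2 :: "'a measure \<Rightarrow> ('a \<Rightarrow> complex) set" where
  "L2 M = {u \<in> borel_measurable M. integrable M (\<lambda>x. (norm (u x))\<^sup>2)}"

definition l2_inner :: "'a measure \<Rightarrow> ('a \<Rightarrow> complex) \<Rightarrow> ('a \<Rightarrow> complex) \<Rightarrow> complex" where
  "l2_inner M u v = (\<integral>x. u x * cnj (v x) \<partial>M)"

definition l2_norm :: "'a measure \<Rightarrow> ('a \<Rightarrow> complex) \<Rightarrow> real" where
  "l2_norm M u = sqrt (\<integral>x. (norm (u x))\<^sup>2 \<partial>M)"

definition linear_operator ::
  "'a measure \<Rightarrow> ('a \<Rightarrow> complex) set \<Rightarrow> 'b measure \<Rightarrow> ('b \<Rightarrow> complex) set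
    \<Rightarrow> (('a \<Rightarrow> complex) \<Rightarrow> 'b \<Rightarrow> complex) \<Rightarrow> bool" where
  "linear_operator M V N W F \<longleftrightarrow>
     (\<forall>u\<in>V. F u \<in> W) \<and>
     (\<forall>u\<in>V. \<forall>v\<in>V. \<forall>c d. AE x in N. F (\<lambda>y. c * u y + d * v y) x = c * F u x + d * F v x)"

definition bounded_operator ::
  "'a measure \<Rightarrow> ('a \<Rightarrow> complex) set \<Rightarrow> (('a \<Rightarrow> complex) \<Rightarrow> 'a \<Rightarrow> complex) \<Rightarrow> bool" where
  "bounded_operator M V F \<longleftrightarrow>
     linear_operator M V M V F \<and> (\<exists>K. \<forall>u\<in>V. l2_norm M (F u) \<le> K * l2_norm M u)"

definition unitary_operator ::
  "'a measure \<Rightarrow> ('a \<Rightarrow> complex) set \<Rightarrow> 'b measure \<Rightarrow> ('b \<Rightarrow> complex) set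
    \<Rightarrow> (('a \<Rightarrow> complex) \<Rightarrow> 'b \<Rightarrow> complex) \<Rightarrow> bool" where
  "unitary_operator M V N W F \<longleftrightarrow>
     linear_operator M V N W F \<and>
     (\<forall>u\<in>V. \<forall>v\<in>V. l2_inner N (F u) (F v) = l2_inner M u v) \<and>
     (\<forall>w\<in>W. \<exists>u\<in>V. AE x in N. F u x = w x)"

text \<open>The value of the adjoint is determined up to almost everywhere equality.\<close>

definition l2_adjoint ::
  "'a measure \<Rightarrow> ('a \<Rightarrow> complex) set \<Rightarrow> 'b measure
    \<Rightarrow> (('a \<Rightarrow> complex) \<Rightarrow> 'b \<Rightarrow> complex) \<Rightarrow> ('b \<Rightarrow> complex) \<Rightarrow> 'a \<Rightarrow> complex" where
  "l2_adjoint M V N F w =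
     (SOME v. v \<in> V \<and> (\<forall>u\<in>V. l2_inner N (F u) w = l2_inner M u v))"

section \<open>Calculus on \<open>\<complex>\<^sup>n\<close>\<close>

definition cvec :: "real^'n \<Rightarrow> complex^'n" where
  "cvec y = (\<chi> j. complex_of_real (y $ j))"

text \<open>The bilinear (not sesquilinear) product.\<close>

definition cdot :: "complex^'n \<Rightarrow> complex^'n \<Rightarrow> complex" where
  "cdot x y = (\<Sum>j\<in>UNIV. x $ j * y $ j)"

definition holomorphic_Cn :: "(complex^'n \<Rightarrow> complex) \<Rightarrow> bool" where
  "holomorphic_Cn f \<longleftrightarrow>
     (\<forall>x. \<exists>D. (f has_derivative D) (at x) \<and> (\<forall>c v. D (c *s v) = c * D v))"

definition cgrad :: "(complex^'n \<Rightarrow> complex) \<Rightarrow> complex^'n \<Rightarrow> complex^'n" where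
  "cgrad f x = (\<chi> j. deriv (\<lambda>t. f (x + t *s axis j 1)) 0)"

text \<open>\<open>\<partial>\<Phi>/\<partial>x\<close> with \<open>\<partial>/\<partial>x\<^sub>j = (\<partial>/\<partial>Re x\<^sub>j - i \<partial>/\<partial>Im x\<^sub>j) / 2\<close>.\<close>

definition wirtinger_grad :: "(complex^'n \<Rightarrow> real) \<Rightarrow> complex^'n \<Rightarrow> complex^'n" where
  "wirtinger_grad \<Phi> x =
     (\<chi> j. (complex_of_real (frechet_derivative \<Phi> (at x) (axis j 1))
             - \<i> * complex_of_real (frechet_derivative \<Phi> (at x) (axis j \<i>))) / 2)"

section \<open>Phase, weight, FBI transform, canonical transformation\<close>

definition holomorphic_quadratic_form ::
  "(complex^'n \<Rightarrow> complex^'n \<Rightarrow> complex) \<Rightarrow> bool" where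
  "holomorphic_quadratic_form \<phi> \<longleftrightarrow>
     (\<exists>P Q R :: complex^'n^'n. \<forall>x y.
        \<phi> x y = (\<Sum>j\<in>UNIV. \<Sum>k\<in>UNIV.
                   P $ j $ k * x $ j * x $ k + Q $ j $ k * x $ j * y $ k + R $ j $ k * y $ j * y $ k))"

definition phase_dx :: "(complex^'n \<Rightarrow> complex^'n \<Rightarrow> complex) \<Rightarrow> complex^'n \<Rightarrow> complex^'n \<Rightarrow> complex^'n" where
  "phase_dx \<phi> x y = cgrad (\<lambda>x'. \<phi> x' y) x"

definition phase_dy :: "(complex^'n \<Rightarrow> complex^'n \<Rightarrow> complex) \<Rightarrow> complex^'n \<Rightarrow> complex^'n \<Rightarrow> complex^'n" where
  "phase_dy \<phi> x y = cgrad (\<lambda>y'. \<phi> x y') y"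

text \<open>The second derivatives of a quadratic form are constant, hence evaluated at the origin.\<close>

definition phase_dxy :: "(complex^'n \<Rightarrow> complex^'n \<Rightarrow> complex) \<Rightarrow> complex^'n^'n" where
  "phase_dxy \<phi> = (\<chi> j k. cgrad (\<lambda>y. phase_dx \<phi> 0 y $ j) 0 $ k)"

definition phase_dyy :: "(complex^'n \<Rightarrow> complex^'n \<Rightarrow> complex) \<Rightarrow> complex^'n^'n" where
  "phase_dyy \<phi> = (\<chi> j k. cgrad (\<lambda>y. phase_dy \<phi> 0 y $ j) 0 $ k)"

definition fbi_phase :: "(complex^'n \<Rightarrow> complex^'n \<Rightarrow> complex) \<Rightarrow> bool" where
  "fbi_phase \<phi> \<longleftrightarrow>
     holomorphic_quadratic_form \<phi> \<and>
     det (phase_dxy \<phi>) \<noteq> 0 \<and>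
     (\<forall>v :: real^'n. v \<noteq> 0 \<longrightarrow> 0 < v \<bullet> ((\<chi> j k. Im (phase_dyy \<phi> $ j $ k)) *v v))"

definition fbi_weight :: "(complex^'n \<Rightarrow> complex^'n \<Rightarrow> complex) \<Rightarrow> complex^'n \<Rightarrow> real" where
  "fbi_weight \<phi> x = (SUP y :: real^'n. - Im (\<phi> x (cvec y)))"

definition weight_measure :: "(complex^'n \<Rightarrow> real) \<Rightarrow> real \<Rightarrow> (complex^'n) measure" where
  "weight_measure \<Phi> h = density lborel (\<lambda>x. ennreal (exp (- 2 * \<Phi> x / h)))"

definition H_weight :: "(complex^'n \<Rightarrow> real) \<Rightarrow> real \<Rightarrow> (complex^'n \<Rightarrow> complex) set" where
  "H_weight \<Phi> h = {u. holomorphic_Cn u} \<inter> L2 (weight_measure \<Phi> h)"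

definition fbi ::
  "(complex^'n \<Rightarrow> complex^'n \<Rightarrow> complex) \<Rightarrow> real \<Rightarrow> real
    \<Rightarrow> (real^'n \<Rightarrow> complex) \<Rightarrow> complex^'n \<Rightarrow> complex" where
  "fbi \<phi> C h u x =
     complex_of_real (C * h powr (- 3 * real CARD('n) / 4)) *
     (\<integral>y. exp (\<i> * \<phi> x (cvec y) / complex_of_real h) * u y \<partial>lborel)"

definition unitarily_normalized ::
  "(complex^'n \<Rightarrow> complex^'n \<Rightarrow> complex) \<Rightarrow> real \<Rightarrow> bool" where
  "unitarily_normalized \<phi> C \<longleftrightarrow> 0 < C \<and>
     (\<forall>h. 0 < h \<and> h \<le> 1 \<longrightarrow>
        unitary_operator lborel (L2 lborel)
          (weight_measure (fbi_weight \<phi>) h) (H_weight (fbi_weight \<phi>) h) (fbi \<phi> C h))"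

definition fbi_adjoint ::
  "(complex^'n \<Rightarrow> complex^'n \<Rightarrow> complex) \<Rightarrow> real \<Rightarrow> real
    \<Rightarrow> (complex^'n \<Rightarrow> complex) \<Rightarrow> real^'n \<Rightarrow> complex" where
  "fbi_adjoint \<phi> C h =
     l2_adjoint lborel (L2 lborel) (weight_measure (fbi_weight \<phi>) h) (fbi \<phi> C h)"

text \<open>
  The complex linear map \<open>(y, -\<phi>'\<^sub>y(x,y)) \<mapsto> (x, \<phi>'\<^sub>x(x,y))\<close>: given \<open>(y, \<eta>)\<close>, the point \<open>x\<close>
  is the solution of \<open>-\<phi>'\<^sub>y(x,y) = \<eta>\<close>, unique because \<open>\<phi>''\<^sub>x\<^sub>y\<close> is invertible.
\<close>

definition complex_canonical ::
  "(complex^'n \<Rightarrow> complex^'n \<Rightarrow> complex) \<Rightarrow> (complex^'n) \<times> (complex^'n) \<Rightarrow> (complex^'n) \<times> (complex^'n)" where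
  "complex_canonical \<phi> = (\<lambda>(y, \<eta>).
     let x = (THE x. - phase_dy \<phi> x y = \<eta>) in (x, phase_dx \<phi> x y))"

definition canonical_trafo ::
  "(complex^'n \<Rightarrow> complex^'n \<Rightarrow> complex) \<Rightarrow> (real^'n) \<times> (real^'n) \<Rightarrow> (complex^'n) \<times> (complex^'n)" where
  "canonical_trafo \<phi> = (\<lambda>(y, \<eta>). complex_canonical \<phi> (cvec y, cvec \<eta>))"

section \<open>Weyl quantization on the complex side\<close>

definition Lambda_fibre :: "(complex^'n \<Rightarrow> real) \<Rightarrow> complex^'n \<Rightarrow> complex^'n" where
  "Lambda_fibre \<Phi> x = (2 / \<i>) *s wirtinger_grad \<Phi> x"

text \<open>
  A function on \<open>\<Lambda>\<^sub>\<Phi> = {(x, Lambda_fibre \<Phi> x)}\<close> is represented by a function on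
  \<open>\<complex>\<^sup>n \<times> \<complex>\<^sup>n\<close> whose values off \<open>\<Lambda>\<^sub>\<Phi>\<close> are arbitrary and are never used.
\<close>

definition symbol_Lambda ::
  "(complex^'n \<Rightarrow> real) \<Rightarrow> ((complex^'n) \<times> (complex^'n) \<Rightarrow> complex) \<Rightarrow> bool" where
  "symbol_Lambda \<Phi> a \<longleftrightarrow> symbol_class (\<lambda>x. a (x, Lambda_fibre \<Phi> x))"

text \<open>
  Density with respect to Lebesgue measure of the form
  \<open>dy\<^sub>1 \<and> \<dots> \<and> dy\<^sub>n \<and> d\<theta>\<^sub>1 \<and> \<dots> \<and> d\<theta>\<^sub>n\<close> pulled back to the graph \<open>\<theta> = g y\<close>: the form is evaluated on
  the real basis \<open>e\<^sub>k, i e\<^sub>k\<close> of \<open>\<complex>\<^sup>n\<close> (columns \<open>Inl k\<close>, \<open>Inr k\<close>; rows \<open>dy\<^sub>j\<close>, \<open>d\<theta>\<^sub>j\<close>).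
  On the contours used below the determinant is real and non-zero, and the orientation
  making the form a positive multiple of Lebesgue measure replaces it by its absolute value.
\<close>

definition real_basis_vec :: "'n + 'n \<Rightarrow> complex^'n" where
  "real_basis_vec c = (case c of Inl k \<Rightarrow> axis k 1 | Inr k \<Rightarrow> axis k \<i>)"

definition contour_density :: "(complex^'n \<Rightarrow> complex^'n) \<Rightarrow> complex^'n \<Rightarrow> real" where
  "contour_density g y = norm (det (\<chi> r c.
     (case r of Inl j \<Rightarrow> real_basis_vec c $ j
              | Inr j \<Rightarrow> frechet_derivative g (at y) (real_basis_vec c) $ j) :: complex^('n + 'n)^('n + 'n)))"

definition graph_contour_integral ::
  "(complex^'n \<Rightarrow> complex^'n) \<Rightarrow> (complex^'n \<Rightarrow> complex^'n \<Rightarrow> complex) \<Rightarrow> complex" where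
  "graph_contour_integral g f =
     (\<integral>y. f y (g y) * complex_of_real (contour_density g y) \<partial>lborel)"

definition weyl_integral_Cn ::
  "real \<Rightarrow> (complex^'n \<Rightarrow> real) \<Rightarrow> ((complex^'n) \<times> (complex^'n) \<Rightarrow> complex)
    \<Rightarrow> (complex^'n \<Rightarrow> complex) \<Rightarrow> complex^'n \<Rightarrow> complex" where
  "weyl_integral_Cn h \<Phi> a u x =
     graph_contour_integral (\<lambda>y. Lambda_fibre \<Phi> ((1/2) *\<^sub>R (x + y)))
       (\<lambda>y \<theta>. exp (\<i> / complex_of_real h * cdot (x - y) \<theta>) * a ((1/2) *\<^sub>R (x + y), \<theta>) * u y)
     / complex_of_real ((2 * pi * h) ^ CARD('n))"

definition rapidly_decaying ::
  "(complex^'n \<Rightarrow> real) \<Rightarrow> real \<Rightarrow> (complex^'n \<Rightarrow> complex) \<Rightarrow> bool" where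
  "rapidly_decaying \<Phi> h u \<longleftrightarrow>
     (\<forall>N::nat. \<exists>K. \<forall>x. norm (u x) \<le> K * exp (\<Phi> x / h) / japanese x ^ N)"

text \<open>
  \<open>A\<close> is the operator \<open>Op(a)\<close> on \<open>H\<^sub>\<Phi>\<close>: the bounded extension of the contour integral from the
  (dense) space of rapidly decaying holomorphic functions.
\<close>

definition is_weyl_H ::
  "real \<Rightarrow> (complex^'n \<Rightarrow> real) \<Rightarrow> ((complex^'n) \<times> (complex^'n) \<Rightarrow> complex)
    \<Rightarrow> ((complex^'n \<Rightarrow> complex) \<Rightarrow> complex^'n \<Rightarrow> complex) \<Rightarrow> bool" where
  "is_weyl_H h \<Phi> a A \<longleftrightarrow>
     bounded_operator (weight_measure \<Phi> h) (H_weight \<Phi> h) A \<and>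
     (\<forall>u. holomorphic_Cn u \<and> rapidly_decaying \<Phi> h u \<longrightarrow> A u = weyl_integral_Cn h \<Phi> a u)"

section \<open>Weyl quantization on the real side\<close>

text \<open>
  Oscillatory integrals are limits of regularized absolutely convergent ones, the limit being
  the same for every cutoff.
\<close>

definition has_oscillatory_integral :: "('a::euclidean_space \<Rightarrow> complex) \<Rightarrow> complex \<Rightarrow> bool" where
  "has_oscillatory_integral F I \<longleftrightarrow>
     (\<forall>\<psi>. schwartz \<psi> \<and> \<psi> 0 = 1 \<longrightarrow>
        (\<forall>\<epsilon>>0. integrable lborel (\<lambda>z. \<psi> (\<epsilon> *\<^sub>R z) * F z)) \<and>
        ((\<lambda>\<epsilon>. \<integral>z. \<psi> (\<epsilon> *\<^sub>R z) * F z \<partial>lborel) \<longlongrightarrow> I) (at_right 0))"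

definition weyl_integrand_Rn ::
  "real \<Rightarrow> ((real^'n) \<times> (real^'n) \<Rightarrow> complex) \<Rightarrow> (real^'n \<Rightarrow> complex)
    \<Rightarrow> real^'n \<Rightarrow> (real^'n) \<times> (real^'n) \<Rightarrow> complex" where
  "weyl_integrand_Rn h b v x = (\<lambda>(y, \<eta>).
     exp (\<i> / complex_of_real h * complex_of_real ((x - y) \<bullet> \<eta>)) * b ((1/2) *\<^sub>R (x + y), \<eta>) * v y)"

text \<open>
  \<open>B\<close> is the operator \<open>Op(b)\<close> on \<open>L\<^sup>2\<close>: the bounded extension of the oscillatory integral from
  the (dense) space of Schwartz functions.
\<close>

definition is_weyl_L2 ::
  "real \<Rightarrow> ((real^'n) \<times> (real^'n) \<Rightarrow> complex)
    \<Rightarrow> ((real^'n \<Rightarrow> complex) \<Rightarrow> real^'n \<Rightarrow> complex) \<Rightarrow> bool" where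
  "is_weyl_L2 h b B \<longleftrightarrow>
     bounded_operator lborel (L2 lborel) B \<and>
     (\<forall>v. schwartz v \<longrightarrow> (AE x in lborel. \<exists>I.
        has_oscillatory_integral (weyl_integrand_Rn h b v x) I \<and>
        B v x = I / complex_of_real ((2 * pi * h) ^ CARD('n))))"

end

theory Submission
  imports Defs
begin

text \<open>
  A Weyl operator is a superposition of reflections. Substituting the midpoint for the integration
  variable gives, on both sides,
  \<open>Op(b) = (\<pi> h)\<^sup>-\<^sup>n \<integral> b(\<zeta>) R\<^sub>\<zeta> d\<zeta>\<close>, where \<open>R\<^sub>\<zeta>\<close> is, up to an oscillating factor, the reflection
  \<open>v \<mapsto> v(2 w - \<cdot>)\<close> in the space component \<open>w\<close> of \<open>\<zeta>\<close>. The quantization on \<open>\<Lambda>\<^sub>\<Phi>\<close> has the same form, with the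
  integral over \<open>\<Lambda>\<^sub>\<Phi>\<close> and the reflections of \<open>\<complex>\<^sup>n\<close>. For a quadratic phase the relation
  \<open>T R\<^sub>\<zeta> = R\<^bsub>\<kappa>(\<zeta>)\<^esub> T\<close>, with \<open>\<kappa>\<close> the canonical transformation, is an identity between integrands
  (\<open>reflection_identity\<close>). Together with the change of variables \<open>\<kappa>\<close>, whose Jacobian is the reciprocal of the contour
  density because \<open>\<kappa>\<close> is symplectic (\<open>contour_density_det\<close>), this gives \<open>Op(a) T v = T Op(a \<circ> \<kappa>) v\<close> for
  Schwartz functions \<open>v\<close> (\<open>weyl_integral_fbi\<close>).

  To make the integrals converge, all decay is drawn from one estimate for oscillating integrals,
  obtained by repeated integration by parts and uniform over families of amplitudes
  (\<open>osc_integral_decay\<close>). It shows that \<open>T v\<close> is rapidly decaying relative to \<open>exp (\<Phi> / h)\<close>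
  (\<open>fbi_rapidly_decaying\<close>), so that the contour integral defines \<open>Op(a) T v\<close>, and that the oscillatory
  integral for \<open>Op(b) v\<close> exists and equals an iterated integral (\<open>has_oscillatory_integral_weyl\<close>).

  The iterated integral is so far only known to be a bounded function of the base point. It coincides with the
  square integrable function \<open>T\<^sup>* Op(a) T v\<close> since \<open>T\<close> is injective on sums of bounded and square
  integrable functions (\<open>fbi_injective\<close>). This settles Schwartz functions; bounded operators are
  determined by their values there because Schwartz functions are dense in \<open>L\<^sup>2\<close>
  (\<open>bounded_operators_eq_on_schwartz\<close>).
\<close>

section \<open>Families of functions with controlled derivatives\<close>

lemma dir_derivI: "(f has_derivative D) (at x) \<Longrightarrow> dir_deriv b f x = D b"
  unfolding dir_deriv_def using frechet_derivative_at by metis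

lemma iter_deriv_snoc: "iter_deriv (bs @ [b]) f = iter_deriv bs (dir_deriv b f)"
  by (simp add: iter_deriv_def)

text \<open>The index carries base points, frequencies and cutoff parameters; the constants are uniform in it.
  Recursion on the number of derivatives reduces closure under products and substitutions to a
  statement about a single derivative.\<close>

primrec controlled ::
  "nat \<Rightarrow> 'i set \<Rightarrow> ('i \<Rightarrow> 'a::euclidean_space \<Rightarrow> real) \<Rightarrow> ('i \<Rightarrow> 'a \<Rightarrow> complex) \<Rightarrow> bool" where
  "controlled 0 I m F \<longleftrightarrow>
     (\<forall>i\<in>I. continuous_on UNIV (F i)) \<and> (\<exists>K\<ge>0. \<forall>i\<in>I. \<forall>x. norm (F i x) \<le> K * m i x)"
| "controlled (Suc n) I m F \<longleftrightarrow>
     (\<forall>i\<in>I. \<forall>x. F i differentiable at x) \<and> (\<exists>K\<ge>0. \<forall>i\<in>I. \<forall>x. norm (F i x) \<le> K * m i x) \<and>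
     (\<forall>b\<in>Basis. controlled n I m (\<lambda>i. dir_deriv b (F i)))"

lemma controlled_bound:
  assumes "controlled n I m F"
  obtains K where "K \<ge> 0" "\<And>i x. i \<in> I \<Longrightarrow> norm (F i x) \<le> K * m i x"
  using assms by (cases n) auto

lemma controlled_continuous:
  assumes "controlled n I m F" "i \<in> I"
  shows "continuous_on UNIV (F i)"
  using assms by (cases n) (auto intro!: differentiable_imp_continuous_on simp: differentiable_on_def)

lemma controlled_Suc_imp: "controlled (Suc n) I m F \<Longrightarrow> controlled n I m F"
proof (induction n arbitrary: F)
  case 0
  then show ?case
    by (auto intro!: differentiable_imp_continuous_on simp: differentiable_on_def)
next
  case (Suc n)
  then show ?case by (metis controlled.simps(2))
qed

lemma controlled_differentiable:
  assumes "controlled (Suc n) I m F" "i \<in> I"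
  shows "(F i has_derivative frechet_derivative (F i) (at x)) (at x)"
  using assms by (auto simp: frechet_derivative_works)

lemma controlled_weaken:
  assumes "controlled n I m F" and "K \<ge> 0" and m: "\<And>i x. i \<in> I \<Longrightarrow> m i x \<le> K * m' i x"
  shows "controlled n I m' F"
  using assms(1)
proof (induction n arbitrary: F)
  have *: "\<exists>K\<ge>0. \<forall>i\<in>I. \<forall>x. norm (F i x) \<le> K * m' i x"
    if "K' \<ge> 0" "\<forall>i\<in>I. \<forall>x. norm (F i x) \<le> K' * m i x" for F :: "'a \<Rightarrow> 'b \<Rightarrow> complex" and K'
  proof (intro exI[of _ "K' * K"] conjI ballI allI)
    fix i x assume "i \<in> I"
    then have "norm (F i x) \<le> K' * m i x" using that by auto
    also have "\<dots> \<le> K' * (K * m' i x)" using m[OF \<open>i \<in> I\<close>] that by (intro mult_left_mono) auto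
    finally show "norm (F i x) \<le> K' * K * m' i x" by simp
  qed (use that \<open>K \<ge> 0\<close> in auto)
  {
    case 0
    then show ?case using * by auto
  next
    case (Suc n)
    then show ?case using * by auto
  }
qed

lemma controlled_reindex:
  assumes "controlled n I m F" and "\<And>j. j \<in> J \<Longrightarrow> r j \<in> I"
  shows "controlled n J (\<lambda>j. m (r j)) (\<lambda>j. F (r j))"
  using assms(1)
proof (induction n arbitrary: F)
  have *: "\<exists>K\<ge>0. \<forall>j\<in>J. \<forall>x. norm (F (r j) x) \<le> K * m (r j) x"
    if "\<exists>K\<ge>0. \<forall>i\<in>I. \<forall>x. norm (F i x) \<le> K * m i x" for F :: "'a \<Rightarrow> 'b \<Rightarrow> complex"
    using that assms(2) by (elim ex_forward) simp
  {
    case 0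
    then show ?case using assms(2) *[of F] by simp
  next
    case (Suc n)
    then show ?case using assms(2) *[of F] Suc.IH[of "\<lambda>i. dir_deriv _ (F i)"] by simp
  }
qed

lemma controlled_cong:
  assumes "controlled n I m F" and "\<And>i x. i \<in> I \<Longrightarrow> F i x = G i x"
  shows "controlled n I m G"
  using assms
proof (induction n arbitrary: F G)
  case 0
  have "F i = G i" if "i \<in> I" for i using 0(2)[OF that] by blast
  then show ?case using 0(1) by simp
next
  case (Suc n)
  have eq: "F i = G i" if "i \<in> I" for i using Suc.prems(2)[OF that] by blast
  have "controlled n I m (\<lambda>i. dir_deriv b (G i))" if "b \<in> Basis" for b
  proof (rule Suc.IH)
    show "controlled n I m (\<lambda>i. dir_deriv b (F i))" using Suc.prems(1) that by simp
  qed (simp add: eq)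
  then show ?case using Suc.prems(1) eq by simp
qed

lemma controlled_add:
  assumes "controlled n I m F" "controlled n I m G"
  shows "controlled n I m (\<lambda>i x. F i x + G i x)"
  using assms
proof (induction n arbitrary: F G)
  have *: "\<exists>K\<ge>0. \<forall>i\<in>I. \<forall>x. norm (F i x + G i x) \<le> K * m i x"
    if F: "controlled n I m F" and G: "controlled n I m G" for n and F G :: "'a \<Rightarrow> 'b \<Rightarrow> complex"
  proof -
    obtain K where K: "K \<ge> 0" "\<And>i x. i \<in> I \<Longrightarrow> norm (F i x) \<le> K * m i x"
      using controlled_bound[OF F] by blast
    obtain L where L: "L \<ge> 0" "\<And>i x. i \<in> I \<Longrightarrow> norm (G i x) \<le> L * m i x"
      using controlled_bound[OF G] by blast
    show ?thesis
      using K L by (intro exI[of _ "K + L"]) (auto simp: distrib_right intro!: norm_triangle_le add_mono)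
  qed
  {
    case (0 F G)
    then show ?case using *[of 0 F G] by (auto intro!: continuous_on_add)
  next
    case (Suc n F G)
    note D = controlled_differentiable[OF Suc.prems(1)] controlled_differentiable[OF Suc.prems(2)]
    have "controlled n I m (\<lambda>i. dir_deriv b (\<lambda>x. F i x + G i x))" if "b \<in> Basis" for b
    proof (rule controlled_cong)
      show "controlled n I m (\<lambda>i x. dir_deriv b (F i) x + dir_deriv b (G i) x)"
        using Suc that by auto
    qed (auto simp: dir_deriv_def[of _ "F _"] dir_deriv_def[of _ "G _"]
          intro!: dir_derivI[symmetric] has_derivative_add D)
    then show ?case using *[OF Suc.prems] Suc.prems by auto
  }
qed

text \<open>The derivative of a product is a sum of two products of the same kind with one derivative less to
  control, which closes the induction.\<close>

lemma controlled_mult: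
  assumes "controlled n I m F" "controlled n I m' G"
  shows "controlled n I (\<lambda>i x. m i x * m' i x) (\<lambda>i x. F i x * G i x)"
  using assms
proof (induction n arbitrary: F G)
  have *: "\<exists>K\<ge>0. \<forall>i\<in>I. \<forall>x. norm (F i x * G i x) \<le> K * (m i x * m' i x)"
    if F: "controlled n I m F" and G: "controlled n I m' G" for n and F G :: "'a \<Rightarrow> 'b \<Rightarrow> complex"
  proof -
    obtain K where K: "K \<ge> 0" "\<And>i x. i \<in> I \<Longrightarrow> norm (F i x) \<le> K * m i x"
      using controlled_bound[OF F] by blast
    obtain L where L: "L \<ge> 0" "\<And>i x. i \<in> I \<Longrightarrow> norm (G i x) \<le> L * m' i x"
      using controlled_bound[OF G] by blast
    show ?thesis
    proof (intro exI[of _ "K * L"] conjI ballI allI)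
      fix i x assume "i \<in> I"
      have "norm (F i x * G i x) \<le> (K * m i x) * (L * m' i x)"
        unfolding norm_mult using K(2)[OF \<open>i \<in> I\<close>] L(2)[OF \<open>i \<in> I\<close>]
        by (intro mult_mono) (auto intro: order_trans[OF norm_ge_zero])
      then show "norm (F i x * G i x) \<le> K * L * (m i x * m' i x)" by (simp add: mult_ac)
    qed (use K L in auto)
  qed
  {
    case (0 F G)
    then show ?case using *[of 0 F G] by (auto intro!: continuous_on_mult)
  next
    case (Suc n F G)
    note D = controlled_differentiable[OF Suc.prems(1)] controlled_differentiable[OF Suc.prems(2)]
    have "controlled n I (\<lambda>i x. m i x * m' i x) (\<lambda>i. dir_deriv b (\<lambda>x. F i x * G i x))"
      if "b \<in> Basis" for b
    proof (rule controlled_cong)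
      show "controlled n I (\<lambda>i x. m i x * m' i x)
              (\<lambda>i x. F i x * dir_deriv b (G i) x + dir_deriv b (F i) x * G i x)"
        using Suc.prems that
        by (intro controlled_add Suc.IH controlled_Suc_imp[of n I m F] controlled_Suc_imp[of n I m' G]) auto
    qed (auto simp: dir_deriv_def[of _ "F _"] dir_deriv_def[of _ "G _"]
          intro!: dir_derivI[symmetric] has_derivative_mult D)
    then show ?case using *[OF Suc.prems] Suc.prems by auto
  }
qed

lemma controlled_zero:
  assumes "\<And>i x. i \<in> I \<Longrightarrow> m i x \<ge> 0"
  shows "controlled n I m (\<lambda>i x. 0)"
proof (induction n)
  case (Suc n)
  have "dir_deriv b (\<lambda>x. 0) = (\<lambda>x::'b. 0)" for b
    by (auto intro!: dir_derivI)
  then show ?case using Suc assms by (auto intro!: exI[of _ 0])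
qed (use assms in \<open>auto intro!: exI[of _ 0]\<close>)

lemma controlled_const:
  fixes I :: "'i set" and c :: "'i \<Rightarrow> complex"
  assumes "\<And>i. i \<in> I \<Longrightarrow> norm (c i) \<le> K"
  shows "controlled n I (\<lambda>_ (_::'b::euclidean_space). 1) (\<lambda>i x. c i)"
proof -
  have bd: "\<exists>K\<ge>0. \<forall>i\<in>I. \<forall>x::'b. norm (c i) \<le> K * 1"
    using order_trans[OF assms abs_ge_self] by (intro exI[of _ "\<bar>K\<bar>"]) simp
  show ?thesis
  proof (cases n)
    case (Suc k)
    have "dir_deriv b (\<lambda>x. c i) = (\<lambda>x::'b. 0)" for b i
      by (auto intro!: dir_derivI)
    then show ?thesis using bd controlled_zero[of I "\<lambda>_ (_::'b). 1"] Suc by simp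
  qed (use bd in simp)
qed

lemma controlled_cmult:
  assumes "controlled n I m F" and "\<And>i. i \<in> I \<Longrightarrow> norm (c i) \<le> K"
  shows "controlled n I m (\<lambda>i x. c i * F i x)"
  using controlled_mult[OF controlled_const[of I c K n, OF assms(2)] assms(1)] by simp

lemma controlled_sum:
  assumes "finite A" and "\<And>i x. i\<in>I \<Longrightarrow> m i x \<ge> 0" and "\<And>a. a \<in> A \<Longrightarrow> controlled n I m (F a)"
  shows "controlled n I m (\<lambda>i x. \<Sum>a\<in>A. F a i x)"
  using assms(1,3)
  by (induction A rule: finite_induct) (auto intro!: controlled_add controlled_zero assms(2))

lemma linear_expansion_Basis:
  fixes f' :: "'b::euclidean_space \<Rightarrow> 'c::real_vector"
  assumes "linear f'"
  shows "f' v = (\<Sum>c\<in>Basis. (v \<bullet> c) *\<^sub>R f' c)"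
proof -
  have "f' v = f' (\<Sum>c\<in>Basis. (v \<bullet> c) *\<^sub>R c)" by (simp add: euclidean_representation)
  also have "\<dots> = (\<Sum>c\<in>Basis. (v \<bullet> c) *\<^sub>R f' c)"
    using assms by (simp add: linear_sum linear_cmul)
  finally show ?thesis .
qed

text \<open>By the chain rule a derivative of the composition is a combination of derivatives of \<open>F i\<close> whose
  coefficients are entries of \<open>A i\<close>, hence bounded by \<open>K\<close>.\<close>

lemma controlled_affine:
  fixes F :: "'i \<Rightarrow> 'b::euclidean_space \<Rightarrow> complex" and A :: "'i \<Rightarrow> 'a::euclidean_space \<Rightarrow> 'b"
  assumes "controlled n I m F"
    and A: "\<And>i. i \<in> I \<Longrightarrow> linear (A i)"
    and K: "\<And>i b. i \<in> I \<Longrightarrow> b \<in> Basis \<Longrightarrow> norm (A i b) \<le> K"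
    and m: "\<And>i x. i \<in> I \<Longrightarrow> m i x \<ge> 0"
  shows "controlled n I (\<lambda>i x. m i (A i x + p i)) (\<lambda>i x. F i (A i x + p i))"
  using assms(1)
proof (induction n arbitrary: F)
  have bl: "bounded_linear (A i)" if "i \<in> I" for i
    using A[OF that] by (rule linear_conv_bounded_linear[THEN iffD1])
  {
    case 0
    have "continuous_on UNIV (\<lambda>x. F i (A i x + p i))" if "i \<in> I" for i
    proof -
      have "continuous_on UNIV (F i)" using 0 that by auto
      moreover have "continuous_on UNIV (\<lambda>x. A i x + p i)"
        using linear_continuous_on[OF bl[OF that]] by (intro continuous_intros)
      ultimately show ?thesis
        using continuous_on_compose2[of UNIV "F i"] by auto
    qed
    then show ?case using 0 by auto
  next
    case (Suc n)
    have der: "((\<lambda>x. F i (A i x + p i)) has_derivative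
         (\<lambda>v. frechet_derivative (F i) (at (A i x + p i)) (A i v))) (at x)" if "i \<in> I" for i x
    proof -
      have "((\<lambda>x. A i x + p i) has_derivative A i) (at x)"
        using bl[OF that] by (auto intro!: derivative_eq_intros bounded_linear_imp_has_derivative)
      from has_derivative_compose[OF this controlled_differentiable[OF Suc.prems that]]
      show ?thesis by simp
    qed
    have "controlled n I (\<lambda>i x. m i (A i x + p i)) (\<lambda>i. dir_deriv b (\<lambda>x. F i (A i x + p i)))"
      if b: "b \<in> Basis" for b
    proof (rule controlled_cong)
      show "controlled n I (\<lambda>i x. m i (A i x + p i))
         (\<lambda>i x. \<Sum>c\<in>Basis. complex_of_real (A i b \<bullet> c) * dir_deriv c (F i) (A i x + p i))"
      proof (intro controlled_sum controlled_cmult[where K=K] Suc.IH)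
        fix c :: 'b and i assume "c \<in> Basis" "i \<in> I"
        then show "norm (complex_of_real (A i b \<bullet> c)) \<le> K"
          using K[OF \<open>i \<in> I\<close> b] Basis_le_norm[of c "A i b"] by simp
      qed (use Suc.prems m in auto)
      fix i x assume i: "i \<in> I"
      have lin: "linear (frechet_derivative (F i) (at (A i x + p i)))"
        using controlled_differentiable[OF Suc.prems i] has_derivative_linear by blast
      have "dir_deriv b (\<lambda>x. F i (A i x + p i)) x = frechet_derivative (F i) (at (A i x + p i)) (A i b)"
        by (rule dir_derivI[OF der[OF i]])
      also have "\<dots> = (\<Sum>c\<in>Basis. complex_of_real (A i b \<bullet> c) * dir_deriv c (F i) (A i x + p i))"
        unfolding dir_deriv_def by (subst linear_expansion_Basis[OF lin]) (simp add: scaleR_conv_of_real)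
      finally show "(\<Sum>c\<in>Basis. complex_of_real (A i b \<bullet> c) * dir_deriv c (F i) (A i x + p i))
          = dir_deriv b (\<lambda>x. F i (A i x + p i)) x" ..
    qed
    moreover have "(\<lambda>x. F i (A i x + p i)) differentiable at x" if "i \<in> I" for i x
      using der[OF that] by (rule differentiableI)
    moreover have "\<exists>K\<ge>0. \<forall>i\<in>I. \<forall>x. norm (F i (A i x + p i)) \<le> K * m i (A i x + p i)"
      using Suc.prems by auto
    ultimately show ?case by simp
  }
qed

text \<open>Translates between the recursive description, in which the innermost derivative is taken first, and
  lists of directions.\<close>

lemma all_controlled_iff:
  fixes f :: "'a::euclidean_space \<Rightarrow> complex"
  shows "(\<forall>n. controlled n (UNIV::unit set) (\<lambda>_. m) (\<lambda>_. f)) \<longleftrightarrow>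
    smooth_fun f \<and> (\<forall>bs. set bs \<subseteq> Basis \<longrightarrow> (\<exists>K\<ge>0. \<forall>x. norm (iter_deriv bs f x) \<le> K * m x))"
    (is "?L f \<longleftrightarrow> ?R f")
proof
  assume "?L f"
  have "(\<forall>x. iter_deriv bs f differentiable at x) \<and> (\<exists>K\<ge>0. \<forall>x. norm (iter_deriv bs f x) \<le> K * m x)"
    if "set bs \<subseteq> Basis" for bs
    using \<open>?L f\<close> that
  proof (induction bs arbitrary: f rule: rev_induct)
    case Nil
    then have "controlled (Suc 0) (UNIV::unit set) (\<lambda>_. m) (\<lambda>_. f)" by blast
    then show ?case by (auto simp: iter_deriv_def)
  next
    case (snoc b bs)
    have "?L (dir_deriv b f)" using snoc.prems(1)[rule_format, of "Suc _"] snoc.prems(2) by simp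
    then show ?case using snoc by (simp add: iter_deriv_snoc)
  qed
  then show "?R f" by (auto simp: smooth_fun_def)
next
  assume "?R f"
  show "?L f"
  proof
    fix n
    show "controlled n UNIV (\<lambda>_::unit. m) (\<lambda>_. f)"
      using \<open>?R f\<close>
    proof (induction n arbitrary: f)
      case 0
      have "f differentiable at x" for x using 0[THEN conjunct1] by (auto simp: smooth_fun_def iter_deriv_def dest: spec[of _ "[]"])
      then have "continuous_on UNIV f" by (auto intro!: differentiable_imp_continuous_on simp: differentiable_on_def)
      moreover have "\<exists>K\<ge>0. \<forall>x. norm (f x) \<le> K * m x"
        using 0[THEN conjunct2, rule_format, of "[]"] by (simp add: iter_deriv_def)
      ultimately show ?case by simp
    next
      case (Suc n)
      have "f differentiable at x" for x using Suc.prems[THEN conjunct1] by (auto simp: smooth_fun_def iter_deriv_def dest: spec[of _ "[]"])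
      moreover have "\<exists>K\<ge>0. \<forall>x. norm (f x) \<le> K * m x"
        using Suc.prems[THEN conjunct2, rule_format, of "[]"] by (simp add: iter_deriv_def)
      moreover have "controlled n UNIV (\<lambda>_::unit. m) (\<lambda>_. dir_deriv b f)" if "b \<in> Basis" for b
      proof (rule Suc.IH)
        have "iter_deriv (bs @ [b]) f differentiable at x" if "set bs \<subseteq> Basis" for bs x
          using Suc.prems[THEN conjunct1] that \<open>b \<in> Basis\<close> by (simp add: smooth_fun_def)
        moreover have "\<exists>K\<ge>0. \<forall>x. norm (iter_deriv (bs @ [b]) f x) \<le> K * m x" if "set bs \<subseteq> Basis" for bs
          using Suc.prems[THEN conjunct2] that \<open>b \<in> Basis\<close> by simp
        ultimately show "?R (dir_deriv b f)" by (auto simp: smooth_fun_def iter_deriv_snoc)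
      qed
      ultimately show ?case by simp
    qed
  qed
qed

lemma japanese_ge_1: "japanese x \<ge> 1"
  by (simp add: japanese_def)

lemma japanese_pos [simp]: "japanese x > 0"
  using japanese_ge_1[of x] by linarith

lemma bounded_range_iff_nonneg:
  fixes g :: "'a \<Rightarrow> 'b::real_normed_vector"
  shows "bounded (range g) \<longleftrightarrow> (\<exists>K\<ge>0. \<forall>x. norm (g x) \<le> K)"
proof
  assume "bounded (range g)"
  then obtain K where K: "\<forall>x. norm (g x) \<le> K" by (auto simp: bounded_iff)
  then have "0 \<le> K" using norm_ge_zero order_trans by blast
  with K show "\<exists>K\<ge>0. \<forall>x. norm (g x) \<le> K" by blast
qed (auto simp: bounded_iff)

lemma symbol_class_iff:
  "symbol_class f \<longleftrightarrow> (\<forall>n. controlled n (UNIV::unit set) (\<lambda>_ _. 1) (\<lambda>_. f))"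
proof -
  have "bounded (range g) \<longleftrightarrow> (\<exists>K\<ge>0. \<forall>x. norm (g x) \<le> K * 1)" for g :: "'a \<Rightarrow> complex"
    using bounded_range_iff_nonneg[of g] by simp
  then show ?thesis by (simp only: symbol_class_def all_controlled_iff)
qed

abbreviation decay :: "nat \<Rightarrow> 'a::real_normed_vector \<Rightarrow> real" where
  "decay N x \<equiv> inverse (japanese x ^ N)"

lemma schwartz_iff:
  "schwartz f \<longleftrightarrow> (\<forall>N n. controlled n (UNIV::unit set) (\<lambda>_ x. decay N x) (\<lambda>_. f))"
proof -
  have "bounded (range (\<lambda>x. japanese x ^ N *\<^sub>R g x)) \<longleftrightarrow> (\<exists>K\<ge>0. \<forall>x. norm (g x) \<le> K * decay N x)"
    for g :: "'a \<Rightarrow> complex" and N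
  proof -
    have "norm (japanese x ^ N *\<^sub>R g x) \<le> K \<longleftrightarrow> norm (g x) \<le> K * decay N x" for x K
      by (simp add: field_simps less_imp_le[OF japanese_pos])
    moreover have "bounded (range (\<lambda>x. japanese x ^ N *\<^sub>R g x)) \<longleftrightarrow> (\<exists>K\<ge>0. \<forall>x. norm (japanese x ^ N *\<^sub>R g x) \<le> K)"
      by (rule bounded_range_iff_nonneg)
    ultimately show ?thesis by simp
  qed
  then show ?thesis unfolding schwartz_def all_controlled_iff by blast
qed

section \<open>Decay of oscillating integrals\<close>

lemma japanese_square: "(japanese x)\<^sup>2 = 1 + (norm x)\<^sup>2"
  by (simp add: japanese_def)

lemma continuous_on_japanese [continuous_intros]:
  "continuous_on A f \<Longrightarrow> continuous_on A (\<lambda>x. japanese (f x))"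
  unfolding japanese_def by (intro continuous_intros)

lemma borel_measurable_japanese [measurable]:
  "(japanese :: 'a::euclidean_space \<Rightarrow> real) \<in> borel_measurable borel"
  by (intro borel_measurable_continuous_onI continuous_intros)

lemma norm_square_Basis: "(norm x)\<^sup>2 = (\<Sum>b\<in>Basis. (x \<bullet> b)\<^sup>2)" for x :: "'a::euclidean_space"
  unfolding power2_norm_eq_inner by (subst euclidean_inner) (simp add: power2_eq_square)

lemma prod_one_plus_ge: 
  fixes f :: "'a \<Rightarrow> real"
  assumes "finite A" "\<And>a. a \<in> A \<Longrightarrow> f a \<ge> 0"
  shows "1 + sum f A \<le> (\<Prod>a\<in>A. 1 + f a)"
  using assms
proof (induction A rule: finite_induct)
  case (insert a A)
  have "0 \<le> f a * sum f A" using insert by (intro mult_nonneg_nonneg sum_nonneg) auto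
  then have "1 + (f a + sum f A) \<le> (1 + f a) * (1 + sum f A)" by (simp add: algebra_simps)
  also have "\<dots> \<le> (1 + f a) * (\<Prod>a\<in>A. 1 + f a)" using insert by (intro mult_left_mono) auto
  finally show ?case using insert by simp
qed simp

lemma nn_integral_inverse_1_plus_square_finite: "(\<integral>\<^sup>+(x::real). ennreal (inverse (1 + x\<^sup>2)) \<partial>lborel) < \<infinity>"
proof -
  let ?f = "\<lambda>x::real. inverse (1 + x\<^sup>2)"
  have half: "(\<integral>\<^sup>+x. ennreal (?f x) * indicator {0..} x \<partial>lborel) = pi / 2 - arctan 0"
  proof (rule nn_integral_FTC_atLeast)
    show "(arctan \<longlongrightarrow> pi / 2) at_top" by (rule tendsto_arctan_at_top)
  qed (auto intro: DERIV_arctan)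
  have "(\<integral>\<^sup>+x. ennreal (?f x) \<partial>lborel) \<le>
      (\<integral>\<^sup>+x. ennreal (?f x) * indicator {0..} x + ennreal (?f (-x)) * indicator {0..} (-x) \<partial>lborel)"
    by (intro nn_integral_mono) (auto simp: indicator_def)
  also have "\<dots> = (\<integral>\<^sup>+x. ennreal (?f x) * indicator {0..} x \<partial>lborel) 
      + (\<integral>\<^sup>+x. ennreal (?f (-x)) * indicator {0..} (-x) \<partial>lborel)"
    by (intro nn_integral_add) auto
  also have "(\<integral>\<^sup>+x. ennreal (?f (-x)) * indicator {0..} (-x) \<partial>lborel) = (\<integral>\<^sup>+x. ennreal (?f x) * indicator {0..} x \<partial>lborel)"
    using nn_integral_real_affine[of "\<lambda>x. ennreal (?f x) * indicator {0..} x" "-1" 0] by simp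
  also have "\<dots> + \<dots> < \<infinity>" unfolding half by simp
  finally show ?thesis .
qed

text \<open>The power \<open>2 d\<close> dominates the product of the factors \<open>1 + (x \<bullet> b)\<^sup>2\<close>, and the integral of the
  reciprocal product splits into one-dimensional ones.\<close>

lemma integrable_japanese:
  assumes "2 * DIM('a) \<le> N"
  shows "integrable lborel (\<lambda>x::'a::euclidean_space. decay N x)"
proof (rule integrableI_bounded)
  have bound: "decay N x \<le> (\<Prod>b\<in>Basis. inverse (1 + (x \<bullet> b)\<^sup>2))" for x :: 'a
  proof -
    have "(\<Prod>b\<in>Basis. 1 + (x \<bullet> b)\<^sup>2) \<le> (\<Prod>b\<in>(Basis::'a set). (japanese x)\<^sup>2)"
    proof (intro prod_mono conjI)
      fix b :: 'a assume "b \<in> Basis"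
      then show "1 + (x \<bullet> b)\<^sup>2 \<le> (japanese x)\<^sup>2"
        using Basis_le_norm[of b x] by (simp add: japanese_square abs_le_square_iff[symmetric])
    qed auto
    also have "\<dots> = japanese x ^ (2 * DIM('a))" by (simp add: power_mult)
    also have "\<dots> \<le> japanese x ^ N" using assms japanese_ge_1 by (rule power_increasing)
    finally have "decay N x \<le> inverse (\<Prod>b\<in>Basis. 1 + (x \<bullet> b)\<^sup>2)"
      by (intro le_imp_inverse_le prod_pos) (auto simp: add_pos_nonneg)
    also have "\<dots> = (\<Prod>b\<in>Basis. inverse (1 + (x \<bullet> b)\<^sup>2))" by (rule prod_inversef[symmetric, unfolded o_def])
    finally show ?thesis .
  qed
  have "(\<integral>\<^sup>+(x::'a). ennreal (norm (decay N x)) \<partial>lborel)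
      \<le> (\<integral>\<^sup>+(x::'a). (\<Prod>b\<in>Basis. ennreal (inverse (1 + (x \<bullet> b)\<^sup>2))) \<partial>lborel)"
    by (intro nn_integral_mono)
       (auto simp: prod_ennreal less_imp_le intro!: ennreal_leI order_trans[OF _ bound])
  also have "\<dots> = (\<Prod>b\<in>(Basis::'a set). \<integral>\<^sup>+(x::real). ennreal (inverse (1 + x\<^sup>2)) \<partial>lborel)"
    by (rule nn_integral_lborel_prod) auto
  also have "\<dots> < \<infinity>"
    using nn_integral_inverse_1_plus_square_finite by (simp add: power_less_top_ennreal)
  finally show "(\<integral>\<^sup>+(x::'a). ennreal (norm (decay N x)) \<partial>lborel) < \<infinity>" .
qed (intro borel_measurable_inverse borel_measurable_power, simp)

lemma lborel_distr_translation: "distr lborel borel (\<lambda>x. x + a) = (lborel :: 'a::euclidean_space measure)"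
proof -
  have "(\<lambda>x. x + a) = (+) a" by (rule ext) (rule add.commute)
  then show ?thesis using lborel_distr_plus[of a] by simp
qed

lemma integral_translation:
  fixes f :: "'a::euclidean_space \<Rightarrow> 'b::{banach, second_countable_topology}"
  assumes [measurable]: "f \<in> borel_measurable borel"
  shows "(\<integral>x. f (x + a) \<partial>lborel) = (\<integral>x. f x \<partial>lborel)"
  using integral_distr[of "\<lambda>x. x + a" lborel borel f] lborel_distr_translation[of a] by simp

lemma integrable_translation:
  fixes f :: "'a::euclidean_space \<Rightarrow> 'b::{banach, second_countable_topology}"
  assumes "integrable lborel f"
  shows "integrable lborel (\<lambda>x. f (x + a))"
proof -
  have [measurable]: "f \<in> borel_measurable borel" using assms by auto
  show ?thesis
    using integrable_distr[of "\<lambda>x. x + a" lborel borel f] lborel_distr_translation[of a] assms by simp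
qed

text \<open>By translation invariance \<open>f (z + b) - f z\<close> has integral zero, and it is the integral of the
  derivative over the segment from \<open>z\<close> to \<open>z + b\<close>.\<close>

lemma integral_dir_deriv_eq_0:
  fixes f :: "'a::euclidean_space \<Rightarrow> complex"
  assumes diff: "\<And>x. f differentiable at x" and int: "integrable lborel f"
    and cont: "continuous_on UNIV (dir_deriv b f)" and int': "integrable lborel (dir_deriv b f)"
  shows "(\<integral>x. dir_deriv b f x \<partial>lborel) = 0"
proof -
  let ?g = "dir_deriv b f"
  have [measurable]: "?g \<in> borel_measurable borel" using cont by (rule borel_measurable_continuous_onI)
  have FTC: "(\<integral>t. indicator {0..1} t *\<^sub>R ?g (x + t *\<^sub>R b) \<partial>lborel) = f (x + b) - f x" for x
  proof -
    have "(\<integral>t. indicator {0..1} t *\<^sub>R ?g (x + t *\<^sub>R b) \<partial>lborel) = f (x + 1 *\<^sub>R b) - f (x + 0 *\<^sub>R b)"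
    proof (rule integral_FTC_atLeastAtMost)
      show "continuous_on {0..1} (\<lambda>t. ?g (x + t *\<^sub>R b))"
        by (rule continuous_on_compose2[OF cont]) (auto intro!: continuous_intros)
      fix t :: real
      have line: "((\<lambda>t. x + t *\<^sub>R b) has_derivative (\<lambda>s. s *\<^sub>R b)) (at t within {0..1})"
        by (auto intro!: derivative_eq_intros)
      have fd: "(f has_derivative frechet_derivative f (at (x + t *\<^sub>R b))) (at (x + t *\<^sub>R b))"
        using diff by (simp add: frechet_derivative_works)
      have "((\<lambda>t. f (x + t *\<^sub>R b)) has_derivative (\<lambda>s. frechet_derivative f (at (x + t *\<^sub>R b)) (s *\<^sub>R b))) (at t within {0..1})"
        by (rule has_derivative_compose[OF line fd])
      moreover have "frechet_derivative f (at (x + t *\<^sub>R b)) (s *\<^sub>R b) = s *\<^sub>R ?g (x + t *\<^sub>R b)" for s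
        using has_derivative_linear[OF fd] by (simp add: linear_cmul dir_deriv_def)
      ultimately show "((\<lambda>t. f (x + t *\<^sub>R b)) has_vector_derivative ?g (x + t *\<^sub>R b)) (at t within {0..1})"
        by (simp add: has_vector_derivative_def)
    qed simp
    then show ?thesis by simp
  qed
  let ?G = "\<lambda>(t::real) x. indicator {0..1} t *\<^sub>R ?g (x + t *\<^sub>R b)"
  have G: "(\<lambda>(t, x). ?G t x) \<in> borel_measurable (lborel \<Otimes>\<^sub>M lborel)" by measurable
  have intG: "integrable (lborel \<Otimes>\<^sub>M lborel) (\<lambda>(t, x). ?G t x)"
  proof (rule lborel_pair.Fubini_integrable[OF G])
    have "(\<integral>x. norm (?G t x) \<partial>lborel) = indicator {0..1} t * (\<integral>x. norm (?g x) \<partial>lborel)" for t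
      using integral_translation[of "\<lambda>x. norm (?g x)" "t *\<^sub>R b"] by (simp add: indicator_def)
    then show "integrable lborel (\<lambda>t. \<integral>x. norm (case (t, x) of (t, x) \<Rightarrow> ?G t x) \<partial>lborel)"
      by (simp only: split) (intro integrable_mult_left, simp)
    show "AE t in lborel. integrable lborel (\<lambda>x. case (t, x) of (t, x) \<Rightarrow> ?G t x)"
      using integrable_translation[OF int'] by simp
  qed
  have "(\<integral>x. ?g x \<partial>lborel) = (\<integral>t. indicator {0..1::real} t *\<^sub>R (\<integral>x. ?g x \<partial>lborel) \<partial>lborel)"
    by (subst Bochner_Integration.integral_scaleR_left) auto
  also have "\<dots> = (\<integral>t. (\<integral>x. ?G t x \<partial>lborel) \<partial>lborel)"
    using integral_translation[of ?g] by (intro Bochner_Integration.integral_cong) auto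
  also have "\<dots> = (\<integral>x. (\<integral>t. ?G t x \<partial>lborel) \<partial>lborel)"
    by (rule lborel_pair.Fubini_integral[OF intG, symmetric])
  also have "\<dots> = (\<integral>x. f (x + b) - f x \<partial>lborel)" unfolding FTC ..
  also have "\<dots> = (\<integral>x. f (x + b) \<partial>lborel) - (\<integral>x. f x \<partial>lborel)"
    using integrable_translation[OF int] int by (rule Bochner_Integration.integral_diff)
  also have "\<dots> = 0"
    using int by (subst integral_translation) auto
  finally show ?thesis .
qed

text \<open>The semiclassical Fourier character of frequency \<open>\<eta>\<close>.\<close>

definition osc :: "real \<Rightarrow> 'a::real_inner \<Rightarrow> 'a \<Rightarrow> complex" where
  "osc h \<eta> y = exp (- (\<i> / of_real h) * of_real (y \<bullet> \<eta>))"

lemma norm_osc [simp]: "norm (osc h \<eta> y) = 1"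
proof -
  have "- (\<i> / of_real h) * of_real (y \<bullet> \<eta>) = \<i> * of_real (- (y \<bullet> \<eta>) / h)" by simp
  then show ?thesis unfolding osc_def by (simp only: norm_exp_i_times)
qed

lemma continuous_on_osc [continuous_intros]:
  "continuous_on A f \<Longrightarrow> continuous_on A g \<Longrightarrow> continuous_on A (\<lambda>x. osc h (f x) (g x))"
  unfolding osc_def by (intro continuous_intros)

lemma has_derivative_osc:
  assumes "h \<noteq> 0"
  shows "(osc h \<eta> has_derivative (\<lambda>v. - (\<i> / of_real h) * of_real (v \<bullet> \<eta>) * osc h \<eta> x)) (at x)"
proof -
  have lin: "((\<lambda>y. - (\<i> / of_real h) * of_real (y \<bullet> \<eta>)) has_derivative
      (\<lambda>v. - (\<i> / of_real h) * of_real (v \<bullet> \<eta>))) (at x)"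
    by (intro derivative_intros bounded_linear.has_derivative[OF bounded_linear_of_real]
          has_derivative_mult_right has_derivative_inner_left has_derivative_ident)
  have "(exp has_derivative (\<lambda>w. exp z * w)) (at z)" for z :: complex
    using DERIV_exp[of z] by (simp add: has_field_derivative_def)
  from has_derivative_compose[OF lin this] show ?thesis
    unfolding osc_def by (simp add: mult.commute mult.left_commute)
qed

lemma integrable_controlled:
  fixes F :: "'i \<Rightarrow> 'a::euclidean_space \<Rightarrow> complex"
  assumes F: "controlled n I (\<lambda>i y. W i * m y) F" and m: "integrable lborel m" and i: "i \<in> I"
    and g: "continuous_on UNIV g" "\<And>y. norm (g y) \<le> 1"
  shows "integrable lborel (\<lambda>y. g y * F i y)"
proof -
  obtain K where K: "K \<ge> 0" "\<And>i x. i \<in> I \<Longrightarrow> norm (F i x) \<le> K * (W i * m x)"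
    using controlled_bound[OF F] by blast
  show ?thesis
  proof (rule Bochner_Integration.integrable_bound)
    show "integrable lborel (\<lambda>y. K * W i * m y)" using m by simp
    have "continuous_on UNIV (\<lambda>y. g y * F i y)"
      using controlled_continuous[OF F i] g(1) by (intro continuous_on_mult)
    then show "(\<lambda>y. g y * F i y) \<in> borel_measurable lborel"
      by (simp add: borel_measurable_continuous_onI)
    have "norm (g y * F i y) \<le> norm (K * W i * m y)" for y
    proof -
      have "norm (g y * F i y) \<le> 1 * norm (F i y)" unfolding norm_mult by (intro mult_right_mono g) simp
      also have "\<dots> \<le> norm (K * W i * m y)"
        using K(2)[OF i, of y] abs_ge_self[of "K * W i * m y"] unfolding real_norm_def by (simp only: mult.assoc)
      finally show ?thesis .
    qed
    then show "AE y in lborel. norm (g y * F i y) \<le> norm (K * W i * m y)" by simp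
  qed
qed

text \<open>One integration by parts: \<open>1 + h \<partial>\<^sub>b\<close> is the transpose of \<open>1 - h \<partial>\<^sub>b\<close>, which multiplies the
  oscillating exponential by \<open>1 + \<i> \<eta> \<bullet> b\<close>.\<close>

lemma osc_integral_by_parts:
  fixes F :: "'i \<Rightarrow> 'a::euclidean_space \<Rightarrow> complex"
  assumes F: "controlled (Suc n) I (\<lambda>i y. W i * m y) F" and m: "integrable lborel m" and i: "i \<in> I"
    and b: "b \<in> Basis" and h: "h \<noteq> 0"
  shows "(1 + \<i> * of_real (\<eta> \<bullet> b)) * (\<integral>y. osc h \<eta> y * F i y \<partial>lborel)
       = (\<integral>y. osc h \<eta> y * (F i y + of_real h * dir_deriv b (F i) y) \<partial>lborel)"
proof -
  have F': "controlled n I (\<lambda>i y. W i * m y) (\<lambda>i. dir_deriv b (F i))" using F b by simp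
  have osc: "continuous_on UNIV (osc h \<eta>)" "\<And>y. norm (osc h \<eta> y) \<le> 1"
    by (auto intro!: continuous_intros)
  note int = integrable_controlled[OF F m i osc] integrable_controlled[OF F' m i osc]
  let ?H = "\<lambda>y. osc h \<eta> y * F i y"
  have der: "(?H has_derivative (\<lambda>v. osc h \<eta> y * frechet_derivative (F i) (at y) v
      + (- (\<i> / of_real h) * of_real (v \<bullet> \<eta>) * osc h \<eta> y) * F i y)) (at y)" for y
    by (intro has_derivative_mult has_derivative_osc controlled_differentiable[OF F i] h)
  have H': "dir_deriv b ?H = (\<lambda>y. osc h \<eta> y * dir_deriv b (F i) y
      + (- (\<i> / of_real h) * of_real (b \<bullet> \<eta>)) * (osc h \<eta> y * F i y))"
    using dir_derivI[OF der] by (auto simp: dir_deriv_def[of b "F i"] mult_ac)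
  have "0 = (\<integral>y. dir_deriv b ?H y \<partial>lborel)"
  proof (rule integral_dir_deriv_eq_0[symmetric])
    show "?H differentiable at y" for y using der by (rule differentiableI)
    show "continuous_on UNIV (dir_deriv b ?H)" unfolding H'
      using controlled_continuous[OF F i] controlled_continuous[OF F' i] by (intro continuous_intros)
    show "integrable lborel (dir_deriv b ?H)" unfolding H' using int by simp
  qed (rule int)
  also have "\<dots> = (\<integral>y. osc h \<eta> y * dir_deriv b (F i) y \<partial>lborel)
      + (- (\<i> / of_real h) * of_real (b \<bullet> \<eta>)) * (\<integral>y. ?H y \<partial>lborel)"
    unfolding H' using int by simp
  finally have "of_real h * (\<integral>y. osc h \<eta> y * dir_deriv b (F i) y \<partial>lborel) = \<i> * of_real (\<eta> \<bullet> b) * (\<integral>y. ?H y \<partial>lborel)"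
    using h by (simp add: field_simps inner_commute)
  moreover have "(\<integral>y. osc h \<eta> y * (F i y + of_real h * dir_deriv b (F i) y) \<partial>lborel)
     = (\<integral>y. ?H y \<partial>lborel) + of_real h * (\<integral>y. osc h \<eta> y * dir_deriv b (F i) y \<partial>lborel)"
    using int by (simp add: distrib_left mult.left_commute)
  ultimately show ?thesis by (simp add: distrib_right)
qed

lemma osc_integral_decay_list:
  fixes F :: "'i \<Rightarrow> 'a::euclidean_space \<Rightarrow> complex"
  assumes "controlled (length bs) I (\<lambda>i y. W i * m y) F" and m: "integrable lborel m"
    and "set bs \<subseteq> Basis" and h: "h \<noteq> 0" and W: "\<And>i. i \<in> I \<Longrightarrow> W i \<ge> 0"
  shows "\<exists>K\<ge>0. \<forall>i\<in>I. \<forall>\<eta>. (\<Prod>b\<leftarrow>bs. sqrt (1 + (\<eta> \<bullet> b)\<^sup>2)) * norm (\<integral>y. osc h \<eta> y * F i y \<partial>lborel) \<le> K * W i"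
  using assms(1,3)
proof (induction bs arbitrary: F)
  case (Nil F)
  obtain K where K: "K \<ge> 0" "\<And>i x. i \<in> I \<Longrightarrow> norm (F i x) \<le> K * (W i * m x)"
    using controlled_bound[OF Nil(1)] by blast
  have "norm (\<integral>y. osc h \<eta> y * F i y \<partial>lborel) \<le> (K * \<bar>\<integral>y. m y \<partial>lborel\<bar>) * W i" if "i \<in> I" for i \<eta>
  proof -
    have "norm (\<integral>y. osc h \<eta> y * F i y \<partial>lborel) \<le> (\<integral>y. K * W i * m y \<partial>lborel)"
    proof (rule Bochner_Integration.integral_norm_bound_integral)
      show "integrable lborel (\<lambda>y. osc h \<eta> y * F i y)"
        using Nil(1) m that by (rule integrable_controlled) (auto intro!: continuous_intros)
    qed (use K(2)[OF that] m in \<open>auto simp: norm_mult mult.assoc\<close>)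
    also have "\<dots> = K * W i * (\<integral>y. m y \<partial>lborel)" by simp
    also have "\<dots> \<le> K * W i * \<bar>\<integral>y. m y \<partial>lborel\<bar>" using W[OF that] K(1) by (intro mult_left_mono) auto
    finally show ?thesis by (simp add: mult_ac)
  qed
  then show ?case using K(1) by (intro exI[of _ "K * \<bar>\<integral>y. m y \<partial>lborel\<bar>"]) auto
next
  case (Cons b bs F)
  have "controlled (length bs) I (\<lambda>i y. W i * m y) (\<lambda>i y. F i y + of_real h * dir_deriv b (F i) y)"
    using Cons.prems controlled_Suc_imp[of "length bs" I _ F]
    by (intro controlled_add controlled_cmult[where K="\<bar>h\<bar>"]) auto
  then obtain K where K: "K \<ge> 0" and KI: "\<And>i \<eta>. i \<in> I \<Longrightarrow> (\<Prod>b\<leftarrow>bs. sqrt (1 + (\<eta> \<bullet> b)\<^sup>2)) *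
      norm (\<integral>y. osc h \<eta> y * (F i y + of_real h * dir_deriv b (F i) y) \<partial>lborel) \<le> K * W i"
    using Cons.IH[of "\<lambda>i y. F i y + of_real h * dir_deriv b (F i) y"] Cons.prems by auto
  have "norm (1 + \<i> * of_real (\<eta> \<bullet> b)) = sqrt (1 + (\<eta> \<bullet> b)\<^sup>2)" for \<eta>
    by (simp add: cmod_def)
  note sqrt_eq = this
  have "sqrt (1 + (\<eta> \<bullet> b)\<^sup>2) * norm (\<integral>y. osc h \<eta> y * F i y \<partial>lborel)
       = norm (\<integral>y. osc h \<eta> y * (F i y + of_real h * dir_deriv b (F i) y) \<partial>lborel)" if "i \<in> I" for i \<eta>
    unfolding sqrt_eq[symmetric] norm_mult[symmetric]
    using osc_integral_by_parts[of "length bs" I W m F, OF _ m that _ h, of b \<eta>] Cons.prems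
    by (auto intro!: arg_cong[where f=norm])
  note step = this
  have "(\<Prod>b\<leftarrow>b # bs. sqrt (1 + (\<eta> \<bullet> b)\<^sup>2)) * norm (\<integral>y. osc h \<eta> y * F i y \<partial>lborel) \<le> K * W i"
    if "i \<in> I" for i \<eta>
  proof -
    have "(\<Prod>b\<leftarrow>b # bs. sqrt (1 + (\<eta> \<bullet> b)\<^sup>2)) * norm (\<integral>y. osc h \<eta> y * F i y \<partial>lborel)
      = (\<Prod>b\<leftarrow>bs. sqrt (1 + (\<eta> \<bullet> b)\<^sup>2)) * (sqrt (1 + (\<eta> \<bullet> b)\<^sup>2) * norm (\<integral>y. osc h \<eta> y * F i y \<partial>lborel))"
      by simp
    then show ?thesis unfolding step[OF that] by (simp only: KI[OF that])
  qed
  with K show ?case by blast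
qed

lemma sqrt_prod_list: "sqrt (\<Prod>x\<leftarrow>xs. f x) = (\<Prod>x\<leftarrow>xs. sqrt (f x))"
  by (induction xs) (simp_all add: real_sqrt_mult)

text \<open>Each basis vector occurs \<open>k\<close> times in the list: these are the directions in which an oscillating
  integral is integrated by parts to gain \<open>k\<close> powers of its frequency.\<close>

lemma japanese_power_le_prod_list:
  obtains bs :: "'a::euclidean_space list"
  where "set bs \<subseteq> Basis" "length bs = k * DIM('a)"
    "\<And>\<eta>. japanese \<eta> ^ k \<le> (\<Prod>b\<leftarrow>bs. sqrt (1 + (\<eta> \<bullet> b)\<^sup>2))"
proof -
  obtain bl :: "'a list" where bl: "set bl = Basis" "distinct bl"
    using finite_distinct_list[OF finite_Basis] by blast
  define bs where "bs = concat (replicate k bl)"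
  have "length bs = k * DIM('a)"
    using distinct_card[OF bl(2)] bl(1) by (simp add: bs_def length_concat sum_list_replicate)
  moreover have "set bs \<subseteq> Basis" using bl by (auto simp: bs_def)
  moreover have "japanese \<eta> ^ k \<le> (\<Prod>b\<leftarrow>bs. sqrt (1 + (\<eta> \<bullet> b)\<^sup>2))" for \<eta> :: 'a
  proof -
    have "japanese \<eta> \<le> sqrt (\<Prod>b\<in>Basis. 1 + (\<eta> \<bullet> b)\<^sup>2)"
      unfolding japanese_def norm_square_Basis by (intro real_sqrt_le_mono prod_one_plus_ge) auto
    also have "\<dots> = (\<Prod>b\<leftarrow>bl. sqrt (1 + (\<eta> \<bullet> b)\<^sup>2))"
      unfolding bl(1)[symmetric] prod.distinct_set_conv_list[OF bl(2)] sqrt_prod_list ..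
    finally have "japanese \<eta> ^ k \<le> (\<Prod>b\<leftarrow>bl. sqrt (1 + (\<eta> \<bullet> b)\<^sup>2)) ^ k"
      by (intro power_mono) (auto simp: less_imp_le)
    also have "\<dots> = (\<Prod>b\<leftarrow>bs. sqrt (1 + (\<eta> \<bullet> b)\<^sup>2))"
      unfolding bs_def by (induction k) simp_all
    finally show ?thesis .
  qed
  ultimately show thesis using that by blast
qed

text \<open>The source of all decay in dual variables below: smoothness of the amplitude, uniformly over the
  family, is traded for powers of the frequency.\<close>

lemma osc_integral_decay:
  fixes F :: "'i \<Rightarrow> 'a::euclidean_space \<Rightarrow> complex"
  assumes F: "controlled (k * DIM('a)) I (\<lambda>i y. W i * m y) F" and m: "integrable lborel m"
    and h: "h \<noteq> 0" and W: "\<And>i. i \<in> I \<Longrightarrow> W i \<ge> 0"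
  shows "\<exists>K\<ge>0. \<forall>i\<in>I. \<forall>\<eta>. norm (\<integral>y. osc h \<eta> y * F i y \<partial>lborel) \<le> K * W i * decay k \<eta>"
proof -
  obtain bs :: "'a list" where sub: "set bs \<subseteq> Basis" and len: "length bs = k * DIM('a)"
    and prod: "\<And>\<eta>. japanese \<eta> ^ k \<le> (\<Prod>b\<leftarrow>bs. sqrt (1 + (\<eta> \<bullet> b)\<^sup>2))"
    using japanese_power_le_prod_list[where k=k and 'a='a] by blast
  obtain K where K: "K \<ge> 0" and KI: "\<And>i \<eta>. i \<in> I \<Longrightarrow> (\<Prod>b\<leftarrow>bs. sqrt (1 + (\<eta> \<bullet> b)\<^sup>2)) *
      norm (\<integral>y. osc h \<eta> y * F i y \<partial>lborel) \<le> K * W i"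
    using osc_integral_decay_list[of bs I W m F h] F m sub h W unfolding len by blast
  have "norm (\<integral>y. osc h \<eta> y * F i y \<partial>lborel) \<le> K * W i * decay k \<eta>" if "i \<in> I" for i \<eta>
  proof -
    have "japanese \<eta> ^ k * norm (\<integral>y. osc h \<eta> y * F i y \<partial>lborel) \<le> K * W i"
      by (rule order_trans[OF mult_right_mono[OF prod] KI[OF that]]) simp
    then show ?thesis by (simp add: field_simps)
  qed
  with K show ?thesis by blast
qed

lemma norm_le_japanese: "norm x \<le> japanese x"
  unfolding japanese_def by (rule real_le_rsqrt) simp

lemma japanese_triangle: "japanese (x + y) \<le> 2 * japanese x * japanese y"
proof -
  have "(norm (x + y))\<^sup>2 \<le> (norm x + norm y)\<^sup>2" by (intro power_mono norm_triangle_ineq) simp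
  also have "\<dots> \<le> 2 * (norm x)\<^sup>2 + 2 * (norm y)\<^sup>2"
    using zero_le_power2[of "norm x - norm y"] by (simp add: power2_eq_square algebra_simps)
  finally have "(japanese (x + y))\<^sup>2 \<le> 1 + 2 * (norm x)\<^sup>2 + 2 * (norm y)\<^sup>2"
    by (simp add: japanese_square)
  also have "\<dots> \<le> (2 * japanese x * japanese y)\<^sup>2"
    using mult_nonneg_nonneg[of "(norm x)\<^sup>2" "(norm y)\<^sup>2"]
    by (simp add: power_mult_distrib japanese_square algebra_simps)
  finally show ?thesis by (rule power2_le_imp_le) (simp add: less_imp_le)
qed

lemma lborel_integral_pair:
  fixes f :: "'a::euclidean_space \<times> 'b::euclidean_space \<Rightarrow> complex"
  assumes "integrable lborel f"
  shows "(\<integral>z. f z \<partial>lborel) = (\<integral>y. (\<integral>x. f (x, y) \<partial>lborel) \<partial>lborel)"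
    and "(\<integral>z. f z \<partial>lborel) = (\<integral>x. (\<integral>y. f (x, y) \<partial>lborel) \<partial>lborel)"
proof -
  have f: "integrable (lborel \<Otimes>\<^sub>M lborel) f" using assms by (simp only: lborel_prod)
  have "(\<lambda>(x, y). f (x, y)) = f" by simp
  then show "(\<integral>z. f z \<partial>lborel) = (\<integral>y. (\<integral>x. f (x, y) \<partial>lborel) \<partial>lborel)"
    using lborel_pair.integral_snd[of "\<lambda>x y. f (x, y)"] f by (simp only: lborel_prod)
  show "(\<integral>z. f z \<partial>lborel) = (\<integral>x. (\<integral>y. f (x, y) \<partial>lborel) \<partial>lborel)"
    using lborel_pair.integral_fst'[OF f] by (simp only: lborel_prod)
qed

lemma le_norm_real: "a \<le> b \<Longrightarrow> a \<le> norm (b :: real)"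
  by simp

lemma japanese_Pair_le: "japanese (x, y) \<le> japanese x * japanese y"
proof (rule power2_le_imp_le)
  show "(japanese (x, y))\<^sup>2 \<le> (japanese x * japanese y)\<^sup>2"
    using mult_nonneg_nonneg[of "(norm x)\<^sup>2" "(norm y)\<^sup>2"]
    by (simp add: power_mult_distrib japanese_square norm_Pair algebra_simps)
qed (simp add: less_imp_le)

lemma japanese_linear_le:
  fixes f :: "'a::euclidean_space \<Rightarrow> 'b::euclidean_space"
  assumes "linear f"
  shows "\<exists>K>0. \<forall>x. japanese (f x) \<le> K * japanese x"
proof -
  obtain K where K: "K > 0" "\<And>x. norm (f x) \<le> norm x * K"
    using bounded_linear.pos_bounded[OF linear_conv_bounded_linear[THEN iffD1, OF assms]] by blast
  have "japanese (f x) \<le> (1 + K) * japanese x" for x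
  proof (rule power2_le_imp_le)
    have "(norm (f x))\<^sup>2 \<le> (norm x * K)\<^sup>2" using K(2) by (intro power_mono) auto
    moreover have "((1 + K) * japanese x)\<^sup>2 = (1 + K)\<^sup>2 * (1 + (norm x)\<^sup>2)"
      by (simp add: power_mult_distrib japanese_square)
    then have "((1 + K) * japanese x)\<^sup>2 = 1 + (norm x * K)\<^sup>2 + (2 * K + K\<^sup>2 + (1 + 2 * K) * (norm x)\<^sup>2)"
      by (simp add: power2_eq_square algebra_simps)
    moreover have "0 \<le> 2 * K + K\<^sup>2 + (1 + 2 * K) * (norm x)\<^sup>2" using K(1) by simp
    ultimately show "(japanese (f x))\<^sup>2 \<le> ((1 + K) * japanese x)\<^sup>2" unfolding japanese_square by linarith
  qed (use K(1) in \<open>simp add: less_imp_le\<close>)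
  then show ?thesis using K(1) by (intro exI[of _ "1 + K"]) auto
qed

lemma integrable_pair_japanese:
  fixes F :: "'a::euclidean_space \<times> 'a \<Rightarrow> complex"
  assumes F: "F \<in> borel_measurable borel"
    and bound: "\<And>x y. norm (F (x, y)) \<le> K * (decay (4 * DIM('a)) x * decay (4 * DIM('a)) y)"
  shows "integrable (lborel \<Otimes>\<^sub>M lborel) F"
  unfolding lborel_prod
proof (rule Bochner_Integration.integrable_bound)
  show "integrable lborel (\<lambda>z::'a \<times> 'a. K * decay (4 * DIM('a)) z)"
    by (intro integrable_mult_right integrable_japanese) simp
  have K: "K \<ge> 0" using order_trans[OF norm_ge_zero bound[of 0 0]] by (simp add: japanese_def)
  show "AE z in lborel. norm (F z) \<le> norm (K * decay (4 * DIM('a)) z)"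
  proof (intro AE_I2)
    fix z :: "'a \<times> 'a"
    obtain x y where z: "z = (x, y)" by (cases z)
    have "japanese (x, y) ^ (4 * DIM('a)) \<le> (japanese x * japanese y) ^ (4 * DIM('a))"
      by (intro power_mono japanese_Pair_le) (simp add: less_imp_le)
    then have "decay (4 * DIM('a)) x * decay (4 * DIM('a)) y \<le> decay (4 * DIM('a)) z"
      unfolding z by (simp add: power_mult_distrib inverse_mult_distrib[symmetric] del: inverse_mult_distrib)
    from order_trans[OF bound mult_left_mono[OF this K]]
    show "norm (F z) \<le> norm (K * decay (4 * DIM('a)) z)"
      unfolding z using K by simp
  qed
qed (use F in simp)

lemma integral_reflect:
  fixes f :: "'a::euclidean_space \<Rightarrow> complex"
  assumes [measurable]: "f \<in> borel_measurable borel"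
  shows "(\<integral>y. f (a - y) \<partial>lborel) = (\<integral>y. f y \<partial>lborel)"
proof -
  have "(lborel :: 'a measure) = distr lborel borel (\<lambda>y. a - y)"
    using lborel_affine[of "-1" a] by (simp add: density_1)
  then have "(\<integral>y. f y \<partial>lborel) = (\<integral>y. f y \<partial>distr lborel borel (\<lambda>y. a - y))" by simp
  also have "\<dots> = (\<integral>y. f (a - y) \<partial>lborel)" by (rule integral_distr) measurable
  finally show ?thesis ..
qed

lemma japanese_minus [simp]: "japanese (- x) = japanese x"
  by (simp add: japanese_def)

lemma japanese_power_triangle:
  "decay N (x + y) * decay N y \<le> 2 ^ N * decay N x"
proof -
  have "japanese x ^ N \<le> (2 * japanese (x + y) * japanese y) ^ N"
    using japanese_triangle[of "x + y" "- y"] by (intro power_mono) (auto simp: less_imp_le)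
  then show ?thesis by (simp add: power_mult_distrib field_simps)
qed

lemma sets_borel_pair_lborel:
  "sets ((borel :: 'a::second_countable_topology measure) \<Otimes>\<^sub>M (lborel :: 'b::euclidean_space measure)) = sets borel"
  using sets_pair_measure_cong[OF refl sets_lborel, of "borel :: 'a measure"] by (metis borel_prod)

lemma continuous_AE_eq_imp_eq:
  fixes f g :: "'a::euclidean_space \<Rightarrow> complex"
  assumes f: "continuous_on UNIV f" and g: "continuous_on UNIV g" and eq: "AE x in lborel. f x = g x"
  shows "f = g"
proof (rule ccontr)
  assume "f \<noteq> g"
  let ?U = "{x. f x \<noteq> g x}"
  have "open ?U"
    using open_Collect_neq[OF f g] by simp
  moreover have "?U \<noteq> {}" using \<open>f \<noteq> g\<close> by auto
  ultimately have "\<not> negligible ?U" by (rule open_not_negligible)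
  moreover have "?U \<in> null_sets lborel"
    using eq \<open>open ?U\<close> AE_iff_null_sets[of ?U lborel] by (simp add: borel_open)
  then have "negligible ?U" by (simp add: negligible_iff_null_sets null_sets_completionI)
  ultimately show False by simp
qed

section \<open>Square integrable functions and operators\<close>

lemma L2I: "u \<in> borel_measurable M \<Longrightarrow> integrable M (\<lambda>x. (norm (u x))\<^sup>2) \<Longrightarrow> u \<in> L2 M"
  by (simp add: L2_def)

lemma L2_measurable: "u \<in> L2 M \<Longrightarrow> u \<in> borel_measurable M"
  by (simp add: L2_def)

lemma L2_integrable: "u \<in> L2 M \<Longrightarrow> integrable M (\<lambda>x. (norm (u x))\<^sup>2)"
  by (simp add: L2_def)

lemma norm_add_square_le: "(norm (a + b :: complex))\<^sup>2 \<le> 2 * (norm a)\<^sup>2 + 2 * (norm b)\<^sup>2"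
proof -
  have "(norm (a + b))\<^sup>2 \<le> (norm a + norm b)\<^sup>2" by (intro power_mono norm_triangle_ineq) simp
  also have "\<dots> \<le> 2 * (norm a)\<^sup>2 + 2 * (norm b)\<^sup>2"
    using zero_le_power2[of "norm a - norm b"] by (simp add: power2_eq_square algebra_simps)
  finally show ?thesis .
qed

lemma L2_lincomb:
  assumes u: "u \<in> L2 M" and v: "v \<in> L2 M"
  shows "(\<lambda>x. c * u x + d * v x) \<in> L2 M"
proof (rule L2I)
  note [measurable] = L2_measurable[OF u] L2_measurable[OF v]
  show "(\<lambda>x. c * u x + d * v x) \<in> borel_measurable M" by measurable
  show "integrable M (\<lambda>x. (norm (c * u x + d * v x))\<^sup>2)"
  proof (rule Bochner_Integration.integrable_bound)
    show "integrable M (\<lambda>x. 2 * (norm c)\<^sup>2 * (norm (u x))\<^sup>2 + 2 * (norm d)\<^sup>2 * (norm (v x))\<^sup>2)"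
      using L2_integrable[OF u] L2_integrable[OF v] by simp
    show "AE x in M. norm ((norm (c * u x + d * v x))\<^sup>2)
        \<le> norm (2 * (norm c)\<^sup>2 * (norm (u x))\<^sup>2 + 2 * (norm d)\<^sup>2 * (norm (v x))\<^sup>2)"
      using norm_add_square_le[of "c * u _" "d * v _"] by (simp add: norm_mult power_mult_distrib mult_ac)
  qed measurable
qed

lemma L2_mult_cnj_integrable:
  assumes u: "u \<in> L2 M" and v: "v \<in> L2 M"
  shows "integrable M (\<lambda>x. u x * cnj (v x))"
proof (rule Bochner_Integration.integrable_bound)
  note [measurable] = L2_measurable[OF u] L2_measurable[OF v]
  show "integrable M (\<lambda>x. (norm (u x))\<^sup>2 + (norm (v x))\<^sup>2)"
    using L2_integrable[OF u] L2_integrable[OF v] by simp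
  have "norm a * norm b \<le> (norm a)\<^sup>2 + (norm b)\<^sup>2" for a b :: complex
    using sum_squares_bound[of "norm a" "norm b"] mult_nonneg_nonneg[OF norm_ge_zero norm_ge_zero, of a b]
    by linarith
  then show "AE x in M. norm (u x * cnj (v x)) \<le> norm ((norm (u x))\<^sup>2 + (norm (v x))\<^sup>2)"
    by (simp add: norm_mult)
  show "(\<lambda>x. u x * cnj (v x)) \<in> borel_measurable M"
    by (rule borel_measurable_times, measurable)
       (rule measurable_compose[OF L2_measurable[OF v] borel_measurable_continuous_onI], intro continuous_intros)
qed

lemma L2_cnj:
  assumes u: "u \<in> L2 M"
  shows "(\<lambda>x. cnj (u x)) \<in> L2 M"
proof (rule L2I)
  have "cnj \<in> borel_measurable borel"
    by (intro borel_measurable_continuous_onI) (simp add: continuous_on_cnj)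
  then show "(\<lambda>x. cnj (u x)) \<in> borel_measurable M" by (rule measurable_compose[OF L2_measurable[OF u]])
qed (simp add: L2_integrable[OF u])

lemma L2_mult_integrable: "u \<in> L2 M \<Longrightarrow> v \<in> L2 M \<Longrightarrow> integrable M (\<lambda>x. u x * v x)"
  using L2_mult_cnj_integrable[of u M "\<lambda>x. cnj (v x)"] L2_cnj[of v M] by simp

lemma l2_norm_nonneg [simp]: "l2_norm M u \<ge> 0"
  by (simp add: l2_norm_def)

lemma l2_norm_square: "(l2_norm M u)\<^sup>2 = (\<integral>x. (norm (u x))\<^sup>2 \<partial>M)"
  by (simp add: l2_norm_def)

lemma l2_norm_eq_0_imp:
  assumes "u \<in> L2 M" "l2_norm M u = 0"
  shows "AE x in M. u x = 0"
proof -
  have "(\<integral>x. (norm (u x))\<^sup>2 \<partial>M) = 0" using assms(2) l2_norm_square[of M u] by simp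
  then show ?thesis
    using integral_nonneg_eq_0_iff_AE[OF L2_integrable[OF assms(1)]] by simp
qed

lemma l2_norm_cong_AE:
  assumes u: "u \<in> borel_measurable M" and v: "v \<in> borel_measurable M" and eq: "AE x in M. u x = v x"
  shows "l2_norm M u = l2_norm M v"
proof -
  note [measurable] = u v
  have "(\<integral>x. (norm (u x))\<^sup>2 \<partial>M) = (\<integral>x. (norm (v x))\<^sup>2 \<partial>M)"
    by (rule integral_cong_AE) (use eq in auto)
  then show ?thesis by (simp add: l2_norm_def)
qed

lemma l2_norm_zero: "l2_norm M (\<lambda>_. 0) = 0"
  by (simp add: l2_norm_def)

lemma l2_inner_self: "l2_inner M u u = of_real ((l2_norm M u)\<^sup>2)"
  unfolding l2_inner_def l2_norm_square by (simp add: complex_norm_square[symmetric] flip: of_real_power)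

text \<open>The difference of the two arguments has norm zero, and so has its image.\<close>

lemma bounded_operator_AE_cong:
  assumes A: "bounded_operator M V A" and V: "V \<subseteq> L2 M"
    and closed: "\<And>u v c d. u \<in> V \<Longrightarrow> v \<in> V \<Longrightarrow> (\<lambda>x. c * u x + d * v x) \<in> V"
    and u: "u \<in> V" and v: "v \<in> V" and eq: "AE x in M. u x = v x"
  shows "AE x in M. A u x = A v x"
proof -
  let ?w = "\<lambda>x. 1 * u x + (-1) * v x"
  have w: "?w \<in> V" by (rule closed[OF u v])
  obtain K where K: "l2_norm M (A ?w) \<le> K * l2_norm M ?w"
    using A w by (auto simp: bounded_operator_def)
  have "l2_norm M ?w = l2_norm M (\<lambda>_. 0)"
    using w V eq by (intro l2_norm_cong_AE) (auto dest: L2_measurable)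
  then have "l2_norm M (A ?w) = 0" using K by (intro antisym) (simp_all add: l2_norm_zero)
  moreover have "A ?w \<in> L2 M" using A w V by (auto simp: bounded_operator_def linear_operator_def)
  ultimately have "AE x in M. A ?w x = 0" by (intro l2_norm_eq_0_imp)
  moreover have "AE x in M. A ?w x = 1 * A u x + (-1) * A v x"
    using A u v unfolding bounded_operator_def linear_operator_def by blast
  ultimately show ?thesis by eventually_elim simp
qed

lemma unitary_norm:
  assumes "unitary_operator M V N W F" "u \<in> V"
  shows "l2_norm N (F u) = l2_norm M u"
proof -
  have "l2_inner N (F u) (F u) = l2_inner M u u"
    using assms by (simp add: unitary_operator_def)
  then have "(l2_norm N (F u))\<^sup>2 = (l2_norm M u)\<^sup>2"
    unfolding l2_inner_self of_real_eq_iff .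
  then show ?thesis by (simp add: power2_eq_iff_nonneg)
qed

text \<open>The adjoint of a unitary operator is its inverse: a preimage \<open>u\<close> of \<open>w\<close> solves the defining
  equation, and two solutions differ by a vector orthogonal to itself.\<close>

lemma l2_adjoint_unitary:
  assumes F: "unitary_operator M (L2 M) N W F" and W: "W \<subseteq> L2 N"
    and u: "u \<in> L2 M" and w: "w \<in> L2 N" and eq: "AE x in N. F u x = w x"
  shows "l2_adjoint M (L2 M) N F w \<in> L2 M" "AE x in M. l2_adjoint M (L2 M) N F w x = u x"
proof -
  have FW: "F s \<in> L2 N" if "s \<in> L2 M" for s
    using F that W by (auto simp: unitary_operator_def linear_operator_def)
  have solves: "l2_inner N (F s) w = l2_inner M s u" if s: "s \<in> L2 M" for s
  proof -
    have "l2_inner N (F s) w = l2_inner N (F s) (F u)"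
      unfolding l2_inner_def
      using L2_mult_cnj_integrable[OF FW[OF s] w] L2_mult_cnj_integrable[OF FW[OF s] FW[OF u]] eq
      by (intro integral_cong_AE) auto
    also have "\<dots> = l2_inner M s u" using F s u by (simp add: unitary_operator_def)
    finally show ?thesis .
  qed
  let ?v = "l2_adjoint M (L2 M) N F w"
  have "?v \<in> L2 M \<and> (\<forall>s\<in>L2 M. l2_inner N (F s) w = l2_inner M s ?v)"
    unfolding l2_adjoint_def by (rule someI[of _ u]) (use u solves in auto)
  then have v: "?v \<in> L2 M" and inner: "\<And>s. s \<in> L2 M \<Longrightarrow> l2_inner N (F s) w = l2_inner M s ?v" by auto
  let ?d = "\<lambda>x. 1 * ?v x + (-1) * u x"
  have d: "?d \<in> L2 M" by (rule L2_lincomb[OF v u])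
  have "l2_inner M ?d ?d = (\<integral>x. ?d x * cnj (?v x) - ?d x * cnj (u x) \<partial>M)"
    unfolding l2_inner_def by (intro Bochner_Integration.integral_cong) (simp_all add: algebra_simps)
  also have "\<dots> = l2_inner M ?d ?v - l2_inner M ?d u"
    unfolding l2_inner_def
    by (rule Bochner_Integration.integral_diff) (intro L2_mult_cnj_integrable d v u)+
  also have "\<dots> = 0" using inner[OF d] solves[OF d] by simp
  finally have "l2_norm M ?d = 0" by (simp add: l2_inner_self)
  from l2_norm_eq_0_imp[OF d this] show "AE x in M. ?v x = u x" by simp
  show "?v \<in> L2 M" by (rule v)
qed

text \<open>On the range of \<open>F\<close> the adjoint returns preimages, so linearity and the norm bound are read off
  after applying \<open>F\<close>.\<close>

lemma bounded_operator_unitary_conj: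
  assumes F: "unitary_operator M (L2 M) N W F" and W: "W \<subseteq> L2 N"
    and closed: "\<And>u v c d. u \<in> W \<Longrightarrow> v \<in> W \<Longrightarrow> (\<lambda>x. c * u x + d * v x) \<in> W"
    and A: "bounded_operator N W A"
  shows "bounded_operator M (L2 M) (l2_adjoint M (L2 M) N F \<circ> A \<circ> F)"
proof -
  let ?S = "l2_adjoint M (L2 M) N F"
  have FW: "F u \<in> W" if "u \<in> L2 M" for u
    using F that by (auto simp: unitary_operator_def linear_operator_def)
  have AW: "A w \<in> W" if "w \<in> W" for w
    using A that by (auto simp: bounded_operator_def linear_operator_def)
  have S: "\<exists>u\<in>L2 M. (AE x in N. F u x = w x) \<and> ?S w \<in> L2 M \<and> (AE x in M. ?S w x = u x)" if w: "w \<in> W" for w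
  proof -
    obtain u where "u \<in> L2 M" "AE x in N. F u x = w x" using F w by (auto simp: unitary_operator_def)
    then show ?thesis using l2_adjoint_unitary[OF F W _ _] w W by blast
  qed
  have "AE x in M. ?S (A (F (\<lambda>y. c * u y + d * v y))) x = c * ?S (A (F u)) x + d * ?S (A (F v)) x"
    if u: "u \<in> L2 M" and v: "v \<in> L2 M" for u v c d
  proof -
    obtain p where p: "p \<in> L2 M" "AE x in N. F p x = A (F u) x" "AE x in M. ?S (A (F u)) x = p x"
      using S[OF AW[OF FW[OF u]]] by auto
    obtain q where q: "q \<in> L2 M" "AE x in N. F q x = A (F v) x" "AE x in M. ?S (A (F v)) x = q x"
      using S[OF AW[OF FW[OF v]]] by auto
    let ?s = "\<lambda>y. c * u y + d * v y" and ?r = "\<lambda>y. c * p y + d * q y"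
    have s: "?s \<in> L2 M" and r: "?r \<in> L2 M" by (intro L2_lincomb u v p(1) q(1))+
    have "AE x in N. F ?s x = c * F u x + d * F v x"
      using F u v by (auto simp: unitary_operator_def linear_operator_def)
    then have "AE x in N. A (F ?s) x = A (\<lambda>x. c * F u x + d * F v x) x"
      by (intro bounded_operator_AE_cong[OF A W] closed FW s u v)
    moreover have "AE x in N. A (\<lambda>x. c * F u x + d * F v x) x = c * A (F u) x + d * A (F v) x"
      using A FW[OF u] FW[OF v] by (auto simp: bounded_operator_def linear_operator_def)
    moreover have "AE x in N. F ?r x = c * F p x + d * F q x"
      using F p(1) q(1) by (auto simp: unitary_operator_def linear_operator_def)
    ultimately have "AE x in N. F ?r x = A (F ?s) x"
      using p(2) q(2) by eventually_elim simp
    then have "AE x in M. ?S (A (F ?s)) x = ?r x"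
      using W AW[OF FW[OF s]] by (intro l2_adjoint_unitary[OF F W r]) auto
    then show ?thesis using p(3) q(3) by eventually_elim simp
  qed
  moreover have "?S (A (F u)) \<in> L2 M" if "u \<in> L2 M" for u
    using S[OF AW[OF FW[OF that]]] by auto
  moreover have "\<exists>K. \<forall>u\<in>L2 M. l2_norm M (?S (A (F u))) \<le> K * l2_norm M u"
  proof -
    obtain K where K: "\<And>w. w \<in> W \<Longrightarrow> l2_norm N (A w) \<le> K * l2_norm N w"
      using A by (auto simp: bounded_operator_def)
    have "l2_norm M (?S (A (F u))) \<le> K * l2_norm M u" if u: "u \<in> L2 M" for u
    proof -
      obtain p where p: "p \<in> L2 M" "AE x in N. F p x = A (F u) x" "AE x in M. ?S (A (F u)) x = p x"
        "?S (A (F u)) \<in> L2 M"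
        using S[OF AW[OF FW[OF u]]] by auto
      have "l2_norm M (?S (A (F u))) = l2_norm M p"
        using p by (intro l2_norm_cong_AE) (auto dest: L2_measurable)
      also have "\<dots> = l2_norm N (F p)" using unitary_norm[OF F p(1)] by simp
      also have "\<dots> = l2_norm N (A (F u))"
        using p FW[OF p(1)] AW[OF FW[OF u]] W by (intro l2_norm_cong_AE) (auto dest!: L2_measurable)
      also have "\<dots> \<le> K * l2_norm N (F u)" by (rule K[OF FW[OF u]])
      also have "\<dots> = K * l2_norm M u" using unitary_norm[OF F u] by simp
      finally show ?thesis .
    qed
    then show ?thesis by blast
  qed
  ultimately show ?thesis unfolding bounded_operator_def linear_operator_def by simp
qed

text \<open>The difference of the images of \<open>v\<close> equals that of the images of \<open>v - s k\<close>, which tends to zero.\<close>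

lemma bounded_operators_agree_limit:
  assumes F: "bounded_operator M (L2 M) F" and G: "bounded_operator M (L2 M) G"
    and v: "v \<in> L2 M" and s: "\<And>k. s k \<in> L2 M" and eq: "\<And>k. AE x in M. F (s k) x = G (s k) x"
    and lim: "(\<lambda>k. l2_norm M (\<lambda>x. v x - s k x)) \<longlonglongrightarrow> 0"
  shows "AE x in M. F v x = G v x"
proof -
  obtain KF where KF: "\<And>u. u \<in> L2 M \<Longrightarrow> l2_norm M (F u) \<le> KF * l2_norm M u" using F by (auto simp: bounded_operator_def)
  obtain KG where KG: "\<And>u. u \<in> L2 M \<Longrightarrow> l2_norm M (G u) \<le> KG * l2_norm M u" using G by (auto simp: bounded_operator_def)
  have FL2: "F u \<in> L2 M" and GL2: "G u \<in> L2 M" if "u \<in> L2 M" for u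
    using F G that by (auto simp: bounded_operator_def linear_operator_def)
  let ?d = "\<lambda>x. 1 * F v x + (-1) * G v x"
  have d: "?d \<in> L2 M" by (intro L2_lincomb FL2 GL2 v)
  have bound: "(l2_norm M ?d)\<^sup>2 \<le> (2 * KF\<^sup>2 + 2 * KG\<^sup>2) * (l2_norm M (\<lambda>x. v x - s k x))\<^sup>2" for k
  proof -
    let ?r = "\<lambda>x. 1 * v x + (-1) * s k x"
    have r: "?r \<in> L2 M" by (intro L2_lincomb v s)
    have Fr: "AE x in M. F ?r x = 1 * F v x + (-1) * F (s k) x" and Gr: "AE x in M. G ?r x = 1 * G v x + (-1) * G (s k) x"
      using F G v s[of k] unfolding bounded_operator_def linear_operator_def by blast+
    have "(l2_norm M ?d)\<^sup>2 \<le> (\<integral>x. 2 * (norm (F ?r x))\<^sup>2 + 2 * (norm (G ?r x))\<^sup>2 \<partial>M)"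
      unfolding l2_norm_square
    proof (rule integral_mono_AE)
      show "integrable M (\<lambda>x. (norm (?d x))\<^sup>2)" using d by (rule L2_integrable)
      show "integrable M (\<lambda>x. 2 * (norm (F ?r x))\<^sup>2 + 2 * (norm (G ?r x))\<^sup>2)"
        using L2_integrable[OF FL2[OF r]] L2_integrable[OF GL2[OF r]] by simp
      show "AE x in M. (norm (?d x))\<^sup>2 \<le> 2 * (norm (F ?r x))\<^sup>2 + 2 * (norm (G ?r x))\<^sup>2"
        using Fr Gr eq[of k]
      proof eventually_elim
        case (elim x)
        then have "?d x = F ?r x + - G ?r x" by simp
        then show ?case using norm_add_square_le[of "F ?r x" "- G ?r x"] by (simp only: norm_minus_cancel)
      qed
    qed
    also have "\<dots> = 2 * (l2_norm M (F ?r))\<^sup>2 + 2 * (l2_norm M (G ?r))\<^sup>2"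
      unfolding l2_norm_square using L2_integrable[OF FL2[OF r]] L2_integrable[OF GL2[OF r]] by simp
    also have "\<dots> \<le> 2 * (KF * l2_norm M ?r)\<^sup>2 + 2 * (KG * l2_norm M ?r)\<^sup>2"
      by (intro add_mono mult_left_mono power_mono KF KG r) simp_all
    finally show ?thesis by (simp add: power_mult_distrib algebra_simps)
  qed
  have "(\<lambda>k. (2 * KF\<^sup>2 + 2 * KG\<^sup>2) * (l2_norm M (\<lambda>x. v x - s k x))\<^sup>2) \<longlonglongrightarrow> (2 * KF\<^sup>2 + 2 * KG\<^sup>2) * 0\<^sup>2"
    by (intro tendsto_intros lim)
  then have "(l2_norm M ?d)\<^sup>2 \<le> (2 * KF\<^sup>2 + 2 * KG\<^sup>2) * 0\<^sup>2"
    by (rule LIMSEQ_le_const) (use bound in auto)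
  then have "l2_norm M ?d = 0" by simp
  from l2_norm_eq_0_imp[OF d this] show ?thesis by simp
qed

section \<open>Schwartz functions\<close>

lemma controlled_linear:
  fixes l :: "'a::euclidean_space \<Rightarrow> complex"
  assumes "linear l"
  shows "controlled n I (\<lambda>_. japanese) (\<lambda>_. l)"
proof -
  have bl: "bounded_linear l" using assms by (rule linear_conv_bounded_linear[THEN iffD1])
  obtain K where K: "K \<ge> 0" "\<And>x. norm (l x) \<le> norm x * K"
    using bounded_linear.nonneg_bounded[OF bl] by blast
  have bd: "norm (l x) \<le> K * japanese x" for x
    using K(2)[of x] mult_left_mono[OF norm_le_japanese[of x] K(1)] by (simp add: mult.commute)
  show ?thesis
  proof (cases n)
    case 0
    then show ?thesis using bd K(1) linear_continuous_on[OF bl] by auto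
  next
    case (Suc k)
    have "dir_deriv b l = (\<lambda>_. l b)" for b
      using dir_derivI[OF bounded_linear_imp_has_derivative[OF bl]] by auto
    moreover have "controlled k I (\<lambda>_. japanese) (\<lambda>_ (_::'a). l b)" for b
      by (rule controlled_weaken[where K=1, OF controlled_const[where K="norm (l b)"]])
         (auto simp: japanese_ge_1)
    moreover have "l differentiable at x" for x
      using bounded_linear_imp_differentiable[OF bl] .
    ultimately show ?thesis using Suc bd K(1) by auto
  qed
qed

text \<open>A derivative multiplies \<open>g i\<close> by a factor of linear growth; one more power of decay absorbs it.\<close>

lemma controlled_exponential:
  fixes g :: "'i \<Rightarrow> 'a::euclidean_space \<Rightarrow> complex"
  assumes diff: "\<And>i x. i \<in> I \<Longrightarrow> g i differentiable at x"
    and deriv: "\<And>i b. i \<in> I \<Longrightarrow> b \<in> Basis \<Longrightarrow> dir_deriv b (g i) = (\<lambda>y. l b i y * g i y)"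
    and l: "\<And>b n. b \<in> Basis \<Longrightarrow> controlled n I (\<lambda>_. japanese) (l b)"
    and decay: "\<And>N. \<exists>K\<ge>0. \<forall>i\<in>I. \<forall>y. norm (g i y) \<le> K * decay N y"
  shows "controlled n I (\<lambda>_ y. decay N y) g"
proof (induction n arbitrary: N)
  case 0
  have "continuous_on UNIV (g i)" if "i \<in> I" for i
    using diff[OF that] by (intro differentiable_imp_continuous_on) (simp add: differentiable_on_def)
  then show ?case using decay by simp
next
  case (Suc n)
  have "controlled n I (\<lambda>_ y. decay N y) (\<lambda>i. dir_deriv b (g i))" if b: "b \<in> Basis" for b
  proof (rule controlled_cong)
    show "controlled n I (\<lambda>_ y. decay N y) (\<lambda>i y. l b i y * g i y)"
      by (rule controlled_weaken[where K=1, OF controlled_mult[OF l[OF b] Suc.IH[of "Suc N"]]])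
         (simp_all add: field_simps)
  qed (simp add: deriv[OF _ b])
  then show ?case using diff decay by simp
qed

lemma power_le_exp: "0 \<le> (x::real) \<Longrightarrow> x ^ N \<le> real N ^ N * exp x"
proof (cases "N = 0")
  case False
  assume x: "0 \<le> x"
  have "x / real N \<le> exp (x / real N)" using exp_ge_add_one_self[of "x / real N"] by linarith
  then have "(x / real N) ^ N \<le> exp (x / real N) ^ N" using x by (intro power_mono) auto
  also have "\<dots> = exp x" using False by (simp add: exp_of_nat_mult[symmetric])
  finally show ?thesis using False by (simp add: power_divide field_simps)
qed simp

lemma gaussian_decay:
  assumes c: "c > 0"
  shows "\<exists>K\<ge>0. \<forall>y::'a::real_normed_vector. exp (- c * (norm y)\<^sup>2) \<le> K * decay N y"
proof (intro exI[of _ "(real N / c) ^ N * exp c"] conjI allI)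
  fix y :: 'a
  have "(c * (japanese y)\<^sup>2) ^ N \<le> real N ^ N * exp (c * (japanese y)\<^sup>2)"
    using c by (intro power_le_exp) simp
  moreover have "exp (c * (japanese y)\<^sup>2) * exp (- c * (norm y)\<^sup>2) = exp c"
    by (simp add: japanese_square algebra_simps flip: exp_add)
  ultimately have "(c * (japanese y)\<^sup>2) ^ N * exp (- c * (norm y)\<^sup>2) \<le> real N ^ N * exp c"
    by (metis (no_types, lifting) exp_ge_zero mult.assoc mult_right_mono)
  moreover have "japanese y ^ N \<le> ((japanese y)\<^sup>2) ^ N"
    using japanese_ge_1[of y] by (intro power_mono) (auto simp: power2_eq_square)
  then have "(c * japanese y) ^ N * exp (- c * (norm y)\<^sup>2) \<le> (c * (japanese y)\<^sup>2) ^ N * exp (- c * (norm y)\<^sup>2)"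
    using c by (intro mult_right_mono) (auto simp: power_mult_distrib)
  ultimately have "(c * japanese y) ^ N * exp (- c * (norm y)\<^sup>2) \<le> real N ^ N * exp c" by linarith
  then show "exp (- c * (norm y)\<^sup>2) \<le> (real N / c) ^ N * exp c * decay N y"
    using c by (simp add: power_divide power_mult_distrib field_simps)
qed (use c in auto)

lemma schwartz_gaussian:
  fixes B :: "'a::euclidean_space \<Rightarrow> 'a \<Rightarrow> complex"
  assumes B: "bounded_bilinear B" and sym: "\<And>x y. B x y = B y x"
    and c: "c > 0" and neg: "\<And>y. Re (B y y) \<le> - c * (norm y)\<^sup>2"
  shows "schwartz (\<lambda>y. exp (B y y))"
  unfolding schwartz_iff
proof (intro allI)
  fix N n
  interpret bounded_bilinear B by (rule B)
  have der: "((\<lambda>y. exp (B y y)) has_derivative (\<lambda>v. 2 * B v y * exp (B y y))) (at y)" for y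
  proof -
    have "((\<lambda>y. B y y) has_derivative (\<lambda>v. B y v + B v y)) (at y)"
      by (rule FDERIV) (rule has_derivative_ident)+
    moreover have "(exp has_derivative (\<lambda>w. exp z * w)) (at z)" for z :: complex
      using DERIV_exp[of z] by (simp add: has_field_derivative_def)
    ultimately have "((\<lambda>y. exp (B y y)) has_derivative (\<lambda>v. exp (B y y) * (B y v + B v y))) (at y)"
      by (rule has_derivative_compose)
    moreover have "exp (B y y) * (B y v + B v y) = 2 * B v y * exp (B y y)" for v
      using sym[of y v] by simp
    ultimately show ?thesis by (simp only:)
  qed
  show "controlled n (UNIV::unit set) (\<lambda>_ y. decay N y) (\<lambda>_ y. exp (B y y))"
  proof (rule controlled_exponential[where l="\<lambda>b _ y. 2 * B b y"])
    show "controlled k (UNIV::unit set) (\<lambda>_. japanese) (\<lambda>_ y. 2 * B b y)" for b k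
      by (rule controlled_linear) (auto intro!: linearI simp: add_right scaleR_right distrib_left)
    show "\<exists>K\<ge>0. \<forall>i\<in>(UNIV::unit set). \<forall>y. norm (exp (B y y)) \<le> K * decay M y" for M
    proof -
      obtain K where "K \<ge> 0" "\<And>y::'a. exp (- c * (norm y)\<^sup>2) \<le> K * decay M y"
        using gaussian_decay[OF c] by blast
      moreover have "norm (exp (B y y)) \<le> exp (- c * (norm y)\<^sup>2)" for y
        using neg by simp
      ultimately show ?thesis by (meson order_trans)
    qed
  qed (auto intro: differentiableI[OF der] dir_derivI[OF der])
qed

lemma schwartz_standard_gaussian: "schwartz (\<lambda>y::'a::euclidean_space. exp (- of_real (y \<bullet> y)))"
proof -
  have "bounded_bilinear (\<lambda>x y::'a. - complex_of_real (x \<bullet> y))"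
    by unfold_locales (auto simp: inner_add_left inner_add_right scaleR_conv_of_real
        intro!: exI[of _ 1] Cauchy_Schwarz_ineq2)
  from schwartz_gaussian[OF this _ zero_less_one] show ?thesis
    by (simp add: inner_commute power2_norm_eq_inner)
qed

lemma schwartz_controlled:
  "schwartz f \<Longrightarrow> controlled n I (\<lambda>_ x. decay N x) (\<lambda>_. f)"
  using controlled_reindex[of n "UNIV::unit set" "\<lambda>_ x. decay N x" "\<lambda>_. f" I "\<lambda>_. ()"]
  by (simp add: schwartz_iff)

lemma symbol_class_controlled:
  "symbol_class f \<Longrightarrow> controlled n I (\<lambda>_ _. 1) (\<lambda>_. f)"
  using controlled_reindex[of n "UNIV::unit set" "\<lambda>_ _. 1" "\<lambda>_. f" I "\<lambda>_. ()"]
  by (simp add: symbol_class_iff)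

lemma schwartz_mult:
  assumes "symbol_class f" "schwartz g"
  shows "schwartz (\<lambda>x. f x * g x)"
  unfolding schwartz_iff
proof (intro allI)
  fix N n
  show "controlled n (UNIV::unit set) (\<lambda>_ x. decay N x) (\<lambda>_ x. f x * g x)"
    using controlled_mult[OF symbol_class_controlled[OF assms(1)] schwartz_controlled[OF assms(2)],
        of n "UNIV::unit set" N] by simp
qed

lemma schwartz_imp_symbol_class: "schwartz f \<Longrightarrow> symbol_class f"
  using schwartz_controlled[of f _ "UNIV::unit set" 0] by (simp add: symbol_class_iff)

lemma symbol_class_bounded:
  assumes "symbol_class f"
  obtains K where "K \<ge> 0" "\<And>x. norm (f x) \<le> K"
  using controlled_bound[OF symbol_class_controlled[OF assms, of 0 "UNIV::unit set"]] by auto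

lemma symbol_class_continuous: "symbol_class f \<Longrightarrow> continuous_on UNIV f"
  using controlled_continuous[OF symbol_class_controlled[of f 0 "UNIV::unit set"]] by auto

lemma schwartz_continuous: "schwartz f \<Longrightarrow> continuous_on UNIV f"
  by (intro symbol_class_continuous schwartz_imp_symbol_class)

lemma schwartz_bound:
  assumes "schwartz f"
  obtains K where "K \<ge> 0" "\<And>x. norm (f x) \<le> K * decay N x"
  using controlled_bound[OF schwartz_controlled[OF assms, of 0 "UNIV::unit set" N]] by auto

lemma schwartz_integrable:
  fixes f :: "'a::euclidean_space \<Rightarrow> complex"
  assumes "schwartz f"
  shows "integrable lborel f"
proof -
  obtain K where K: "K \<ge> 0" "\<And>x. norm (f x) \<le> K * decay (2 * DIM('a)) x"
    using schwartz_bound[OF assms] by blast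
  show ?thesis
  proof (rule Bochner_Integration.integrable_bound)
    show "integrable lborel (\<lambda>x::'a. K * decay (2 * DIM('a)) x)"
      using integrable_japanese[where 'a='a, OF order_refl] by simp
    show "f \<in> borel_measurable lborel"
      using schwartz_continuous[OF assms] by (simp add: borel_measurable_continuous_onI)
    show "AE x in lborel. norm (f x) \<le> norm (K * decay (2 * DIM('a)) x)"
      by (intro AE_I2 order_trans[OF K(2)]) simp
  qed
qed

lemma L2_bounded_mult:
  assumes "u \<in> L2 M" and [measurable]: "g \<in> borel_measurable M" and g: "\<And>x. norm (g x) \<le> K"
  shows "(\<lambda>x. g x * u x) \<in> L2 M"
proof (rule L2I)
  note [measurable] = L2_measurable[OF assms(1)]
  show "(\<lambda>x. g x * u x) \<in> borel_measurable M" by measurable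
  show "integrable M (\<lambda>x. (norm (g x * u x))\<^sup>2)"
  proof (rule Bochner_Integration.integrable_bound)
    show "integrable M (\<lambda>x. K\<^sup>2 * (norm (u x))\<^sup>2)" using L2_integrable[OF assms(1)] by simp
    have "(norm (g x))\<^sup>2 * (norm (u x))\<^sup>2 \<le> K\<^sup>2 * (norm (u x))\<^sup>2" for x
      using g[of x] by (intro mult_right_mono power_mono) auto
    then show "AE x in M. norm ((norm (g x * u x))\<^sup>2) \<le> norm (K\<^sup>2 * (norm (u x))\<^sup>2)"
      by (simp add: norm_mult power_mult_distrib)
  qed measurable
qed

lemma L2_of_decay:
  fixes f :: "'a::euclidean_space \<Rightarrow> complex"
  assumes [measurable]: "f \<in> borel_measurable borel" and "\<And>x. norm (f x) \<le> K * inverse (japanese x ^ DIM('a))"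
  shows "f \<in> L2 lborel"
proof (rule L2I)
  show "integrable lborel (\<lambda>x. (norm (f x))\<^sup>2)"
  proof (rule Bochner_Integration.integrable_bound)
    show "integrable lborel (\<lambda>x::'a. K\<^sup>2 * decay (2 * DIM('a)) x)"
      using integrable_japanese[where 'a='a, OF order_refl] by simp
    have "(norm (f x))\<^sup>2 \<le> norm (K\<^sup>2 * decay (2 * DIM('a)) x)" for x
    proof -
      have "(norm (f x))\<^sup>2 \<le> (K * inverse (japanese x ^ DIM('a)))\<^sup>2"
        using assms(2)[of x] by (intro power_mono) auto
      also have "\<dots> = K\<^sup>2 * decay (2 * DIM('a)) x"
        by (simp add: power_mult_distrib power_mult power2_eq_square)
      finally show ?thesis by (simp add: less_imp_le)
    qed
    then show "AE x in lborel. norm ((norm (f x))\<^sup>2) \<le> norm (K\<^sup>2 * decay (2 * DIM('a)) x)"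
      by simp
  qed measurable
qed simp

lemma schwartz_L2:
  fixes f :: "'a::euclidean_space \<Rightarrow> complex"
  assumes "schwartz f"
  shows "f \<in> L2 lborel"
proof -
  obtain K where "\<And>x. norm (f x) \<le> K * inverse (japanese x ^ DIM('a))"
    using schwartz_bound[OF assms] by blast
  then show ?thesis
    by (intro L2_of_decay borel_measurable_continuous_onI schwartz_continuous[OF assms])
qed

section \<open>Density of the Schwartz functions\<close>

text \<open>The logistic function of a linear form has bounded derivatives of all orders because its
  derivative is a polynomial in itself.\<close>

lemma symbol_class_logistic:
  fixes b :: "'a::euclidean_space"
  shows "symbol_class (\<lambda>y. complex_of_real (inverse (1 + exp (k * (y \<bullet> b) + c))))"
proof -
  let ?s = "\<lambda>y. complex_of_real (inverse (1 + exp (k * (y \<bullet> b) + c)))"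
  have pos: "1 + exp t \<noteq> (0::real)" for t :: real using exp_gt_zero[of t] by linarith
  have der: "(?s has_derivative (\<lambda>v. of_real (- (k * (v \<bullet> b))) * (?s y * (1 + (-1) * ?s y)))) (at y)" for y
  proof -
    have "((\<lambda>y. inverse (1 + exp (k * (y \<bullet> b) + c))) has_derivative
        (\<lambda>v. - (inverse (1 + exp (k * (y \<bullet> b) + c)) * (exp (k * (y \<bullet> b) + c) * (k * (v \<bullet> b))) * inverse (1 + exp (k * (y \<bullet> b) + c))))) (at y)"
      by (auto intro!: derivative_eq_intros simp: pos mult_ac)
    moreover have "- (inverse (1 + exp t) * (exp t * a) * inverse (1 + exp t)) = - a * (inverse (1 + exp t) * (1 + (-1) * inverse (1 + exp t)))"
      for t a :: real using pos[of t] by (simp add: field_simps)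
    ultimately have "((\<lambda>y. inverse (1 + exp (k * (y \<bullet> b) + c))) has_derivative
        (\<lambda>v. - (k * (v \<bullet> b)) * (inverse (1 + exp (k * (y \<bullet> b) + c)) * (1 + (-1) * inverse (1 + exp (k * (y \<bullet> b) + c)))))) (at y)"
      by simp
    from bounded_linear.has_derivative[OF bounded_linear_of_real this] show ?thesis
      by (simp only: of_real_mult of_real_add of_real_minus of_real_1)
  qed
  have bd: "norm (?s y) \<le> 1" for y
  proof -
    have "0 \<le> inverse (1 + exp (k * (y \<bullet> b) + c)) \<and> inverse (1 + exp (k * (y \<bullet> b) + c)) \<le> 1"
      by (simp add: add_pos_pos less_imp_le inverse_le_1_iff)
    then show ?thesis by (simp only: norm_of_real) simp
  qed
  have "controlled n (UNIV::unit set) (\<lambda>_ _. 1) (\<lambda>_. ?s)" for n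
  proof (induction n)
    case 0
    have "continuous_on UNIV ?s" using der
      by (intro differentiable_imp_continuous_on) (auto simp: differentiable_on_def intro: differentiableI)
    then show ?case using bd by (auto intro!: exI[of _ 1])
  next
    case (Suc n)
    have "controlled n (UNIV::unit set) (\<lambda>_ _. 1) (\<lambda>_. dir_deriv e ?s)" for e
    proof (rule controlled_cong)
      show "controlled n (UNIV::unit set) (\<lambda>_ _. 1)
          (\<lambda>_ y. of_real (- (k * (e \<bullet> b))) * (?s y * (1 + (-1) * ?s y)))"
        by (rule controlled_cmult[where K="norm (complex_of_real (- (k * (e \<bullet> b))))"],
            rule controlled_mult[where m="\<lambda>_ _. 1" and m'="\<lambda>_ _. 1", simplified],
            rule Suc.IH, intro controlled_add controlled_const[where K=1] controlled_cmult[where K=1] Suc.IH) auto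
      show "of_real (- (k * (e \<bullet> b))) * (?s y * (1 + (-1) * ?s y)) = dir_deriv e ?s y" for y
        by (rule dir_derivI[OF der, symmetric])
    qed
    then show ?case using bd differentiableI[OF der] by (auto intro!: exI[of _ 1])
  qed
  then show ?thesis by (simp add: symbol_class_iff)
qed

lemma symbol_class_mult: "symbol_class f \<Longrightarrow> symbol_class g \<Longrightarrow> symbol_class (\<lambda>x. f x * g x)"
  using controlled_mult[where m="\<lambda>_ _. 1" and m'="\<lambda>_ _. 1" and I="UNIV::unit set" and F="\<lambda>_. f" and G="\<lambda>_. g"]
  by (simp add: symbol_class_iff)

lemma symbol_class_1: "symbol_class (\<lambda>_. 1)"
  unfolding symbol_class_iff by (intro allI controlled_const[where K=1]) simp

lemma symbol_class_prod:
  "finite A \<Longrightarrow> (\<And>a. a \<in> A \<Longrightarrow> symbol_class (f a)) \<Longrightarrow> symbol_class (\<lambda>x. \<Prod>a\<in>A. f a x)"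
  by (induction A rule: finite_induct) (auto intro: symbol_class_mult symbol_class_1)

lemma l2_norm_dominated_convergence:
  assumes w: "w \<in> L2 M" and u: "u \<in> borel_measurable M" and s: "\<And>k. s k \<in> borel_measurable M"
    and lim: "\<And>x. x \<in> space M \<Longrightarrow> (\<lambda>k. s k x) \<longlonglongrightarrow> u x"
    and dom: "\<And>k x. x \<in> space M \<Longrightarrow> norm (s k x) \<le> norm (w x)"
  shows "u \<in> L2 M" "\<And>k. s k \<in> L2 M" "(\<lambda>k. l2_norm M (\<lambda>x. u x - s k x)) \<longlonglongrightarrow> 0"
proof -
  note [measurable] = u s L2_measurable[OF w]
  have domu: "norm (u x) \<le> norm (w x)" if "x \<in> space M" for x
    using tendsto_norm[OF lim[OF that]] dom[OF that] by (intro LIMSEQ_le_const2) auto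
  have bounded: "v \<in> L2 M" if [measurable]: "v \<in> borel_measurable M"
    and "\<And>x. x \<in> space M \<Longrightarrow> norm (v x) \<le> norm (w x)" for v
    using that(2) L2_integrable[OF w]
    by (intro L2I Bochner_Integration.integrable_bound[of M "\<lambda>x. (norm (w x))\<^sup>2" "\<lambda>x. (norm (v x))\<^sup>2"])
       (auto intro: power_mono)
  show "u \<in> L2 M" using u domu by (rule bounded)
  show "s k \<in> L2 M" for k using s dom by (rule bounded)
  have "(\<lambda>k. \<integral>x. (norm (u x - s k x))\<^sup>2 \<partial>M) \<longlonglongrightarrow> (\<integral>x. 0 \<partial>M)"
  proof (rule integral_dominated_convergence[where w="\<lambda>x. 4 * (norm (w x))\<^sup>2"])
    show "integrable M (\<lambda>x. 4 * (norm (w x))\<^sup>2)" using L2_integrable[OF w] by simp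
    have "(\<lambda>k. (norm (u x - s k x))\<^sup>2) \<longlonglongrightarrow> (norm (u x - u x))\<^sup>2" if "x \<in> space M" for x
      using lim[OF that] by (intro tendsto_intros)
    then show "AE x in M. (\<lambda>k. (norm (u x - s k x))\<^sup>2) \<longlonglongrightarrow> 0" by simp
    have "norm ((norm (u x - s k x))\<^sup>2) \<le> 4 * (norm (w x))\<^sup>2" if "x \<in> space M" for x k
    proof -
      have "norm (u x - s k x) \<le> 2 * norm (w x)"
        using norm_triangle_ineq4[of "u x" "s k x"] domu[OF that] dom[OF that, of k] by linarith
      from power_mono[OF this, of 2] show ?thesis by (simp add: power_mult_distrib)
    qed
    then show "AE x in M. norm ((norm (u x - s k x))\<^sup>2) \<le> 4 * (norm (w x))\<^sup>2" for k by simp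
  qed measurable
  from tendsto_real_sqrt[OF this] show "(\<lambda>k. l2_norm M (\<lambda>x. u x - s k x)) \<longlonglongrightarrow> 0"
    by (simp add: l2_norm_def)
qed

text \<open>The Gaussian times a product of logistic functions is a Schwartz function. Making the logistic
  functions steeper gives the Gaussian times the indicator of an orthant, then of any Borel set, then
  times any simple function; and \<open>u\<close> divided by the Gaussian is a limit of simple functions.\<close>

lemma L2_schwartz_induct:
  fixes P :: "('a::ordered_euclidean_space \<Rightarrow> complex) \<Rightarrow> bool"
  assumes u: "u \<in> L2 lborel"
    and schwartz: "\<And>v. schwartz v \<Longrightarrow> P v"
    and lincomb: "\<And>v w c d. v \<in> L2 lborel \<Longrightarrow> w \<in> L2 lborel \<Longrightarrow> P v \<Longrightarrow> P w \<Longrightarrow> P (\<lambda>x. c * v x + d * w x)"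
    and closed: "\<And>v s. v \<in> L2 lborel \<Longrightarrow> (\<And>k::nat. s k \<in> L2 lborel) \<Longrightarrow> (\<And>k. P (s k)) \<Longrightarrow>
       (\<lambda>k. l2_norm lborel (\<lambda>x. v x - s k x)) \<longlonglongrightarrow> 0 \<Longrightarrow> P v"
  shows "P u"
proof -
  define p where "p = (\<lambda>y::'a. exp (- complex_of_real (y \<bullet> y)))"
  have p: "schwartz p" unfolding p_def by (rule schwartz_standard_gaussian)
  have pL2: "p \<in> L2 lborel" using p by (rule schwartz_L2)
  have p_nz: "p y \<noteq> 0" for y by (simp add: p_def)
  have [measurable]: "p \<in> borel_measurable borel" using L2_measurable[OF pL2] by simp
  have dominated: "P v" if "w \<in> L2 lborel" "v \<in> borel_measurable borel" "\<And>k. s k \<in> borel_measurable borel"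
    "\<And>x. (\<lambda>k. s k x) \<longlonglongrightarrow> v x" "\<And>k x. norm (s k x) \<le> norm (w x)" "\<And>k. P (s k)" for v w and s :: "nat \<Rightarrow> 'a \<Rightarrow> complex"
    using l2_norm_dominated_convergence[of w lborel v s] that by (intro closed[of v s]) auto
  have ind_L2: "(\<lambda>x. indicator A x * p x) \<in> L2 lborel" if "A \<in> sets borel" for A
    using that by (intro L2_bounded_mult[OF pL2, where K=1]) (auto simp: indicator_def)

  have orthant: "P (\<lambda>x. indicator {x. \<forall>b\<in>Basis. x \<bullet> b < a \<bullet> b} x * p x)" for a
  proof (rule dominated[where w=p])
    \<comment> \<open>The slope grows like \<open>k\<^sup>2\<close> and the offset like \<open>k\<close>, so that the limit is \<open>0\<close> on the boundary as well.\<close>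
    define s where "s k b y = inverse (1 + exp ((real k)\<^sup>2 * (y \<bullet> b) + (real k - (real k)\<^sup>2 * (a \<bullet> b))))" for k and b y :: 'a
    have s_bd: "0 \<le> s k b y \<and> s k b y \<le> 1" for k b y
      unfolding s_def by (simp add: add_pos_pos less_imp_le inverse_le_1_iff)
    have s_lim: "(\<lambda>k. s k b y) \<longlonglongrightarrow> (if y \<bullet> b < a \<bullet> b then 1 else 0)" for b y
    proof -
      define t where "t = y \<bullet> b - a \<bullet> b"
      have s_eq: "s k b y = inverse (1 + exp ((real k)\<^sup>2 * t + real k))" for k
        by (simp add: s_def t_def algebra_simps)
      show ?thesis
      proof (cases "t < 0")
        case True
        have "filterlim (\<lambda>k. real k * ((- t) * real k + (- 1))) at_top sequentially"
        proof (rule filterlim_at_top_mult_at_top[OF filterlim_real_sequentially])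
          have "filterlim (\<lambda>k. (- t) * real k) at_top sequentially"
            using True by (intro filterlim_tendsto_pos_mult_at_top[OF tendsto_const _ filterlim_real_sequentially]) simp
          from filterlim_tendsto_add_at_top[OF tendsto_const this, of "- 1"]
          show "filterlim (\<lambda>k. (- t) * real k + (- 1)) at_top sequentially"
            by (simp add: add.commute)
        qed
        then have "filterlim (\<lambda>k. (real k)\<^sup>2 * t + real k) at_bot sequentially"
          unfolding filterlim_uminus_at_bot by (simp add: power2_eq_square algebra_simps)
        then have "(\<lambda>k. exp ((real k)\<^sup>2 * t + real k)) \<longlonglongrightarrow> 0"
          by (rule filterlim_compose[OF exp_at_bot])
        then have "(\<lambda>k. inverse (1 + exp ((real k)\<^sup>2 * t + real k))) \<longlonglongrightarrow> inverse (1 + 0)"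
          by (intro tendsto_intros) auto
        then show ?thesis using True by (simp add: s_eq t_def)
      next
        case False
        have "filterlim (\<lambda>k. exp (real k)) at_top sequentially"
          by (rule filterlim_compose[OF exp_at_top filterlim_real_sequentially])
        then have "filterlim (\<lambda>k. 1 + exp ((real k)\<^sup>2 * t + real k)) at_top sequentially"
          by (rule filterlim_at_top_mono)
             (use False in \<open>auto intro!: always_eventually order_trans[OF _ less_imp_le[OF less_add_one, of "exp _", unfolded add.commute[of _ 1]]]\<close>)
        then have "(\<lambda>k. inverse (1 + exp ((real k)\<^sup>2 * t + real k))) \<longlonglongrightarrow> 0"
          by (rule tendsto_inverse_0_at_top)
        then show ?thesis using False by (simp add: s_eq t_def)
      qed
    qed
    show "P (\<lambda>y. (\<Prod>b\<in>Basis. complex_of_real (s k b y)) * p y)" for k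
      unfolding s_def by (intro schwartz schwartz_mult p symbol_class_prod symbol_class_logistic) simp
    show "norm ((\<Prod>b\<in>Basis. complex_of_real (s k b y)) * p y) \<le> norm (p y)" for k y
    proof -
      have "(\<Prod>b\<in>(Basis::'a set). norm (complex_of_real (s k b y))) \<le> 1"
        using s_bd by (intro prod_le_1) auto
      then show ?thesis unfolding norm_mult prod_norm[symmetric] by (intro mult_left_le_one_le prod_nonneg) auto
    qed
    show "(\<lambda>k. (\<Prod>b\<in>Basis. complex_of_real (s k b y)) * p y) \<longlonglongrightarrow> indicator {x. \<forall>b\<in>Basis. x \<bullet> b < a \<bullet> b} y * p y" for y
    proof -
      have "(\<lambda>k. (\<Prod>b\<in>Basis. complex_of_real (s k b y)) * p y) \<longlonglongrightarrow>
          (\<Prod>b\<in>Basis. complex_of_real (if y \<bullet> b < a \<bullet> b then 1 else 0)) * p y"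
        by (intro tendsto_intros s_lim)
      also have "(\<Prod>b\<in>Basis. complex_of_real (if y \<bullet> b < a \<bullet> b then 1 else 0)) = indicator {x. \<forall>b\<in>Basis. x \<bullet> b < a \<bullet> b} y"
        by (auto simp: indicator_def intro!: prod.neutral)
      finally show ?thesis .
    qed
    show "(\<lambda>y. (\<Prod>b\<in>Basis. complex_of_real (s k b y)) * p y) \<in> borel_measurable borel" for k
      unfolding s_def by measurable
    show "(\<lambda>x. indicator {x. \<forall>b\<in>Basis. x \<bullet> b < a \<bullet> b} x * p x) \<in> borel_measurable borel"
      by measurable
  qed (rule pL2)

  \<comment> \<open>All Borel sets, since the lower orthants are a generator stable under intersection.\<close>
  have borel: "P (\<lambda>x. indicator A x * p x)" if A: "A \<in> sets borel" for A
  proof -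
    define G where "G = range (\<lambda>a::'a. {x. \<forall>b\<in>Basis. x \<bullet> b < a \<bullet> b})"
    have "sets (borel :: 'a measure) = sets (sigma UNIV (range (\<lambda>a::'a. {x. eucl_less x a})))"
      by (simp only: borel_eq_lessThan[symmetric])
    then have sets_G: "sets (borel :: 'a measure) = sigma_sets UNIV G"
      by (simp add: G_def eucl_less_def)
    have "Int_stable G"
    proof (rule Int_stableI)
      fix A B assume "A \<in> G" "B \<in> G"
      then obtain a b where "A = {x. \<forall>i\<in>Basis. x \<bullet> i < a \<bullet> i}" "B = {x. \<forall>i\<in>Basis. x \<bullet> i < b \<bullet> i}"
        by (auto simp: G_def)
      then have "A \<inter> B = {x. \<forall>i\<in>Basis. x \<bullet> i < (\<Sum>i\<in>Basis. min (a \<bullet> i) (b \<bullet> i) *\<^sub>R i) \<bullet> i}"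
        by auto
      then show "A \<inter> B \<in> G" unfolding G_def by blast
    qed
    moreover have "G \<subseteq> Pow UNIV" by simp
    moreover have "A \<in> sigma_sets UNIV G" using A sets_G by simp
    ultimately show ?thesis
    proof (induction rule: sigma_sets_induct_disjoint)
      case (basic A)
      then show ?case using orthant by (auto simp: G_def)
    next
      case empty
      have "P (\<lambda>x. 0 * p x + 0 * p x)" by (intro lincomb pL2 schwartz p)
      then show ?case by simp
    next
      case (compl A)
      have "A \<in> sets borel" using compl sets_G by simp
      then have "P (\<lambda>x. 1 * p x + (-1) * (indicator A x * p x))"
        by (intro lincomb pL2 schwartz p compl ind_L2)
      moreover have "(\<lambda>x. 1 * p x + (-1) * (indicator A x * p x)) = (\<lambda>x. indicator (UNIV - A) x * p x)"
        by (auto simp: indicator_def)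
      ultimately show ?case by simp
    next
      case (union A)
      have A: "A i \<in> sets borel" for i using union sets_G by auto
      have step: "P (\<lambda>x. indicator (\<Union>i<k. A i) x * p x)" for k
      proof (induction k)
        case 0
        have "P (\<lambda>x. 0 * p x + 0 * p x)" by (intro lincomb pL2 schwartz p)
        then show ?case by simp
      next
        case (Suc k)
        have "P (\<lambda>x. 1 * (indicator (\<Union>i<k. A i) x * p x) + 1 * (indicator (A k) x * p x))"
          using A by (intro lincomb ind_L2 Suc union(3)) auto
        moreover have "indicator (\<Union>i<Suc k. A i) x = indicator (\<Union>i<k. A i) x + (indicator (A k) x :: complex)" for x
        proof -
          have "x \<notin> A i" if "x \<in> A k" "i < k" for i
            using union(1) that unfolding disjoint_family_on_def by (metis IntI UNIV_I empty_iff less_irrefl)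
          then show ?thesis by (auto simp: indicator_def less_Suc_eq)
        qed
        ultimately show ?case by (simp add: distrib_right)
      qed
      show ?case
      proof (rule dominated[where w=p and s="\<lambda>k x. indicator (\<Union>i<k. A i) x * p x"])
        show "(\<lambda>k. indicator (\<Union>i<k. A i) x * p x) \<longlonglongrightarrow> indicator (\<Union>i. A i) x * p x" for x
          by (intro tendsto_intros LIMSEQ_indicator_UN)
        show "norm (indicator (\<Union>i<k. A i) x * p x) \<le> norm (p x)" for k x
          by (simp add: indicator_def)
        show "(\<lambda>x. indicator (\<Union>i<k. A i) x * p x) \<in> borel_measurable borel" for k
          using A by measurable
        show "(\<lambda>x. indicator (\<Union>i. A i) x * p x) \<in> borel_measurable borel"
          using A by measurable
      qed (auto intro: pL2 step)
    qed
  qed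

  note [measurable] = L2_measurable[OF u]
  obtain F where F: "\<And>i. simple_function borel (F i)" "\<And>x. (\<lambda>i. F i x) \<longlonglongrightarrow> u x / p x"
    "\<And>i x. dist (F i x) 0 \<le> 2 * dist (u x / p x) 0"
    using borel_measurable_implies_sequence_metric[of "\<lambda>x. u x / p x" borel 0] by (auto simp: L2_measurable[OF u, simplified])
  have Fm: "F i \<in> borel_measurable borel" for i using F(1) by (rule borel_measurable_simple_function)
  have simple: "P (\<lambda>x. F i x * p x)" for i
  proof -
    let ?A = "\<lambda>c. F i -` {c}"
    have A: "?A c \<in> sets borel" for c
      using measurable_sets[OF Fm, of "{c}" i] by simp
    have *: "P (\<lambda>x. \<Sum>c\<in>S. c * (indicator (?A c) x * p x)) \<and> (\<lambda>x. \<Sum>c\<in>S. c * (indicator (?A c) x * p x)) \<in> L2 lborel"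
      if "finite S" for S
      using that
    proof (induction S rule: finite_induct)
      case empty
      have "P (\<lambda>x. 0 * p x + 0 * p x)" "(\<lambda>x. 0 * p x + 0 * p x) \<in> L2 lborel" by (intro lincomb L2_lincomb pL2 schwartz p)+
      then show ?case by simp
    next
      case (insert c S)
      have "P (\<lambda>x. c * (indicator (?A c) x * p x) + 1 * (\<Sum>c\<in>S. c * (indicator (?A c) x * p x)))"
        "(\<lambda>x. c * (indicator (?A c) x * p x) + 1 * (\<Sum>c\<in>S. c * (indicator (?A c) x * p x))) \<in> L2 lborel"
        using insert by (intro lincomb L2_lincomb ind_L2 A borel; simp)+
      then show ?case using insert by simp
    qed
    have fin: "finite (range (F i))" using F(1)[of i] by (simp add: simple_function_def)
    have "(\<Sum>c\<in>range (F i). c * (indicator (?A c) x * p x)) = F i x * p x" for x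
    proof -
      have "(\<Sum>c\<in>range (F i). c * (indicator (?A c) x * p x)) = (\<Sum>c\<in>range (F i). if c = F i x then F i x * p x else 0)"
        by (intro sum.cong) (auto simp: indicator_def)
      then show ?thesis using fin by simp
    qed
    then show ?thesis using *[OF fin] by simp
  qed
  show "P u"
  proof (rule dominated[where s="\<lambda>i x. F i x * p x"])
    have "(\<lambda>x. 2 * u x + 0 * u x) \<in> L2 lborel" by (intro L2_lincomb u)
    then show "(\<lambda>x. 2 * u x) \<in> L2 lborel" by simp
    show "(\<lambda>i. F i x * p x) \<longlonglongrightarrow> u x" for x
      using tendsto_mult_right[OF F(2)[of x], of "p x"] p_nz[of x] by simp
    show "norm (F i x * p x) \<le> norm (2 * u x)" for i x
      using mult_right_mono[OF F(3)[of i x], of "norm (p x)"] p_nz[of x]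
      by (simp add: norm_mult norm_divide)
    show "(\<lambda>x. F i x * p x) \<in> borel_measurable borel" for i using Fm[of i] by measurable
  qed (use simple L2_measurable[OF u] in auto)
qed

lemma bounded_operators_eq_on_schwartz:
  fixes F G :: "('a::ordered_euclidean_space \<Rightarrow> complex) \<Rightarrow> 'a \<Rightarrow> complex"
  assumes F: "bounded_operator lborel (L2 lborel) F" and G: "bounded_operator lborel (L2 lborel) G"
    and eq: "\<And>v. schwartz v \<Longrightarrow> AE x in lborel. F v x = G v x" and u: "u \<in> L2 lborel"
  shows "AE x in lborel. F u x = G u x"
  using u
proof (rule L2_schwartz_induct)
  fix v w c d assume vw: "v \<in> L2 lborel" "w \<in> L2 lborel" "AE x in lborel. F v x = G v x" "AE x in lborel. F w x = G w x"
  have "AE x in lborel. F (\<lambda>y. c * v y + d * w y) x = c * F v x + d * F w x"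
    "AE x in lborel. G (\<lambda>y. c * v y + d * w y) x = c * G v x + d * G w x"
    using F G vw(1,2) unfolding bounded_operator_def linear_operator_def by blast+
  then show "AE x in lborel. F (\<lambda>y. c * v y + d * w y) x = G (\<lambda>y. c * v y + d * w y) x"
    using vw(3,4) by eventually_elim simp
next
  fix v and s :: "nat \<Rightarrow> 'a \<Rightarrow> complex"
  assume "v \<in> L2 lborel" "\<And>k. s k \<in> L2 lborel" "\<And>k. AE x in lborel. F (s k) x = G (s k) x"
    "(\<lambda>k. l2_norm lborel (\<lambda>x. v x - s k x)) \<longlonglongrightarrow> 0"
  then show "AE x in lborel. F v x = G v x" by (rule bounded_operators_agree_limit[OF F G])
qed (rule eq)

section \<open>Linear changes of variables\<close>

lemma inner_linear_bij_Basis: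
  fixes f :: "'a::euclidean_space \<Rightarrow> 'b::euclidean_space"
  assumes f: "linear f" and bij: "bij_betw f Basis Basis" and b: "b \<in> Basis"
  shows "f x \<bullet> f b = x \<bullet> b"
proof -
  have "f x \<bullet> f b = (\<Sum>c\<in>Basis. (x \<bullet> c) * (f c \<bullet> f b))"
    by (subst linear_expansion_Basis[OF f]) (simp add: inner_sum_left)
  also have "\<dots> = (\<Sum>c\<in>Basis. if c = b then x \<bullet> b else 0)"
  proof (intro sum.cong refl)
    fix c :: 'a assume c: "c \<in> Basis"
    have "f c \<in> Basis" "f b \<in> Basis" "f c = f b \<longleftrightarrow> c = b"
      using bij b c by (auto simp: bij_betw_def inj_on_eq_iff)
    then show "(x \<bullet> c) * (f c \<bullet> f b) = (if c = b then x \<bullet> b else 0)"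
      by (auto simp: inner_Basis)
  qed
  finally show ?thesis using b by simp
qed

lemma borel_measurable_linear:
  fixes f :: "'a::euclidean_space \<Rightarrow> 'b::euclidean_space"
  shows "linear f \<Longrightarrow> f \<in> borel_measurable borel"
  by (intro borel_measurable_continuous_onI linear_continuous_on linear_conv_bounded_linear[THEN iffD1])

lemma distr_lborel_bij_Basis:
  fixes f :: "'a::euclidean_space \<Rightarrow> 'b::euclidean_space"
  assumes f: "linear f" and bij: "bij_betw f Basis Basis"
  shows "distr lborel borel f = lborel"
proof (rule lborel_eqI[symmetric])
  have [measurable]: "f \<in> borel_measurable borel" using f by (rule borel_measurable_linear)
  have img: "f ` Basis = Basis" and inj: "inj_on f Basis" using bij by (auto simp: bij_betw_def)
  fix l u :: 'b assume le: "\<And>b. b \<in> Basis \<Longrightarrow> l \<bullet> b \<le> u \<bullet> b"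
  let ?l = "\<Sum>b\<in>Basis. (l \<bullet> f b) *\<^sub>R b" and ?u = "\<Sum>b\<in>Basis. (u \<bullet> f b) *\<^sub>R b"
  have "f x \<in> box l u \<longleftrightarrow> x \<in> box ?l ?u" for x
  proof -
    have "f x \<in> box l u \<longleftrightarrow> (\<forall>b\<in>f ` Basis. l \<bullet> b < f x \<bullet> b \<and> f x \<bullet> b < u \<bullet> b)"
      by (simp add: mem_box img)
    also have "\<dots> \<longleftrightarrow> x \<in> box ?l ?u"
      using inner_linear_bij_Basis[OF f bij] by (simp add: mem_box)
    finally show ?thesis .
  qed
  then have vimage: "f -` box l u \<inter> space lborel = box ?l ?u" by auto
  have "emeasure (distr lborel borel f) (box l u) = emeasure lborel (box ?l ?u)"
    by (subst emeasure_distr) (simp_all add: vimage[simplified])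
  also have "\<dots> = (\<Prod>b\<in>Basis. (?u - ?l) \<bullet> b)"
    using le img by (intro emeasure_lborel_box) auto
  also have "(\<Prod>b\<in>Basis. (?u - ?l) \<bullet> b) = (\<Prod>b\<in>Basis. (u - l) \<bullet> f b)"
    by (intro prod.cong) (simp_all add: inner_diff_left)
  also have "\<dots> = (\<Prod>b\<in>Basis. (u - l) \<bullet> b)"
    using prod.reindex[OF inj, of "\<lambda>b. (u - l) \<bullet> b"] by (simp add: img)
  finally show "emeasure (distr lborel borel f) (box l u) = ennreal (\<Prod>b\<in>Basis. (u - l) \<bullet> b)" .
qed simp

lemma nn_integral_bij_Basis:
  fixes f :: "'a::euclidean_space \<Rightarrow> 'b::euclidean_space"
  assumes f: "linear f" and bij: "bij_betw f Basis Basis" and g: "g \<in> borel_measurable borel"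
  shows "(\<integral>\<^sup>+x. g (f x) \<partial>lborel) = (\<integral>\<^sup>+x. g x \<partial>lborel)"
  using nn_integral_distr[of f lborel borel g] borel_measurable_linear[OF f] g
  by (simp add: distr_lborel_bij_Basis[OF f bij])

text \<open>A shear translates each line parallel to \<open>e\<close>.\<close>

lemma nn_integral_shear:
  fixes e :: "'a::euclidean_space"
  assumes e: "e \<in> Basis" and l: "linear l" and le: "l e = 0" and g: "g \<in> borel_measurable borel"
  shows "(\<integral>\<^sup>+x. g (x + l x *\<^sub>R e) \<partial>lborel) = (\<integral>\<^sup>+x. g x \<partial>lborel)"
proof -
  let ?M = "\<lambda>_::'a. lborel :: real measure"
  interpret product_sigma_finite ?M by standard
  let ?I = "Basis - {e}" and ?v = "\<lambda>f. \<Sum>b\<in>Basis. f b *\<^sub>R b :: 'a"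
  have I: "insert e ?I = Basis" using e by auto
  have lb: "lborel = distr (\<Pi>\<^sub>M b\<in>Basis. lborel) borel ?v"
    unfolding lborel_def[where 'a='a] lborel_eq_real ..
  have lm: "l \<in> borel_measurable borel" using l by (rule borel_measurable_linear)
  note [measurable] = g lm
  have fub: "(\<integral>\<^sup>+x. k x \<partial>lborel) = (\<integral>\<^sup>+f. (\<integral>\<^sup>+t. k (?v (f(e := t))) \<partial>lborel) \<partial>(\<Pi>\<^sub>M b\<in>?I. lborel))"
    if [measurable]: "k \<in> borel_measurable borel" for k :: "'a \<Rightarrow> ennreal"
  proof -
    have "(\<integral>\<^sup>+x. k x \<partial>lborel) = (\<integral>\<^sup>+f. k (?v f) \<partial>(\<Pi>\<^sub>M b\<in>insert e ?I. lborel))"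
      unfolding I by (subst lb, subst nn_integral_distr) simp_all
    also have "\<dots> = (\<integral>\<^sup>+f. (\<integral>\<^sup>+t. k (?v (f(e := t))) \<partial>lborel) \<partial>(\<Pi>\<^sub>M b\<in>?I. lborel))"
      by (rule product_nn_integral_insert) (simp_all add: I)
    finally show ?thesis .
  qed
  have inner: "(\<integral>\<^sup>+t. g (?v (f(e := t)) + l (?v (f(e := t))) *\<^sub>R e) \<partial>lborel) = (\<integral>\<^sup>+t. g (?v (f(e := t))) \<partial>lborel)" for f
  proof -
    define r where "r = (\<Sum>b\<in>?I. f b *\<^sub>R b)"
    have v: "?v (f(e := t)) = t *\<^sub>R e + r" for t
    proof -
      have "(\<Sum>b\<in>insert e ?I. (f(e := t)) b *\<^sub>R b) = t *\<^sub>R e + r"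
        by (subst sum.insert) (auto simp: r_def intro!: sum.cong)
      then show ?thesis unfolding I .
    qed
    have lv: "l (t *\<^sub>R e + r) = l r" for t
      using l le by (simp add: linear_add linear_cmul)
    have "(\<integral>\<^sup>+t. g (?v (f(e := t))) \<partial>lborel) = (\<integral>\<^sup>+t. g (t *\<^sub>R e + r) \<partial>lborel)" by (simp only: v)
    also have "\<dots> = (\<integral>\<^sup>+t. g ((l r + 1 * t) *\<^sub>R e + r) \<partial>lborel)"
      using nn_integral_real_affine[of "\<lambda>t. g (t *\<^sub>R e + r)" 1 "l r"] by simp
    also have "\<dots> = (\<integral>\<^sup>+t. g (?v (f(e := t)) + l (?v (f(e := t))) *\<^sub>R e) \<partial>lborel)"
      unfolding v lv by (intro nn_integral_cong arg_cong[where f=g]) (simp add: algebra_simps)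
    finally show ?thesis by simp
  qed
  have "(\<lambda>x. g (x + l x *\<^sub>R e)) \<in> borel_measurable borel" by measurable
  from fub[OF this] fub[OF g] show ?thesis by (simp only: inner)
qed

lemma Basis_cart: "(Basis :: (real^'m) set) = range (\<lambda>i. axis i 1)"
  by (auto simp: Basis_vec_def)

lemma inj_axis_1: "inj (\<lambda>i::'m::finite. axis i (1::real))"
  by (auto simp: inj_def axis_eq_axis)

text \<open>Both sides are multiplicative in \<open>f\<close>, which leaves dilations of the axes, transpositions and shears.\<close>

lemma nn_integral_linear_cart:
  fixes f :: "real^'m \<Rightarrow> real^'m"
  assumes "linear f" and "det (matrix f) \<noteq> 0" and "g \<in> borel_measurable borel"
  shows "(\<integral>\<^sup>+x. g x \<partial>lborel) = ennreal \<bar>det (matrix f)\<bar> * (\<integral>\<^sup>+x. g (f x) \<partial>lborel)"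
proof -
  have "det (matrix f) \<noteq> 0 \<longrightarrow> (\<forall>g\<in>borel_measurable borel.
      (\<integral>\<^sup>+x. g x \<partial>lborel) = ennreal \<bar>det (matrix f)\<bar> * (\<integral>\<^sup>+x. g (f x) \<partial>lborel))" (is "?P f")
  proof (rule induct_linear_elementary[OF \<open>linear f\<close>])
    fix f g :: "real^'m \<Rightarrow> real^'m"
    assume f: "linear f" "?P f" and g: "linear g" "?P g"
    show "?P (f \<circ> g)"
    proof (intro impI ballI)
      fix k :: "real^'m \<Rightarrow> ennreal" assume k [measurable]: "k \<in> borel_measurable borel"
      have [measurable]: "f \<in> borel_measurable borel" using f(1) by (rule borel_measurable_linear)
      have det: "det (matrix (f \<circ> g)) = det (matrix f) * det (matrix g)"
        using matrix_compose[OF g(1) f(1)] by (simp add: det_mul)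
      assume "det (matrix (f \<circ> g)) \<noteq> 0"
      then have nz: "det (matrix f) \<noteq> 0" "det (matrix g) \<noteq> 0" by (simp_all add: det)
      have "(\<integral>\<^sup>+x. k x \<partial>lborel) = ennreal \<bar>det (matrix f)\<bar> * (\<integral>\<^sup>+x. k (f x) \<partial>lborel)"
        using f(2) nz k by blast
      also have "(\<integral>\<^sup>+x. k (f x) \<partial>lborel) = ennreal \<bar>det (matrix g)\<bar> * (\<integral>\<^sup>+x. k (f (g x)) \<partial>lborel)"
      proof -
        have "(\<lambda>x. k (f x)) \<in> borel_measurable borel" by measurable
        then show ?thesis using g(2) nz by blast
      qed
      finally show "(\<integral>\<^sup>+x. k x \<partial>lborel) = ennreal \<bar>det (matrix (f \<circ> g))\<bar> * (\<integral>\<^sup>+x. k ((f \<circ> g) x) \<partial>lborel)"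
        by (simp add: det abs_mult ennreal_mult mult.assoc)
    qed
  next
    fix f :: "real^'m \<Rightarrow> real^'m" and i assume f: "linear f" and 0: "\<And>x. f x $ i = 0"
    have "\<not> surj f" using 0 by (metis surjE vec_component one_neq_zero)
    then have "det (matrix f) = 0"
      using det_nz_iff_inj[OF f] linear_injective_imp_surjective[OF f] by blast
    then show "?P f" by simp
  next
    fix c :: "'m \<Rightarrow> real"
    let ?f = "\<lambda>x::real^'m. \<chi> i. c i * x $ i"
    have det: "det (matrix ?f) = (\<Prod>i\<in>UNIV. c i)"
      by (simp add: axis_def matrix_def det_diagonal)
    show "?P ?f"
    proof (intro impI ballI)
      fix k :: "real^'m \<Rightarrow> ennreal" assume k [measurable]: "k \<in> borel_measurable borel"
      assume "det (matrix ?f) \<noteq> 0"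
      then have nz: "c i \<noteq> 0" for i by (simp add: det)
      let ?c = "\<lambda>b::real^'m. (\<chi> i. c i) \<bullet> b"
      have T: "0 + (\<Sum>j\<in>Basis. (?c j * (x \<bullet> j)) *\<^sub>R j) = ?f x" for x
        unfolding Basis_cart by (subst sum.reindex[OF inj_axis_1])
          (simp add: vec_eq_iff inner_axis, simp add: axis_def if_distrib cong: if_cong)
      have prod: "(\<Prod>j\<in>Basis. \<bar>?c j\<bar>) = \<bar>det (matrix ?f)\<bar>"
        unfolding det Basis_cart by (subst prod.reindex[OF inj_axis_1]) (simp add: inner_axis abs_prod)
      have lin: "linear ?f" by (rule linearI) (simp_all add: vec_eq_iff algebra_simps)
      have [measurable]: "?f \<in> borel_measurable borel" using lin by (rule borel_measurable_linear)
      have "(lborel :: (real^'m) measure) = density (distr lborel borel ?f) (\<lambda>_. ennreal \<bar>det (matrix ?f)\<bar>)"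
      proof -
        have "?c j \<noteq> 0" if "j \<in> Basis" for j using that nz by (auto simp: Basis_cart inner_axis)
        from lborel_affine_euclidean[of ?c 0, OF this] show ?thesis unfolding T prod .
      qed
      then have "(\<integral>\<^sup>+x. k x \<partial>lborel) = (\<integral>\<^sup>+x. k x \<partial>density (distr lborel borel ?f) (\<lambda>_. ennreal \<bar>det (matrix ?f)\<bar>))"
        by simp
      also have "\<dots> = ennreal \<bar>det (matrix ?f)\<bar> * (\<integral>\<^sup>+x. k (?f x) \<partial>lborel)"
        by (simp add: nn_integral_density nn_integral_distr nn_integral_cmult)
      finally show "(\<integral>\<^sup>+x. k x \<partial>lborel) = ennreal \<bar>det (matrix ?f)\<bar> * (\<integral>\<^sup>+x. k (?f x) \<partial>lborel)" .
    qed
  next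
    fix m n :: 'm assume "m \<noteq> n"
    let ?t = "Transposition.transpose m n"
    let ?f = "\<lambda>v::real^'m. \<chi> i. v $ ?t i"
    have lin: "linear ?f" by (rule linearI) (simp_all add: vec_eq_iff)
    have ax: "?f (axis i 1) = axis (?t i) 1" for i
      by (auto simp: vec_eq_iff axis_def transpose_eq_iff)
    have bij: "bij_betw ?f Basis Basis"
      unfolding bij_betw_def
    proof
      show "inj_on ?f Basis" 
        by (rule inj_on_inverseI[of _ ?f]) (simp add: vec_eq_iff)
      have "range (\<lambda>i. axis (?t i) (1::real)) = range (\<lambda>i. axis i (1::real))"
        by (auto simp: image_iff) (metis transpose_involutory)
      then show "?f ` Basis = Basis" unfolding Basis_cart image_image ax .
    qed
    have "(\<chi> i j. if ?t i = j then 1 else 0) = (\<chi> i j. if j = ?t i then 1 else (0::real))"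
      by (auto intro!: Cart_lambda_cong)
    then have "matrix ?f = transpose (\<chi> i j. mat 1 $ i $ ?t j)"
      by (auto simp: matrix_eq transpose_def axis_def mat_def matrix_def)
    then have "\<bar>det (matrix ?f)\<bar> = 1"
      by (simp add: det_permute_columns permutes_swap_id sign_swap_id abs_mult)
    then show "?P ?f" using nn_integral_bij_Basis[OF lin bij] by simp
  next
    fix m n :: 'm assume mn: "m \<noteq> n"
    let ?f = "\<lambda>x::real^'m. \<chi> i. if i = m then x $ m + x $ n else x $ i"
    have "matrix ?f = (\<chi> k. if k = m then row m (mat 1) + 1 *s row n (mat 1) else row k (mat 1))"
      by (auto simp: matrix_def vec_eq_iff row_def mat_def axis_def)
    then have det: "det (matrix ?f) = 1"
      using det_row_operation[OF mn, of "mat 1" 1] by simp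
    have f: "?f x = x + (x $ n) *\<^sub>R axis m 1" for x
      by (auto simp: vec_eq_iff axis_def)
    have "axis m (1::real) $ n = 0" using mn by (simp add: axis_def)
    moreover have "linear (\<lambda>x::real^'m. x $ n)" by (rule linearI) simp_all
    ultimately have "(\<integral>\<^sup>+x. g (?f x) \<partial>lborel) = (\<integral>\<^sup>+x. g x \<partial>lborel)" if "g \<in> borel_measurable borel" for g
      unfolding f using nn_integral_shear[of "axis m 1" "\<lambda>x. x $ n" g] that by (simp add: Basis_cart)
    then show "?P ?f" by (simp only: det) simp
  qed
  then show ?thesis using assms by blast
qed

section \<open>The quadratic phase\<close>

text \<open>Keeps \<open>transpose Q *v x\<close> in the form in which it is the transpose for \<open>cdot\<close>.\<close>

declare transpose_matrix_vector [simp del]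

lemma cscaleR_nth: "(r *\<^sub>R x) $ j = of_real r * x $ j" for x :: "complex^'n"
  by (simp add: scaleR_conv_of_real[where 'a=complex])

lemma cdot_add_left: "cdot (x + x') y = cdot x y + cdot x' y"
  by (simp add: cdot_def algebra_simps sum.distrib)

lemma cdot_add_right: "cdot x (y + y') = cdot x y + cdot x y'"
  by (simp add: cdot_def algebra_simps sum.distrib)

lemma cdot_commute: "cdot x y = cdot y x"
  by (simp add: cdot_def mult.commute)

lemma cdot_scale_left: "cdot (c *s x) y = c * cdot x y"
  by (simp add: cdot_def sum_distrib_left mult.assoc)

lemma cdot_scale_right: "cdot x (c *s y) = c * cdot x y"
  by (simp add: cdot_commute[of x] cdot_scale_left)

lemma cdot_scaleR_left: "cdot (r *\<^sub>R x) y = of_real r * cdot x y"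
  by (simp add: cdot_def sum_distrib_left cscaleR_nth mult.assoc del: vector_scaleR_component)

lemma cdot_scaleR_right: "cdot x (r *\<^sub>R y) = of_real r * cdot x y"
  by (simp add: cdot_commute[of x] cdot_scaleR_left)

lemma cdot_minus_left: "cdot (- x) y = - cdot x y"
  by (simp add: cdot_def sum_negf)

lemma cdot_minus_right: "cdot x (- y) = - cdot x y"
  by (simp add: cdot_def sum_negf)

lemma cdot_diff_left: "cdot (x - x') y = cdot x y - cdot x' y"
  by (simp add: cdot_def algebra_simps sum_subtractf)

lemma cdot_diff_right: "cdot x (y - y') = cdot x y - cdot x y'"
  by (simp add: cdot_def algebra_simps sum_subtractf)

lemma cdot_zero_left: "cdot 0 y = 0"
  by (simp add: cdot_def)

lemmas cdot_simps = cdot_add_left cdot_add_right cdot_scale_left cdot_scale_right cdot_scaleR_left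
  cdot_scaleR_right cdot_minus_left cdot_minus_right cdot_diff_left cdot_diff_right

lemma cdot_axis_left: "cdot (axis j c) y = c * y $ j"
proof -
  have "cdot (axis j c) y = (\<Sum>k\<in>UNIV. if k = j then c * y $ j else 0)"
    unfolding cdot_def by (intro sum.cong) (auto simp: axis_def)
  then show ?thesis by simp
qed

lemma cdot_axis_right: "cdot y (axis j c) = c * y $ j"
  by (simp add: cdot_commute[of y] cdot_axis_left)

lemma cdot_transpose: "cdot x (M *v y) = cdot (transpose M *v x) y"
proof -
  have "cdot x (M *v y) = (\<Sum>j\<in>UNIV. \<Sum>k\<in>UNIV. x $ j * (M $ j $ k * y $ k))"
    by (simp add: cdot_def matrix_vector_mult_def sum_distrib_left)
  also have "\<dots> = (\<Sum>k\<in>UNIV. \<Sum>j\<in>UNIV. x $ j * (M $ j $ k * y $ k))" by (rule sum.swap)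
  also have "\<dots> = cdot (transpose M *v x) y"
    by (simp add: cdot_def matrix_vector_mult_def transpose_def sum_distrib_right sum_distrib_left mult_ac)
  finally show ?thesis .
qed

lemma cdot_double_sum: "cdot x (M *v y) = (\<Sum>j\<in>UNIV. \<Sum>k\<in>UNIV. M $ j $ k * x $ j * y $ k)"
  by (simp add: cdot_def matrix_vector_mult_def sum_distrib_left mult_ac)

lemma cvec_nth [simp]: "cvec y $ j = of_real (y $ j)"
  by (simp add: cvec_def)

lemma cvec_add: "cvec (x + y) = cvec x + cvec y"
  by (simp add: vec_eq_iff)

lemma cvec_minus: "cvec (- y) = - cvec y"
  by (simp add: vec_eq_iff)

lemma cvec_diff: "cvec (x - y) = cvec x - cvec y"
  by (simp add: vec_eq_iff)

lemma cvec_scaleR: "cvec (r *\<^sub>R x) = r *\<^sub>R cvec x"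
  by (simp add: vec_eq_iff scaleR_conv_of_real[where 'a=complex])

lemma cvec_0: "cvec 0 = 0"
  by (simp add: vec_eq_iff)

lemma linear_cvec: "linear cvec"
  by (rule linearI) (simp_all add: cvec_add cvec_scaleR)

lemma cdot_cvec: "cdot (cvec x) (cvec y) = of_real (x \<bullet> y)"
  by (simp add: cdot_def inner_vec_def)

lemma linear_cmatrix: "linear ((*v) (M :: complex^'n^'m))"
  by (rule linearI) (simp_all add: matrix_vector_right_distrib scaleR_matrix_vector_assoc[symmetric]
       vec_eq_iff matrix_vector_mult_def scaleR_sum_right sum.distrib distrib_left)

lemma matrix_vector_uminus: "(M :: complex^'n^'m) *v (- x) = - (M *v x)"
  using linear_neg[OF linear_cmatrix] .

lemma matrix_vector_scaleR: "(M :: complex^'n^'m) *v (r *\<^sub>R x) = r *\<^sub>R (M *v x)"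
  using linear_cmul[OF linear_cmatrix] .

lemma matrix_vector_diff: "(M :: complex^'n^'m) *v (x - y) = M *v x - M *v y"
  using linear_diff[OF linear_cmatrix] .

lemma matrix_vector_vscale: "(M :: complex^'n^'m) *v (c *s x) = c *s (M *v x)"
  by (simp add: vec_eq_iff matrix_vector_mult_def sum_distrib_left mult_ac)

lemmas matrix_vector_simps = matrix_vector_right_distrib matrix_vector_uminus matrix_vector_scaleR
  matrix_vector_diff matrix_vector_vscale

lemma bounded_bilinear_cdot: "bounded_bilinear (cdot :: complex^'n \<Rightarrow> _)"
proof
  show "\<exists>K. \<forall>(a::complex^'n) b. norm (cdot a b) \<le> norm a * norm b * K"
  proof (intro exI allI)
    fix a b :: "complex^'n"
    have "norm (cdot a b) \<le> (\<Sum>j\<in>UNIV. norm (a $ j) * norm (b $ j))"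
      unfolding cdot_def by (rule order_trans[OF norm_sum]) (simp add: norm_mult)
    also have "\<dots> \<le> (\<Sum>j\<in>(UNIV::'n set). norm a * norm b)"
      by (intro sum_mono mult_mono component_le_norm_cart Finite_Cartesian_Product.norm_nth_le) auto
    finally show "norm (cdot a b) \<le> norm a * norm b * real CARD('n)" by (simp add: mult_ac)
  qed
qed (simp_all add: cdot_simps scaleR_conv_of_real[where 'a=complex])

lemma continuous_on_cdot [continuous_intros]:
  fixes f g :: "'a::topological_space \<Rightarrow> complex^'n"
  shows "continuous_on A f \<Longrightarrow> continuous_on A g \<Longrightarrow> continuous_on A (\<lambda>x. cdot (f x) (g x))"
  by (rule bounded_bilinear.continuous_on[OF bounded_bilinear_cdot])

lemma continuous_on_linear_comp:
  fixes l :: "'b::euclidean_space \<Rightarrow> 'c::real_normed_vector"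
  assumes "linear l" "continuous_on A f"
  shows "continuous_on A (\<lambda>x. l (f x))"
  using linear_continuous_on[OF linear_conv_bounded_linear[THEN iffD1, OF assms(1)], of UNIV] assms(2)
  by (rule continuous_on_compose2) simp

lemmas continuous_on_cvec [continuous_intros] = continuous_on_linear_comp[OF linear_cvec]
lemmas continuous_on_cmatrix [continuous_intros] = continuous_on_linear_comp[OF linear_cmatrix]

lemma cgrad_quadratic:
  assumes "\<And>j t. f (x + t *s axis j 1) = f x + t * g $ j + t\<^sup>2 * c j"
  shows "cgrad f x = g"
proof -
  have "deriv (\<lambda>t. f (x + t *s axis j 1)) 0 = g $ j" for j
  proof (rule DERIV_imp_deriv)
    show "((\<lambda>t. f (x + t *s axis j 1)) has_field_derivative g $ j) (at 0)"
      unfolding assms by (auto intro!: derivative_eq_intros)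
  qed
  then show ?thesis by (simp add: cgrad_def vec_eq_iff)
qed

text \<open>The matrices are the second derivatives \<open>\<phi>''\<^sub>x\<^sub>x\<close>, \<open>\<phi>''\<^sub>x\<^sub>y\<close> and \<open>\<phi>''\<^sub>y\<^sub>y\<close>.\<close>

locale fbi_quadratic =
  fixes P Q R :: "complex^'n^'n"
    and \<phi> :: "complex^'n \<Rightarrow> complex^'n \<Rightarrow> complex"
  assumes symP: "transpose P = P" and symR: "transpose R = R" and detQ: "det Q \<noteq> 0"
    and posR: "\<And>v :: real^'n. v \<noteq> 0 \<Longrightarrow> 0 < v \<bullet> ((\<chi> j k. Im (R $ j $ k)) *v v)"
    and phase: "\<And>x y. \<phi> x y = (1/2) * cdot x (P *v x) + cdot x (Q *v y) + (1/2) * cdot y (R *v y)"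
begin

lemma P_sym: "cdot x (P *v y) = cdot y (P *v x)"
  using cdot_transpose[of x P y] symP cdot_commute[of y "P *v x"] by simp

lemma R_sym: "cdot x (R *v y) = cdot y (R *v x)"
  using cdot_transpose[of x R y] symR cdot_commute[of y "R *v x"] by simp

text \<open>Taylor expansion of a quadratic form, with the gradients \<open>\<phi>'\<^sub>x = P x + Q y\<close> and \<open>\<phi>'\<^sub>y = Q\<^sup>T x + R y\<close>.\<close>

lemma phase_add:
  "\<phi> (x + x') (y + y') = \<phi> x y + \<phi> x' y' + cdot x' (P *v x + Q *v y) + cdot y' (transpose Q *v x + R *v y)"
  unfolding phase matrix_vector_simps cdot_simps
  using P_sym[of x x'] R_sym[of y y'] cdot_transpose[of x Q y'] cdot_commute[of y' "transpose Q *v x"]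
  by (simp add: algebra_simps)

lemma phase_scale: "\<phi> (c *s x) (c *s y) = c\<^sup>2 * \<phi> x y"
  unfolding phase matrix_vector_simps cdot_simps by (simp add: algebra_simps power2_eq_square)

lemma phase_dx: "phase_dx \<phi> x y = P *v x + Q *v y"
  unfolding phase_dx_def
proof (rule cgrad_quadratic)
  fix j t
  show "\<phi> (x + t *s axis j 1) y = \<phi> x y + t * (P *v x + Q *v y) $ j + t\<^sup>2 * \<phi> (axis j 1) 0"
    using phase_add[of x "t *s axis j 1" y 0] phase_scale[of t "axis j 1" 0]
    by (simp add: cdot_simps cdot_axis_left distrib_left cdot_zero_left)
qed

lemma phase_dy: "phase_dy \<phi> x y = transpose Q *v x + R *v y"
  unfolding phase_dy_def
proof (rule cgrad_quadratic)
  fix j t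
  show "\<phi> x (y + t *s axis j 1) = \<phi> x y + t * (transpose Q *v x + R *v y) $ j + t\<^sup>2 * \<phi> 0 (axis j 1)"
    using phase_add[of x 0 y "t *s axis j 1"] phase_scale[of t 0 "axis j 1"]
    by (simp add: cdot_simps cdot_axis_left distrib_left cdot_zero_left)
qed

end

lemma cgrad_linear_component: "cgrad (\<lambda>y. (M *v y + a) $ j) 0 = M $ j"
proof (rule cgrad_quadratic[where c="\<lambda>_. 0"])
  fix k t
  have "(M *v (t *s axis k 1)) $ j = t * M $ j $ k"
  proof -
    have "(M *v (t *s axis k 1)) $ j = t * cdot (M $ j) (axis k 1)"
      by (simp add: matrix_vector_mult_def cdot_def sum_distrib_left mult_ac)
    then show ?thesis by (simp add: cdot_axis_right)
  qed
  then show "(M *v (0 + t *s axis k 1) + a) $ j = (M *v 0 + a) $ j + t * M $ j $ k + t\<^sup>2 * 0"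
    by simp
qed

lemma half_symmetrized:
  "cdot x (M *v x) = (1/2) * cdot x ((M + transpose M) *v x)"
  using cdot_transpose[of x M x] cdot_commute[of x "transpose M *v x"]
  by (simp add: matrix_vector_mult_add_rdistrib cdot_add_right)

lemma fbi_phase_imp_quadratic:
  fixes \<phi> :: "complex^'n \<Rightarrow> complex^'n \<Rightarrow> complex"
  assumes "fbi_phase \<phi>"
  obtains P Q R :: "complex^'n^'n" where "fbi_quadratic P Q R \<phi>"
proof -
  from assms obtain P0 Q R0 :: "complex^'n^'n" where \<phi>: "\<And>x y. \<phi> x y = (\<Sum>j\<in>UNIV. \<Sum>k\<in>UNIV.
      P0 $ j $ k * x $ j * x $ k + Q $ j $ k * x $ j * y $ k + R0 $ j $ k * y $ j * y $ k)"
    by (auto simp: fbi_phase_def holomorphic_quadratic_form_def)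
  define P R where "P = P0 + transpose P0" and "R = R0 + transpose R0"
  have sum_form: "\<phi> x y = cdot x (P0 *v x) + cdot x (Q *v y) + cdot y (R0 *v y)" for x y
    by (simp add: \<phi> cdot_double_sum sum.distrib)
  have form: "\<phi> x y = (1/2) * cdot x (P *v x) + cdot x (Q *v y) + (1/2) * cdot y (R *v y)" for x y
    unfolding P_def R_def half_symmetrized[symmetric] by (rule sum_form)
  have sym: "transpose P = P" "transpose R = R"
    by (simp_all add: P_def R_def vec_eq_iff transpose_def add.commute)
  have dx: "phase_dx \<phi> 0 y = Q *v y" for y
    unfolding phase_dx_def
  proof (rule cgrad_quadratic)
    fix j t
    show "\<phi> (0 + t *s axis j 1) y = \<phi> 0 y + t * (Q *v y) $ j + t\<^sup>2 * ((1/2) * cdot (axis j 1) (P *v axis j 1))"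
      unfolding form by (simp add: matrix_vector_simps cdot_simps cdot_axis_left power2_eq_square cdot_zero_left)
  qed
  have dy: "phase_dy \<phi> 0 y = R *v y" for y
    unfolding phase_dy_def
  proof (rule cgrad_quadratic)
    fix j t
    have "cdot y (R *v axis j 1) = (R *v y) $ j"
      using cdot_transpose[of y R "axis j 1"] by (simp add: sym cdot_axis_right)
    then show "\<phi> 0 (y + t *s axis j 1) = \<phi> 0 y + t * (R *v y) $ j + t\<^sup>2 * ((1/2) * cdot (axis j 1) (R *v axis j 1))"
      unfolding form by (simp add: matrix_vector_simps cdot_simps cdot_axis_left power2_eq_square field_simps cdot_zero_left)
  qed
  have "phase_dxy \<phi> = Q"
    using cgrad_linear_component[of Q 0] by (simp add: phase_dxy_def dx vec_eq_iff)
  moreover have "phase_dyy \<phi> = R"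
    using cgrad_linear_component[of R 0] by (simp add: phase_dyy_def dy vec_eq_iff)
  ultimately have "fbi_quadratic P Q R \<phi>"
    using assms sym form by unfold_locales (auto simp: fbi_phase_def)
  then show thesis by (rule that)
qed

lemma obtain_matrix_inverse:
  fixes M :: "complex^'n^'n"
  assumes "det M \<noteq> 0"
  obtains M' where "M ** M' = mat 1" "M' ** M = mat 1"
  using assms by (auto simp: invertible_det_nz[symmetric] invertible_def)

lemma linear_cdot_bound:
  fixes f g :: "'a::euclidean_space \<Rightarrow> complex^'n"
  assumes "linear f" "linear g"
  shows "\<exists>K\<ge>0. \<forall>t. norm (cdot (f t) (g t)) \<le> K * (norm t)\<^sup>2"
proof -
  have bl: "bounded_linear f" "bounded_linear g"
    using assms by (auto intro: linear_conv_bounded_linear[THEN iffD1])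
  interpret bounded_bilinear "\<lambda>s t. cdot (f s) (g t)"
    by (rule bounded_bilinear.comp[OF bounded_bilinear_cdot bl])
  obtain K where "K \<ge> 0" "\<And>s t. norm (cdot (f s) (g t)) \<le> norm s * norm t * K"
    using nonneg_bounded by blast
  then show ?thesis by (intro exI[of _ K]) (auto simp: power2_eq_square mult.commute)
qed

context fbi_quadratic
begin

definition Qt_inv :: "complex^'n^'n" where
  "Qt_inv = (SOME M. transpose Q ** M = mat 1 \<and> M ** transpose Q = mat 1)"

lemma Qt_inv: "transpose Q ** Qt_inv = mat 1" "Qt_inv ** transpose Q = mat 1"
proof -
  have "det (transpose Q) \<noteq> 0" using detQ by simp
  then have "\<exists>M. transpose Q ** M = mat 1 \<and> M ** transpose Q = mat 1"
    by (meson obtain_matrix_inverse)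
  from someI_ex[OF this] show "transpose Q ** Qt_inv = mat 1" "Qt_inv ** transpose Q = mat 1"
    unfolding Qt_inv_def by auto
qed

lemma Qt_Qt_inv: "transpose Q *v (Qt_inv *v z) = z"
  using Qt_inv by (simp add: matrix_vector_mul_assoc)

lemma Qt_inv_Qt: "Qt_inv *v (transpose Q *v z) = z"
  using Qt_inv by (simp add: matrix_vector_mul_assoc)

text \<open>The two components of \<open>\<kappa>\<^sub>T (y, \<eta>)\<close>: the solution \<open>x\<close> of \<open>Q\<^sup>T x + R y = - \<eta>\<close>, and \<open>\<phi>'\<^sub>x\<close> there.\<close>

definition base :: "(real^'n) \<times> (real^'n) \<Rightarrow> complex^'n" where
  "base \<zeta> = - (Qt_inv *v (cvec (snd \<zeta>) + R *v cvec (fst \<zeta>)))"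

definition fibre :: "(real^'n) \<times> (real^'n) \<Rightarrow> complex^'n" where
  "fibre \<zeta> = P *v base \<zeta> + Q *v cvec (fst \<zeta>)"

lemma base_eq: "transpose Q *v base \<zeta> + R *v cvec (fst \<zeta>) = - cvec (snd \<zeta>)"
  by (simp add: base_def matrix_vector_simps Qt_Qt_inv)

lemma base_unique: "- phase_dy \<phi> x (cvec y) = cvec \<eta> \<longleftrightarrow> x = base (y, \<eta>)"
proof
  assume "- phase_dy \<phi> x (cvec y) = cvec \<eta>"
  then have "transpose Q *v x = - (cvec \<eta> + R *v cvec y)"
    by (simp add: phase_dy algebra_simps flip: eq_neg_iff_add_eq_0)
  then have "Qt_inv *v (transpose Q *v x) = - (Qt_inv *v (cvec \<eta> + R *v cvec y))"
    by (simp add: matrix_vector_simps)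
  then show "x = base (y, \<eta>)" by (simp add: Qt_inv_Qt base_def)
next
  assume "x = base (y, \<eta>)"
  then show "- phase_dy \<phi> x (cvec y) = cvec \<eta>"
    using base_eq[of "(y, \<eta>)"] by (simp add: phase_dy)
qed

lemma canonical_trafo_eq: "canonical_trafo \<phi> \<zeta> = (base \<zeta>, fibre \<zeta>)"
proof -
  obtain y \<eta> where \<zeta>: "\<zeta> = (y, \<eta>)" by (cases \<zeta>)
  have "(THE x. - phase_dy \<phi> x (cvec y) = cvec \<eta>) = base (y, \<eta>)"
    unfolding base_unique by simp
  then show ?thesis
    by (simp add: \<zeta> canonical_trafo_def complex_canonical_def phase_dx fibre_def Let_def)
qed

lemma linear_base: "linear base"
  by (rule linearI) (simp_all add: base_def cvec_add cvec_scaleR matrix_vector_simps algebra_simps)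

lemma linear_fibre: "linear fibre"
  by (rule linearI) (simp_all add: fibre_def linear_add[OF linear_base] linear_cmul[OF linear_base]
      cvec_add cvec_scaleR matrix_vector_simps algebra_simps)

lemma Im_R: "Im (cdot (cvec v) (R *v cvec v)) = v \<bullet> ((\<chi> j k. Im (R $ j $ k)) *v v)"
proof -
  have "Im (cdot (cvec v) (R *v cvec v)) = (\<Sum>j\<in>UNIV. \<Sum>k\<in>UNIV. Im (R $ j $ k) * v $ j * v $ k)"
    unfolding cdot_double_sum by simp
  then show ?thesis
    by (simp add: inner_vec_def matrix_vector_mult_def sum_distrib_left mult_ac)
qed

text \<open>The minimum on the unit sphere is positive; homogeneity does the rest.\<close>

lemma Im_R_coercive: "\<exists>c>0. \<forall>v. c * (norm v)\<^sup>2 \<le> Im (cdot (cvec v) (R *v cvec v))"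
proof -
  let ?q = "\<lambda>v. Im (cdot (cvec v) (R *v cvec v))"
  have "continuous_on (sphere 0 1) ?q"
    by (intro continuous_intros)
  moreover have "sphere 0 1 \<noteq> ({} :: (real^'n) set)" by simp
  ultimately obtain m where m: "m \<in> sphere 0 1" "\<And>v. v \<in> sphere 0 1 \<Longrightarrow> ?q m \<le> ?q v"
    using continuous_attains_inf[of "sphere 0 1" ?q] by auto
  have pos: "?q m > 0" unfolding Im_R using m(1) by (intro posR) auto
  have "?q m * (norm v)\<^sup>2 \<le> ?q v" for v
  proof (cases "v = 0")
    case True
    then show ?thesis by (simp add: cvec_0 cdot_zero_left)
  next
    case False
    have "?q m \<le> ?q (inverse (norm v) *\<^sub>R v)" using False by (intro m(2)) simp
    also have "\<dots> = inverse (norm v) ^ 2 * ?q v"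
      by (simp add: cvec_scaleR matrix_vector_simps cdot_simps power2_eq_square flip: of_real_mult of_real_inverse)
    finally show ?thesis using False by (simp add: field_simps)
  qed
  with pos show ?thesis by blast
qed

lemma Im_R_nonneg: "0 \<le> Im (cdot (cvec v) (R *v cvec v))"
  using Im_R_coercive by (meson less_imp_le mult_nonneg_nonneg order_trans zero_le_power2)

text \<open>If \<open>x = 0\<close> then \<open>R y = - \<eta>\<close> is real, so \<open>Im R\<close> annihilates \<open>y\<close>.\<close>

lemma base_injective: "base \<zeta> = 0 \<Longrightarrow> \<zeta> = 0"
proof -
  assume "base \<zeta> = 0"
  then have eq: "R *v cvec (fst \<zeta>) = - cvec (snd \<zeta>)" using base_eq[of \<zeta>] by simp
  then have "Im (cdot (cvec (fst \<zeta>)) (R *v cvec (fst \<zeta>))) = 0"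
    by (simp add: cdot_minus_right cdot_cvec)
  then have fst0: "fst \<zeta> = 0" using posR[of "fst \<zeta>"] by (auto simp: Im_R)
  then have "cvec (snd \<zeta>) = 0" using eq by (simp add: cvec_0)
  then have "snd \<zeta> = 0" by (simp add: vec_eq_iff)
  with fst0 show "\<zeta> = 0" by (simp add: prod_eq_iff)
qed

lemma bij_base: "bij base"
proof -
  have inj: "inj base" using base_injective by (simp add: linear_injective_0[OF linear_base])
  moreover have "surj base"
  proof -
    have "dim (range base) = DIM(complex^'n)"
      using dim_image_eq[OF linear_base, of UNIV] inj by simp
    then have "span (range base) = UNIV" by (rule dim_eq_full[THEN iffD1])
    then show ?thesis
      using linear_subspace_image[OF linear_base subspace_UNIV] by (metis span_eq_iff)
  qed
  ultimately show ?thesis by (simp add: bij_def)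
qed

definition base_inv :: "complex^'n \<Rightarrow> (real^'n) \<times> (real^'n)" where
  "base_inv = inv base"

lemma base_base_inv [simp]: "base (base_inv x) = x"
  unfolding base_inv_def using bij_base by (simp add: bij_is_surj surj_f_inv_f)

lemma base_inv_base [simp]: "base_inv (base \<zeta>) = \<zeta>"
  unfolding base_inv_def using bij_base by (simp add: bij_is_inj inv_f_f)

lemma linear_base_inv: "linear base_inv"
proof (rule linearI)
  fix x y r
  have "base_inv (base (base_inv x + base_inv y)) = base_inv x + base_inv y" by (rule base_inv_base)
  then show "base_inv (x + y) = base_inv x + base_inv y" by (simp add: linear_add[OF linear_base])
  have "base_inv (base (r *\<^sub>R base_inv x)) = r *\<^sub>R base_inv x" by (rule base_inv_base)
  then show "base_inv (r *\<^sub>R x) = r *\<^sub>R base_inv x" by (simp add: linear_cmul[OF linear_base])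
qed

text \<open>Along the real directions the phase has real first derivative \<open>- \<eta>\<close> at the critical point.\<close>

lemma phase_expansion:
  "\<phi> (base \<zeta>) (cvec (fst \<zeta> + s)) = \<phi> (base \<zeta>) (cvec (fst \<zeta>)) - of_real (s \<bullet> snd \<zeta>)
     + (1/2) * cdot (cvec s) (R *v cvec s)"
proof -
  have "\<phi> (base \<zeta> + 0) (cvec (fst \<zeta>) + cvec s) = \<phi> (base \<zeta>) (cvec (fst \<zeta>)) + \<phi> 0 (cvec s)
      + cdot 0 (P *v base \<zeta> + Q *v cvec (fst \<zeta>)) + cdot (cvec s) (transpose Q *v base \<zeta> + R *v cvec (fst \<zeta>))"
    by (rule phase_add)
  then show ?thesis
    by (simp add: base_eq cvec_add cdot_zero_left cdot_minus_right cdot_cvec phase)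
qed

abbreviation "\<Phi> \<equiv> fbi_weight \<phi>"

text \<open>Since the linear term of the expansion is real and \<open>Im R\<close> is positive, the supremum defining \<open>\<Phi>\<close> is
  attained at the real point over which \<open>x\<close> lies.\<close>

lemma weight_base: "\<Phi> (base \<zeta>) = - Im (\<phi> (base \<zeta>) (cvec (fst \<zeta>)))"
  unfolding fbi_weight_def
proof (rule cSup_eq_maximum)
  fix r assume "r \<in> range (\<lambda>y. - Im (\<phi> (base \<zeta>) (cvec y)))"
  then obtain y where "r = - Im (\<phi> (base \<zeta>) (cvec y))" by blast
  then show "r \<le> - Im (\<phi> (base \<zeta>) (cvec (fst \<zeta>)))"
    using phase_expansion[of \<zeta> "y - fst \<zeta>"] Im_R_nonneg[of "y - fst \<zeta>"] by simp
qed simp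

text \<open>Of the two mixed terms in the expansion of the phase, the one along \<open>\<real>\<^sup>n\<close> is real and disappears in
  the imaginary part. Hence the derivative of \<open>\<Phi>\<close> is given by \<open>\<phi>'\<^sub>x\<close>, and \<open>\<kappa>\<^sub>T\<close> maps into
  \<open>\<Lambda>\<^sub>\<Phi>\<close>.\<close>

lemma weight_add: "\<Phi> (x + t) = \<Phi> x + \<Phi> t - Im (cdot (fibre (base_inv x)) t)"
proof -
  let ?\<zeta> = "base_inv x" and ?\<tau> = "base_inv t"
  have "\<phi> (base ?\<zeta> + base ?\<tau>) (cvec (fst ?\<zeta>) + cvec (fst ?\<tau>)) = \<phi> (base ?\<zeta>) (cvec (fst ?\<zeta>)) + \<phi> (base ?\<tau>) (cvec (fst ?\<tau>))
      + cdot (base ?\<tau>) (fibre ?\<zeta>) - of_real (fst ?\<tau> \<bullet> snd ?\<zeta>)"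
    unfolding phase_add base_eq fibre_def by (simp add: cdot_minus_right cdot_cvec)
  then have "Im (\<phi> (base (?\<zeta> + ?\<tau>)) (cvec (fst (?\<zeta> + ?\<tau>)))) = Im (\<phi> (base ?\<zeta>) (cvec (fst ?\<zeta>)))
      + Im (\<phi> (base ?\<tau>) (cvec (fst ?\<tau>))) + Im (cdot (fibre ?\<zeta>) t)"
    by (simp add: linear_add[OF linear_base] cvec_add cdot_commute[of t])
  then have "\<Phi> (base (?\<zeta> + ?\<tau>)) = \<Phi> (base ?\<zeta>) + \<Phi> (base ?\<tau>) - Im (cdot (fibre ?\<zeta>) t)"
    unfolding weight_base by simp
  then show ?thesis by (simp add: linear_add[OF linear_base])
qed

lemma weight_minus: "\<Phi> (- t) = \<Phi> t"
  using phase_scale[of "-1" "base (base_inv t)" "cvec (fst (base_inv t))"]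
    weight_base[of "- base_inv t"] weight_base[of "base_inv t"]
  by (simp add: linear_neg[OF linear_base] cvec_minus vector_sneg_minus1[symmetric])

lemma weight_bound: "\<exists>K\<ge>0. \<forall>t. \<bar>\<Phi> t\<bar> \<le> K * (norm t)\<^sup>2"
proof -
  let ?y = "\<lambda>t. cvec (fst (base_inv t))"
  have y: "linear ?y"
    using linear_compose[OF linear_compose[OF linear_base_inv linear_fst] linear_cvec] by (simp add: o_def)
  have M: "linear (\<lambda>t. M *v ?y t)" for M :: "complex^'n^'n"
    using linear_compose[OF y linear_cmatrix[of M]] by (simp add: o_def)
  obtain K1 where K1: "K1 \<ge> 0" "\<And>t. norm (cdot t (P *v t)) \<le> K1 * (norm t)\<^sup>2"
    using linear_cdot_bound[OF linear_ident linear_cmatrix[of P]] by blast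
  obtain K2 where K2: "K2 \<ge> 0" "\<And>t. norm (cdot t (Q *v ?y t)) \<le> K2 * (norm t)\<^sup>2"
    using linear_cdot_bound[OF linear_ident M[of Q]] by blast
  obtain K3 where K3: "K3 \<ge> 0" "\<And>t. norm (cdot (?y t) (R *v ?y t)) \<le> K3 * (norm t)\<^sup>2"
    using linear_cdot_bound[OF y M[of R]] by blast
  have "\<bar>\<Phi> t\<bar> \<le> (K1 + K2 + K3) * (norm t)\<^sup>2" for t
  proof -
    have "\<bar>\<Phi> t\<bar> \<le> norm (\<phi> t (?y t))"
      using weight_base[of "base_inv t"] abs_Im_le_cmod[of "\<phi> t (?y t)"] by simp
    also have "\<dots> \<le> norm ((1/2) * cdot t (P *v t)) + norm (cdot t (Q *v ?y t)) + norm ((1/2) * cdot (?y t) (R *v ?y t))"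
      unfolding phase by (intro norm_triangle_le add_right_mono norm_triangle_ineq)
    also have "\<dots> \<le> K1 * (norm t)\<^sup>2 + K2 * (norm t)\<^sup>2 + K3 * (norm t)\<^sup>2"
    proof (intro add_mono K2)
      have "norm ((1/2) * z) \<le> norm z" for z :: complex by (simp add: norm_mult)
      then show "norm ((1/2) * cdot t (P *v t)) \<le> K1 * (norm t)\<^sup>2" "norm ((1/2) * cdot (?y t) (R *v ?y t)) \<le> K3 * (norm t)\<^sup>2"
        using K1(2) K3(2) order_trans by blast+
    qed
    finally show ?thesis by (simp add: algebra_simps)
  qed
  with K1(1) K2(1) K3(1) show ?thesis by (intro exI[of _ "K1 + K2 + K3"]) auto
qed

lemma has_derivative_weight: "(\<Phi> has_derivative (\<lambda>t. - Im (cdot (fibre (base_inv x)) t))) (at x)"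
proof -
  obtain K where K: "K \<ge> 0" "\<And>t. \<bar>\<Phi> t\<bar> \<le> K * (norm t)\<^sup>2" using weight_bound by blast
  have bl: "bounded_linear (\<lambda>t. - Im (cdot (fibre (base_inv x)) t))"
    by (intro bounded_linear_minus bounded_linear_compose[OF bounded_linear_Im]
        bounded_bilinear.bounded_linear_right[OF bounded_bilinear_cdot])
  have "((\<lambda>t. \<bar>\<Phi> t\<bar> / norm t) \<longlongrightarrow> 0) (at 0)"
  proof (rule tendsto_sandwich[of "\<lambda>_. 0"])
    have "\<bar>\<Phi> t\<bar> / norm t \<le> K * norm t" for t
    proof (cases "t = 0")
      case False
      then show ?thesis using K(2)[of t] by (simp add: field_simps power2_eq_square)
    qed simp
    then show "\<forall>\<^sub>F t in at 0. \<bar>\<Phi> t\<bar> / norm t \<le> K * norm t" by simp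
    show "((\<lambda>t. K * norm t) \<longlongrightarrow> 0) (at (0::complex^'n))"
      by (rule tendsto_eq_intros refl)+ simp
  qed auto
  then show ?thesis
    using bl by (simp add: has_derivative_at weight_add)
qed

text \<open>For \<open>d\<Phi> = - Im (\<theta> \<cdot> dx)\<close> one has \<open>\<partial>\<Phi>/\<partial>x = (\<i> / 2) \<theta>\<close>.\<close>

lemma Lambda_fibre_eq: "Lambda_fibre \<Phi> x = fibre (base_inv x)"
proof -
  have d: "frechet_derivative \<Phi> (at x) = (\<lambda>t. - Im (cdot (fibre (base_inv x)) t))"
    using frechet_derivative_at[OF has_derivative_weight] by simp
  show ?thesis
    unfolding Lambda_fibre_def wirtinger_grad_def d vec_eq_iff
    by (simp add: cdot_axis_right complex_eq_iff)
qed

lemma Lambda_fibre_base: "Lambda_fibre \<Phi> (base \<zeta>) = fibre \<zeta>"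
  by (simp add: Lambda_fibre_eq)

end

section \<open>The Jacobian of the contour\<close>

definition cart_pair :: "real^('n + 'n) \<Rightarrow> (real^'n) \<times> (real^'n)" where
  "cart_pair v = (\<chi> j. v $ Inl j, \<chi> j. v $ Inr j)"

definition cart_complex :: "real^('n + 'n) \<Rightarrow> complex^'n" where
  "cart_complex v = (\<chi> j. Complex (v $ Inl j) (v $ Inr j))"

lemma linear_cart_pair: "linear cart_pair"
  by (rule linearI) (simp_all add: cart_pair_def vec_eq_iff)

lemma linear_cart_complex: "linear cart_complex"
  by (rule linearI) (simp_all add: cart_complex_def vec_eq_iff complex_eq_iff)

lemma cart_pair_axis:
  "cart_pair (axis (Inl k) 1) = (axis k 1, 0)" "cart_pair (axis (Inr k) 1) = (0, axis k 1)"
  by (auto simp: cart_pair_def axis_def vec_eq_iff)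

lemma cart_complex_axis: "cart_complex (axis c 1) = real_basis_vec c"
  by (cases c) (auto simp: cart_complex_def real_basis_vec_def axis_def vec_eq_iff complex_eq_iff)

lemma UNIV_sum_type: "(UNIV :: ('a + 'b) set) = range Inl \<union> range Inr"
  by (metis UNIV_sum)

lemma sum_UNIV_sum_type:
  fixes f :: "'a::finite + 'b::finite \<Rightarrow> 'c::comm_monoid_add"
  shows "(\<Sum>c\<in>UNIV. f c) = (\<Sum>j\<in>UNIV. f (Inl j)) + (\<Sum>j\<in>UNIV. f (Inr j))"
  unfolding UNIV_sum_type by (subst sum.union_disjoint) (auto simp: sum.reindex inj_def)

lemma bij_cart_pair: "bij_betw (cart_pair :: real^('n::finite + 'n) \<Rightarrow> _) Basis Basis"
  unfolding bij_betw_def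
proof
  show "inj_on (cart_pair :: real^('n + 'n) \<Rightarrow> _) Basis"
    unfolding inj_on_def
  proof (intro ballI impI)
    fix x y :: "real^('n + 'n)" assume "cart_pair x = cart_pair y"
    then have "x $ Inl j = y $ Inl j" "x $ Inr j = y $ Inr j" for j by (auto simp: cart_pair_def vec_eq_iff)
    then show "x = y" unfolding vec_eq_iff by (metis sum.exhaust)
  qed
  have "cart_pair ` Basis = range (\<lambda>k::'n. cart_pair (axis (Inl k) 1)) \<union> range (\<lambda>k::'n. cart_pair (axis (Inr k) 1))"
    unfolding Basis_cart UNIV_sum_type by auto
  also have "\<dots> = Basis" unfolding cart_pair_axis Basis_prod_def Basis_cart by auto
  finally show "cart_pair ` (Basis :: (real^('n + 'n)) set) = Basis" .
qed

lemma bij_cart_complex: "bij_betw (cart_complex :: real^('n::finite + 'n) \<Rightarrow> _) Basis Basis"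
  unfolding bij_betw_def
proof
  show "inj_on (cart_complex :: real^('n + 'n) \<Rightarrow> _) Basis"
    unfolding inj_on_def
  proof (intro ballI impI)
    fix x y :: "real^('n + 'n)" assume "cart_complex x = cart_complex y"
    then have "x $ Inl j = y $ Inl j" "x $ Inr j = y $ Inr j" for j by (auto simp: cart_complex_def vec_eq_iff)
    then show "x = y" unfolding vec_eq_iff by (metis sum.exhaust)
  qed
  have "cart_complex ` Basis = range (\<lambda>k::'n. axis k (1::complex)) \<union> range (\<lambda>k::'n. axis k \<i>)"
    unfolding Basis_cart UNIV_sum_type image_Un image_image cart_complex_axis real_basis_vec_def by simp
  also have "\<dots> = Basis" by (auto simp: Basis_vec_def Basis_complex_def)
  finally show "cart_complex ` (Basis :: (real^('n + 'n)) set) = Basis" .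
qed

lemma cart_complex_expand: "cart_complex v = (\<Sum>c\<in>UNIV. v $ c *\<^sub>R real_basis_vec c)"
proof -
  have "cart_complex v = (\<Sum>b\<in>Basis. (v \<bullet> b) *\<^sub>R cart_complex b)"
    by (rule linear_expansion_Basis[OF linear_cart_complex])
  then show ?thesis
    unfolding Basis_cart sum.reindex[OF inj_axis_1] by (simp add: cart_complex_axis inner_axis)
qed

text \<open>The map \<open>N\<close> with its target in the real coordinates \<open>Re x\<^sub>j\<close>, \<open>Im x\<^sub>j\<close>.\<close>

definition cart_map :: "((real^'n) \<times> (real^'n) \<Rightarrow> complex^'n) \<Rightarrow> real^('n + 'n) \<Rightarrow> real^('n + 'n)" where
  "cart_map N v = (\<chi> c. case c of Inl j \<Rightarrow> Re (N (cart_pair v) $ j) | Inr j \<Rightarrow> Im (N (cart_pair v) $ j))"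

lemma cart_complex_cart_map: "cart_complex (cart_map N v) = N (cart_pair v)"
  by (simp add: cart_complex_def cart_map_def vec_eq_iff)

lemma linear_cart_map:
  assumes "linear N"
  shows "linear (cart_map N)"
proof (rule linearI)
  show "cart_map N (x + y) = cart_map N x + cart_map N y" for x y
    by (auto simp: cart_map_def vec_eq_iff linear_add[OF linear_cart_pair] linear_add[OF assms] split: sum.split)
  show "cart_map N (r *\<^sub>R x) = r *\<^sub>R cart_map N x" for r x
    by (auto simp: cart_map_def vec_eq_iff linear_cmul[OF linear_cart_pair] linear_cmul[OF assms] split: sum.split)
qed

lemma lborel_change_of_variables:
  fixes N :: "(real^'n) \<times> (real^'n) \<Rightarrow> complex^'n"
  assumes N: "linear N" and det: "det (matrix (cart_map N)) \<noteq> 0"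
  shows "(lborel :: (complex^'n) measure) = density (distr lborel borel N) (\<lambda>_. ennreal \<bar>det (matrix (cart_map N))\<bar>)"
proof (rule measure_eqI)
  fix A :: "(complex^'n) set" assume "A \<in> sets lborel"
  then have A [measurable]: "A \<in> sets borel" by simp
  have [measurable]: "N \<in> borel_measurable borel" "cart_map N \<in> borel_measurable borel"
      "(cart_complex :: real^('n + 'n) \<Rightarrow> _) \<in> borel_measurable borel"
    using N linear_cart_map[OF N] linear_cart_complex by (auto intro: borel_measurable_linear)
  have "emeasure lborel A = (\<integral>\<^sup>+z. indicator A z \<partial>lborel)" by simp
  also have "\<dots> = (\<integral>\<^sup>+v. indicator A (cart_complex v) \<partial>lborel)"
    by (rule nn_integral_bij_Basis[OF linear_cart_complex bij_cart_complex, symmetric]) measurable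
  also have "\<dots> = ennreal \<bar>det (matrix (cart_map N))\<bar> * (\<integral>\<^sup>+v. indicator A (cart_complex (cart_map N v)) \<partial>lborel)"
    by (rule nn_integral_linear_cart[OF linear_cart_map[OF N] det]) measurable
  also have "(\<integral>\<^sup>+v. indicator A (cart_complex (cart_map N v)) \<partial>lborel) = (\<integral>\<^sup>+\<zeta>. indicator A (N \<zeta>) \<partial>lborel)"
    unfolding cart_complex_cart_map
    by (rule nn_integral_bij_Basis[OF linear_cart_pair bij_cart_pair]) measurable
  also have "ennreal \<bar>det (matrix (cart_map N))\<bar> * (\<integral>\<^sup>+\<zeta>. indicator A (N \<zeta>) \<partial>lborel)
      = emeasure (density (distr lborel borel N) (\<lambda>_. ennreal \<bar>det (matrix (cart_map N))\<bar>)) A"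
    using nn_integral_distr[of N lborel borel "indicator A :: _ \<Rightarrow> ennreal"]
    by (simp add: emeasure_density nn_integral_cmult)
  finally show "emeasure lborel A = emeasure (density (distr lborel borel N) (\<lambda>_. ennreal \<bar>det (matrix (cart_map N))\<bar>)) A" .
qed simp

lemma det_of_real:
  fixes A :: "real^'m^'m"
  shows "det (\<chi> i j. complex_of_real (A $ i $ j)) = complex_of_real (det A)"
  by (simp add: det_def)

definition symplectic_matrix :: "complex^('n::finite + 'n)^('n + 'n)" where
  "symplectic_matrix = (\<chi> r s. case r of
     Inl j \<Rightarrow> (case s of Inl k \<Rightarrow> 0 | Inr k \<Rightarrow> of_bool (j = k))
   | Inr j \<Rightarrow> (case s of Inl k \<Rightarrow> - of_bool (j = k) | Inr k \<Rightarrow> 0))"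

lemma symplectic_matrix_mult:
  fixes M :: "complex^('n::finite + 'n)^('n + 'n)"
  shows "(symplectic_matrix ** M) $ Inl j $ d = M $ Inr j $ d"
    and "(symplectic_matrix ** M) $ Inr j $ d = - M $ Inl j $ d"
proof -
  have *: "(\<Sum>k\<in>(UNIV::'n set). of_bool (j = k) * f k) = f j" for f :: "'n \<Rightarrow> complex"
    by (simp add: of_bool_def if_distrib[of "\<lambda>x. x * _"] cong: if_cong)
  show "(symplectic_matrix ** M) $ Inl j $ d = M $ Inr j $ d"
    using *[of "\<lambda>k. M $ Inr k $ d"] by (simp add: matrix_matrix_mult_def symplectic_matrix_def sum_UNIV_sum_type)
  show "(symplectic_matrix ** M) $ Inr j $ d = - M $ Inl j $ d"
    using *[of "\<lambda>k. M $ Inl k $ d"] by (simp add: matrix_matrix_mult_def symplectic_matrix_def sum_UNIV_sum_type sum_negf)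
qed

lemma det_symplectic_matrix: "det (symplectic_matrix :: complex^('n::finite + 'n)^('n + 'n)) \<noteq> 0"
proof -
  let ?J = "symplectic_matrix :: complex^('n + 'n)^('n + 'n)"
  have "(?J ** (- ?J)) $ r $ d = mat 1 $ r $ d" for r d
    by (cases r; cases d; simp add: symplectic_matrix_mult; simp add: symplectic_matrix_def mat_def)
  then have "?J ** (- ?J) = mat 1" by (simp add: vec_eq_iff)
  then have "det ?J * det (- ?J) = 1" by (metis det_mul det_I)
  then show ?thesis by auto
qed

text \<open>Take determinants in \<open>M\<^sup>T J M = J\<close>.\<close>

lemma norm_det_symplectic:
  fixes M :: "complex^('n::finite + 'n)^('n + 'n)"
  assumes "\<And>c d. (\<Sum>j\<in>UNIV. M $ Inl j $ c * M $ Inr j $ d) - (\<Sum>j\<in>UNIV. M $ Inr j $ c * M $ Inl j $ d)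
     = symplectic_matrix $ c $ d"
  shows "norm (det M) = 1"
proof -
  have "(transpose M ** (symplectic_matrix ** M)) $ c $ d = symplectic_matrix $ c $ d" for c d
  proof -
    have "(transpose M ** (symplectic_matrix ** M)) $ c $ d
        = (\<Sum>r\<in>UNIV. M $ r $ c * (symplectic_matrix ** M) $ r $ d)"
      by (subst matrix_matrix_mult_def) (simp add: transpose_def)
    also have "\<dots> = (\<Sum>j\<in>UNIV. M $ Inl j $ c * M $ Inr j $ d) - (\<Sum>j\<in>UNIV. M $ Inr j $ c * M $ Inl j $ d)"
      by (simp add: sum_UNIV_sum_type symplectic_matrix_mult sum_negf)
    finally show ?thesis using assms by simp
  qed
  then have "transpose M ** (symplectic_matrix ** M) = symplectic_matrix" by (simp add: vec_eq_iff)
  then have "det M * (det (symplectic_matrix :: complex^('n + 'n)^('n + 'n)) * det M) = det (symplectic_matrix :: complex^('n + 'n)^('n + 'n))"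
    by (metis det_mul det_transpose)
  then have "(det M)\<^sup>2 = 1" using det_symplectic_matrix[where 'n='n] by (simp add: power2_eq_square)
  then have "(norm (det M))\<^sup>2 = 1" by (metis norm_one norm_power)
  then show ?thesis by (simp add: power2_eq_1_iff) (smt (verit) norm_ge_zero)
qed

context fbi_quadratic
begin

text \<open>The parameter \<open>(w, \<eta>)\<close> stands for the point \<open>y\<close> with \<open>(x + y) / 2 = base (w / 2, \<eta>)\<close>, up to the
  translation by \<open>x\<close>. Halving \<open>w\<close> makes the parametrization of the contour symplectic, and on the real
  side \<open>w\<close> becomes the sum of the two space variables.\<close>

definition midpoint_param :: "(real^'n) \<times> (real^'n) \<Rightarrow> complex^'n" where
  "midpoint_param \<zeta> = 2 *\<^sub>R base ((1/2) *\<^sub>R fst \<zeta>, snd \<zeta>)"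

lemma linear_midpoint_param: "linear midpoint_param"
proof (rule linearI)
  fix x y :: "(real^'n) \<times> (real^'n)" and r :: real
  show "midpoint_param (x + y) = midpoint_param x + midpoint_param y"
    using linear_add[OF linear_base, of "((1/2) *\<^sub>R fst x, snd x)" "((1/2) *\<^sub>R fst y, snd y)"]
    by (simp add: midpoint_param_def scaleR_add_right)
  show "midpoint_param (r *\<^sub>R x) = r *\<^sub>R midpoint_param x"
    using linear_cmul[OF linear_base, of r "((1/2) *\<^sub>R fst x, snd x)"]
    by (simp add: midpoint_param_def)
qed

lemma base_inv_half_midpoint_param: "base_inv ((1/2) *\<^sub>R midpoint_param \<zeta>) = ((1/2) *\<^sub>R fst \<zeta>, snd \<zeta>)"
  by (simp add: midpoint_param_def)

text \<open>The symmetry of \<open>P\<close> and \<open>R\<close> cancels everything except the terms coming from \<open>- \<eta> = Q\<^sup>T x + R y\<close>.\<close>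

lemma symplectic:
  "cdot (base \<zeta>) (fibre \<zeta>') - cdot (fibre \<zeta>) (base \<zeta>') = of_real (fst \<zeta> \<bullet> snd \<zeta>' - snd \<zeta> \<bullet> fst \<zeta>')"
proof -
  have Qt: "transpose Q *v base \<zeta> = - cvec (snd \<zeta>) - R *v cvec (fst \<zeta>)" for \<zeta>
    using base_eq[of \<zeta>] by (simp add: algebra_simps)
  have "cdot (base \<zeta>) (fibre \<zeta>') - cdot (base \<zeta>') (fibre \<zeta>)
      = cdot (transpose Q *v base \<zeta>) (cvec (fst \<zeta>')) - cdot (transpose Q *v base \<zeta>') (cvec (fst \<zeta>))"
    unfolding fibre_def cdot_add_right P_sym[of "base \<zeta>"] cdot_transpose[of _ Q] by simp
  also have "\<dots> = of_real (fst \<zeta> \<bullet> snd \<zeta>' - snd \<zeta> \<bullet> fst \<zeta>')"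
    unfolding Qt cdot_diff_left cdot_minus_left cdot_cvec
    using R_sym[of "cvec (fst \<zeta>)" "cvec (fst \<zeta>')"] cdot_commute[of "R *v _"]
    by (simp add: inner_commute cdot_commute[of "R *v _"])
  finally show ?thesis by (simp add: cdot_commute[of "fibre \<zeta>"])
qed

text \<open>The product of the matrix \<open>D\<close> of \<open>dy \<and> d\<theta>\<close> on the contour with the real matrix of the
  parametrization is the matrix of a symplectic map: it is \<open>\<kappa>\<^sub>T\<close> preceded by halving \<open>w\<close> and followed
  by doubling \<open>x\<close>. So the contour density is the reciprocal of the Jacobian.\<close>

lemma contour_density_det:
  "contour_density (\<lambda>y. Lambda_fibre \<Phi> ((1/2) *\<^sub>R (x + y))) y * \<bar>det (matrix (cart_map midpoint_param))\<bar> = 1"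
proof -
  let ?g = "\<lambda>y. Lambda_fibre \<Phi> ((1/2) *\<^sub>R (x + y))"
  define G where "G v = fibre (base_inv ((1/2) *\<^sub>R v))" for v
  have G: "linear G"
    unfolding G_def by (rule linearI)
      (simp_all add: scaleR_add_right linear_add[OF linear_base_inv] linear_add[OF linear_fibre]
         linear_cmul[OF linear_base_inv] linear_cmul[OF linear_fibre])
  have gG: "?g = (\<lambda>y. G x + G y)"
    unfolding Lambda_fibre_eq using linear_add[OF G] by (simp add: G_def)
  have "(?g has_derivative G) (at y)"
    unfolding gG using linear_conv_bounded_linear[THEN iffD1, OF G]
    by (auto intro!: derivative_eq_intros bounded_linear_imp_has_derivative)
  then have fd: "frechet_derivative ?g (at y) = G" by (rule frechet_derivative_at[symmetric])
  define D where "D = (\<chi> r c. (case r of Inl j \<Rightarrow> real_basis_vec c $ j | Inr j \<Rightarrow> G (real_basis_vec c) $ j) :: complex^('n + 'n)^('n + 'n))"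
  define A where "A = matrix (cart_map midpoint_param)"
  define M where "M = D ** (\<chi> i j. complex_of_real (A $ i $ j))"
  define Z where "Z c = cart_pair (axis c 1 :: real^('n + 'n))" for c
  have expand: "midpoint_param (Z c) = (\<Sum>k\<in>UNIV. A $ k $ c *\<^sub>R real_basis_vec k)" for c
    using cart_complex_cart_map[of midpoint_param "axis c 1"] cart_complex_expand[of "cart_map midpoint_param (axis c 1)"]
    by (simp add: Z_def A_def matrix_def)
  have M1: "M $ Inl j $ c = midpoint_param (Z c) $ j" for j c
    unfolding expand M_def D_def by (simp add: matrix_matrix_mult_def scaleR_conv_of_real[where 'a=complex] mult.commute)
  have "G (midpoint_param (Z c)) = (\<Sum>k\<in>UNIV. A $ k $ c *\<^sub>R G (real_basis_vec k))" for c
    unfolding expand by (simp add: linear_sum[OF G] linear_cmul[OF G])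
  then have M2: "M $ Inr j $ c = G (midpoint_param (Z c)) $ j" for j c
    unfolding M_def D_def by (simp add: matrix_matrix_mult_def scaleR_conv_of_real[where 'a=complex] mult.commute)
  have "norm (det M) = 1"
  proof (rule norm_det_symplectic)
    fix c d
    let ?z = "\<lambda>c. ((1/2) *\<^sub>R fst (Z c), snd (Z c))"
    have "(\<Sum>j\<in>UNIV. M $ Inl j $ c * M $ Inr j $ d) - (\<Sum>j\<in>UNIV. M $ Inr j $ c * M $ Inl j $ d)
        = cdot (midpoint_param (Z c)) (G (midpoint_param (Z d))) - cdot (G (midpoint_param (Z c))) (midpoint_param (Z d))"
      by (simp add: M1 M2 cdot_def)
    also have "\<dots> = 2 * (cdot (base (?z c)) (fibre (?z d)) - cdot (fibre (?z c)) (base (?z d)))"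
      unfolding G_def base_inv_half_midpoint_param by (simp add: midpoint_param_def cdot_simps right_diff_distrib)
    also have "\<dots> = of_real (fst (Z c) \<bullet> snd (Z d) - snd (Z c) \<bullet> fst (Z d))"
      unfolding symplectic by simp
    also have "\<dots> = symplectic_matrix $ c $ d"
      unfolding Z_def symplectic_matrix_def
      by (cases c; cases d; simp add: cart_pair_axis inner_axis; simp add: axis_def)
    finally show "(\<Sum>j\<in>UNIV. M $ Inl j $ c * M $ Inr j $ d) - (\<Sum>j\<in>UNIV. M $ Inr j $ c * M $ Inl j $ d)
       = symplectic_matrix $ c $ d" .
  qed
  moreover have "det M = det D * of_real (det A)"
    unfolding M_def det_mul det_of_real ..
  moreover have "contour_density ?g y = norm (det D)"
    unfolding contour_density_def fd D_def ..
  ultimately show ?thesis by (simp add: A_def norm_mult)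
qed

lemma lborel_midpoint_param:
  "(lborel :: (complex^'n) measure)
    = density (distr lborel borel midpoint_param) (\<lambda>_. ennreal \<bar>det (matrix (cart_map midpoint_param))\<bar>)"
  using contour_density_det[of 0 0] by (intro lborel_change_of_variables linear_midpoint_param) auto

lemma contour_integral_eq:
  assumes k: "k \<in> borel_measurable borel"
  shows "(\<integral>y. k y * complex_of_real (contour_density (\<lambda>y. Lambda_fibre \<Phi> ((1/2) *\<^sub>R (x + y))) y) \<partial>lborel)
     = (\<integral>\<zeta>. k (midpoint_param \<zeta> - x) \<partial>lborel)"
proof -
  let ?d = "\<bar>det (matrix (cart_map midpoint_param))\<bar>"
  have d: "?d > 0" using contour_density_det[of 0 0] by (cases "?d = 0") auto
  note [measurable] = k borel_measurable_linear[OF linear_midpoint_param]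
  have cd: "contour_density (\<lambda>y. Lambda_fibre \<Phi> ((1/2) *\<^sub>R (x + y))) y = 1 / ?d" for y
    using contour_density_det[of x y] d by (simp add: field_simps)
  have "(\<integral>y. k y * complex_of_real (1 / ?d) \<partial>lborel) = (\<integral>y. k (y + (- x)) * complex_of_real (1 / ?d) \<partial>lborel)"
    by (rule integral_translation[symmetric]) measurable
  also have "\<dots> = (\<integral>y. k (y + (- x)) * complex_of_real (1 / ?d) \<partial>density (distr lborel borel midpoint_param) (\<lambda>_. ennreal ?d))"
    using lborel_midpoint_param by simp
  also have "\<dots> = (\<integral>y. ?d *\<^sub>R (k (y + (- x)) * complex_of_real (1 / ?d)) \<partial>distr lborel borel midpoint_param)"
    by (rule integral_density) auto
  also have "\<dots> = (\<integral>\<zeta>. ?d *\<^sub>R (k (midpoint_param \<zeta> + (- x)) * complex_of_real (1 / ?d)) \<partial>lborel)"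
    by (rule integral_distr) measurable
  also have "\<dots> = (\<integral>\<zeta>. k (midpoint_param \<zeta> - x) \<partial>lborel)"
    using d by (intro Bochner_Integration.integral_cong refl) (simp add: scaleR_conv_of_real)
  finally show ?thesis unfolding cd .
qed

end

section \<open>The Weyl oscillatory integral\<close>

lemma continuous_weyl_integrand:
  fixes b :: "(real^'n) \<times> (real^'n) \<Rightarrow> complex"
  assumes b: "continuous_on UNIV b" and v: "continuous_on UNIV v"
  shows "continuous_on UNIV (\<lambda>(x, z). weyl_integrand_Rn h b v x z)"
proof -
  have 1: "continuous_on UNIV (\<lambda>p::(real^'n) \<times> (real^'n) \<times> (real^'n). b ((1/2) *\<^sub>R (fst p + fst (snd p)), snd (snd p)))"
    by (rule continuous_on_compose2[OF b]) (auto intro!: continuous_intros)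
  have 2: "continuous_on UNIV (\<lambda>p::(real^'n) \<times> (real^'n) \<times> (real^'n). v (fst (snd p)))"
    by (rule continuous_on_compose2[OF v]) (auto intro!: continuous_intros)
  show ?thesis
    unfolding weyl_integrand_Rn_def case_prod_unfold
    by (intro continuous_on_mult 1 2 continuous_on_exp continuous_intros)
qed

lemma norm_exp_i_real: "norm (exp (\<i> / complex_of_real h * complex_of_real t)) = 1"
proof -
  have "\<i> / complex_of_real h * complex_of_real t = \<i> * of_real (t / h)" by simp
  then show ?thesis by (simp only: norm_exp_i_times)
qed

text \<open>Integration by parts in \<open>y\<close>. The bound is uniform in the cutoff parameter because a dilation by
  \<open>\<epsilon> \<le> 1\<close> does not increase derivatives.\<close>

lemma weyl_cutoff_integral_decay:
  fixes b :: "(real^'n) \<times> (real^'n) \<Rightarrow> complex"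
  assumes h: "h \<noteq> 0" and b: "symbol_class b" and v: "schwartz v" and \<psi>: "symbol_class \<psi>"
  shows "\<exists>K\<ge>0. \<forall>\<epsilon> x \<eta>. \<bar>\<epsilon>\<bar> \<le> 1 \<longrightarrow>
    norm (\<integral>y. \<psi> (\<epsilon> *\<^sub>R (y, \<eta>)) * weyl_integrand_Rn h b v x (y, \<eta>) \<partial>lborel) \<le> K * decay k \<eta>"
proof -
  define I where "I = {i :: real \<times> (real^'n) \<times> (real^'n). \<bar>fst i\<bar> \<le> 1}"
  define F where "F i y = \<psi> (fst i *\<^sub>R (y, snd (snd i))) * (b ((1/2) *\<^sub>R (fst (snd i) + y), snd (snd i)) * v y)"
    for i :: "real \<times> (real^'n) \<times> (real^'n)" and y
  have psi: "controlled n I (\<lambda>_ _. 1) (\<lambda>i y. \<psi> (fst i *\<^sub>R (y, snd (snd i))))" for n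
  proof -
    have "controlled n I (\<lambda>_ _. 1) (\<lambda>i y. \<psi> ((fst i *\<^sub>R y, 0) + (0, fst i *\<^sub>R snd (snd i))))"
    proof (rule controlled_affine[OF symbol_class_controlled[OF \<psi>], where K=1])
      show "linear (\<lambda>y. (fst i *\<^sub>R y, 0 :: real^'n))" for i :: "real \<times> (real^'n) \<times> (real^'n)"
        by (rule linearI) (simp_all add: scaleR_add_right)
      show "norm (fst i *\<^sub>R e, 0 :: real^'n) \<le> 1" if "i \<in> I" "e \<in> Basis" for i and e :: "real^'n"
        using that by (simp add: I_def norm_Pair)
    qed simp
    then show ?thesis by simp
  qed
  have b': "controlled n I (\<lambda>_ _. 1) (\<lambda>i y. b ((1/2) *\<^sub>R (fst (snd i) + y), snd (snd i)))" for n
  proof -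
    have "controlled n I (\<lambda>_ _. 1) (\<lambda>i y. b (((1/2) *\<^sub>R y, 0) + ((1/2) *\<^sub>R fst (snd i), snd (snd i))))"
    proof (rule controlled_affine[OF symbol_class_controlled[OF b], where K=1])
      show "linear (\<lambda>y. ((1/2) *\<^sub>R y, 0 :: real^'n))" by (rule linearI) (simp_all add: scaleR_add_right)
    qed (simp_all add: norm_Pair)
    then show ?thesis by (simp add: scaleR_add_right add.commute)
  qed
  let ?m = "\<lambda>y::real^'n. decay (2 * DIM(real^'n)) y"
  have F: "controlled n I (\<lambda>_ y. 1 * ?m y) F" for n
    using controlled_mult[OF psi controlled_mult[OF b' schwartz_controlled[OF v]], of n "2 * DIM(real^'n)"]
    by (simp add: F_def[abs_def])
  obtain K where K: "K \<ge> 0" "\<And>i \<eta>. i \<in> I \<Longrightarrow> norm (\<integral>y. osc h \<eta> y * F i y \<partial>lborel) \<le> K * 1 * decay k \<eta>"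
    using osc_integral_decay[OF F integrable_japanese[OF order_refl] h, of k] by auto
  have "norm (\<integral>y. \<psi> (\<epsilon> *\<^sub>R (y, \<eta>)) * weyl_integrand_Rn h b v x (y, \<eta>) \<partial>lborel) \<le> K * decay k \<eta>"
    if "\<bar>\<epsilon>\<bar> \<le> 1" for \<epsilon> x \<eta>
  proof -
    have "\<psi> (\<epsilon> *\<^sub>R (y, \<eta>)) * weyl_integrand_Rn h b v x (y, \<eta>)
        = exp (\<i> / of_real h * of_real (x \<bullet> \<eta>)) * (osc h \<eta> y * F (\<epsilon>, x, \<eta>) y)" for y
    proof -
      have "exp (\<i> / of_real h * of_real ((x - y) \<bullet> \<eta>)) = exp (\<i> / of_real h * of_real (x \<bullet> \<eta>)) * osc h \<eta> y"
        unfolding osc_def exp_add[symmetric] by (simp add: inner_diff_left right_diff_distrib)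
      then show ?thesis by (simp add: weyl_integrand_Rn_def F_def)
    qed
    then have "norm (\<integral>y. \<psi> (\<epsilon> *\<^sub>R (y, \<eta>)) * weyl_integrand_Rn h b v x (y, \<eta>) \<partial>lborel)
        = norm (\<integral>y. osc h \<eta> y * F (\<epsilon>, x, \<eta>) y \<partial>lborel)"
      by (simp add: norm_mult norm_exp_i_real del: times_divide_eq_left)
    also have "\<dots> \<le> K * decay k \<eta>"
      using K(2)[of "(\<epsilon>, x, \<eta>)" \<eta>] that by (simp add: I_def)
    finally show ?thesis .
  qed
  with K(1) show ?thesis by blast
qed

text \<open>The order of integration matters: the integral over \<open>y\<close> comes first and produces the decay in \<open>\<eta>\<close>.\<close>

definition weyl_value ::
  "real \<Rightarrow> ((real^'n) \<times> (real^'n) \<Rightarrow> complex) \<Rightarrow> (real^'n \<Rightarrow> complex) \<Rightarrow> real^'n \<Rightarrow> complex" where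
  "weyl_value h b v x = (\<integral>\<eta>. (\<integral>y. weyl_integrand_Rn h b v x (y, \<eta>) \<partial>lborel) \<partial>lborel)"

lemma norm_weyl_integrand: "norm (weyl_integrand_Rn h b v x (y, \<eta>)) = norm (b ((1/2) *\<^sub>R (x + y), \<eta>)) * norm (v y)"
  by (simp add: weyl_integrand_Rn_def norm_mult norm_exp_i_real del: times_divide_eq_left)

lemma borel_measurable_weyl_inner_integral:
  assumes b: "symbol_class b" and v: "schwartz v"
  shows "(\<lambda>(y, \<eta>). \<integral>y'. weyl_integrand_Rn h b v y (y', \<eta>) \<partial>lborel) \<in> borel_measurable borel"
proof -
  have "continuous_on UNIV (\<lambda>(p, y'). weyl_integrand_Rn h b v (fst p) (y', snd p))"
    using continuous_on_compose2[OF continuous_weyl_integrand[OF symbol_class_continuous[OF b] schwartz_continuous[OF v], of h],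
        of UNIV "\<lambda>q. (fst (fst q), (snd q, snd (fst q)))"]
    by (simp add: case_prod_unfold continuous_on_Pair continuous_on_fst continuous_on_snd continuous_on_id)
  then have "(\<lambda>(p, y'). weyl_integrand_Rn h b v (fst p) (y', snd p)) \<in> borel_measurable (borel \<Otimes>\<^sub>M lborel)"
    unfolding measurable_cong_sets[OF sets_borel_pair_lborel refl] by (rule borel_measurable_continuous_onI)
  then have "(\<lambda>p. \<integral>y'. weyl_integrand_Rn h b v (fst p) (y', snd p) \<partial>lborel) \<in> borel_measurable borel"
    by (rule lborel.borel_measurable_lebesgue_integral)
  then show ?thesis by (simp add: case_prod_unfold)
qed

lemma weyl_inner_integral_decay:
  assumes h: "h \<noteq> 0" and b: "symbol_class b" and v: "schwartz v"
  shows "\<exists>K\<ge>0. \<forall>x \<eta>. norm (\<integral>y. weyl_integrand_Rn h b v x (y, \<eta>) \<partial>lborel) \<le> K * decay k \<eta>"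
proof -
  obtain K where K: "K \<ge> 0" "\<And>(\<epsilon>::real) x \<eta>. \<bar>\<epsilon>\<bar> \<le> 1 \<Longrightarrow>
      norm (\<integral>y. 1 * weyl_integrand_Rn h b v x (y, \<eta>) \<partial>lborel) \<le> K * decay k \<eta>"
    using weyl_cutoff_integral_decay[OF h b v symbol_class_1, of k] by blast
  have "norm (\<integral>y. weyl_integrand_Rn h b v x (y, \<eta>) \<partial>lborel) \<le> K * decay k \<eta>" for x \<eta>
    using K(2)[of 0 x \<eta>] by simp
  with K(1) show ?thesis by blast
qed

lemma weyl_value_bounded:
  assumes h: "h \<noteq> 0" and b: "symbol_class b" and v: "schwartz (v :: real^'n \<Rightarrow> complex)"
  shows "weyl_value h b v \<in> borel_measurable borel" "\<exists>K. \<forall>y. norm (weyl_value h b v y) \<le> K"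
proof -
  let ?J = "\<lambda>y \<eta>. \<integral>y'. weyl_integrand_Rn h b v y (y', \<eta>) \<partial>lborel"
  have J: "(\<lambda>(y, \<eta>). ?J y \<eta>) \<in> borel_measurable borel"
    by (rule borel_measurable_weyl_inner_integral[OF b v])
  then have "(\<lambda>(y, \<eta>). ?J y \<eta>) \<in> borel_measurable (borel \<Otimes>\<^sub>M lborel)"
    unfolding measurable_cong_sets[OF sets_borel_pair_lborel refl] .
  then show "weyl_value h b v \<in> borel_measurable borel"
    unfolding weyl_value_def[abs_def] by (rule lborel.borel_measurable_lebesgue_integral)
  let ?N = "2 * DIM(real^'n)"
  obtain K where K: "K \<ge> 0" "\<And>y \<eta>. norm (?J y \<eta>) \<le> K * decay ?N \<eta>"
    using weyl_inner_integral_decay[OF h b v] by blast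
  have dom: "integrable lborel (\<lambda>\<eta>::real^'n. K * decay ?N \<eta>)"
    by (intro integrable_mult_right integrable_japanese) simp
  have "norm (weyl_value h b v y) \<le> (\<integral>(\<eta>::real^'n). K * decay ?N \<eta> \<partial>lborel)" for y
    unfolding weyl_value_def
  proof (rule Bochner_Integration.integral_norm_bound_integral[OF _ dom K(2)])
    have "(\<lambda>\<eta>. ?J y \<eta>) \<in> borel_measurable borel"
      using measurable_compose[OF _ J, of "\<lambda>\<eta>. (y, \<eta>)" borel] by simp
    then have "(\<lambda>\<eta>. ?J y \<eta>) \<in> borel_measurable lborel" by simp
    then show "integrable lborel (\<lambda>\<eta>. ?J y \<eta>)"
      by (rule Bochner_Integration.integrable_bound[OF dom]) (intro AE_I2 le_norm_real K)
  qed
  then show "\<exists>K. \<forall>y. norm (weyl_value h b v y) \<le> K" by blast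
qed

text \<open>With a cutoff the integral is absolutely convergent and may be taken over \<open>y\<close> first; the inner
  integrals converge as the cutoff is removed and are dominated uniformly in it.\<close>

lemma has_oscillatory_integral_weyl:
  fixes b :: "(real^'n) \<times> (real^'n) \<Rightarrow> complex"
  assumes h: "h \<noteq> 0" and b: "symbol_class b" and v: "schwartz v"
  shows "has_oscillatory_integral (weyl_integrand_Rn h b v x) (weyl_value h b v x)"
  unfolding has_oscillatory_integral_def
proof (intro allI impI conjI)
  let ?W = "weyl_integrand_Rn h b v x"
  obtain Kb where Kb: "Kb \<ge> 0" "\<And>z. norm (b z) \<le> Kb" using symbol_class_bounded[OF b] by blast
  obtain Kv where Kv: "Kv \<ge> 0" "\<And>y. norm (v y) \<le> Kv" using symbol_class_bounded[OF schwartz_imp_symbol_class[OF v]] by blast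
  fix \<psi> :: "(real^'n) \<times> (real^'n) \<Rightarrow> complex" assume "schwartz \<psi> \<and> \<psi> 0 = 1"
  then have \<psi>: "schwartz \<psi>" "\<psi> 0 = 1" by auto
  obtain Kp where Kp: "Kp \<ge> 0" "\<And>z. norm (\<psi> z) \<le> Kp" using symbol_class_bounded[OF schwartz_imp_symbol_class[OF \<psi>(1)]] by blast
  have cW: "continuous_on UNIV ?W"
    using continuous_on_compose2[OF continuous_weyl_integrand[OF symbol_class_continuous[OF b] schwartz_continuous[OF v], of h]
        continuous_on_Pair[OF continuous_on_const[of UNIV x] continuous_on_id]]
    by simp
  have c\<psi>: "continuous_on UNIV (\<lambda>z. \<psi> (\<epsilon> *\<^sub>R z))" for \<epsilon>
    by (rule continuous_on_compose2[OF schwartz_continuous[OF \<psi>(1)]]) (auto intro!: continuous_intros)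
  have [measurable]: "?W \<in> borel_measurable borel" "(\<lambda>z. \<psi> (\<epsilon> *\<^sub>R z)) \<in> borel_measurable borel" for \<epsilon>
    using cW c\<psi> by (auto intro: borel_measurable_continuous_onI)
  have slice: "continuous_on UNIV (\<lambda>y::real^'n. (y, \<eta>::real^'n))" for \<eta> by (intro continuous_intros)
  have [measurable]: "(\<lambda>y. ?W (y, \<eta>)) \<in> borel_measurable borel" for \<eta>
    by (rule borel_measurable_continuous_onI, rule continuous_on_compose2[OF cW slice]) simp
  have [measurable]: "(\<lambda>y. \<psi> (\<epsilon> *\<^sub>R (y, \<eta>))) \<in> borel_measurable borel" for \<epsilon> \<eta>
    by (rule borel_measurable_continuous_onI, rule continuous_on_compose2[OF c\<psi> slice]) simp
  show int: "integrable lborel (\<lambda>z. \<psi> (\<epsilon> *\<^sub>R z) * ?W z)" if \<epsilon>: "\<epsilon> > 0" for \<epsilon>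
  proof -
    let ?N = "2 * DIM((real^'n) \<times> (real^'n))"
    obtain K where K: "K \<ge> 0" "\<And>z. norm (\<psi> z) \<le> K * decay ?N z" using schwartz_bound[OF \<psi>(1)] by blast
    obtain L where L: "L > 0" "\<And>z::(real^'n) \<times> (real^'n). japanese (inverse \<epsilon> *\<^sub>R z) \<le> L * japanese z"
      using japanese_linear_le[of "\<lambda>z. inverse \<epsilon> *\<^sub>R z"] by (auto intro!: linearI simp: scaleR_add_right)
    show ?thesis
    proof (rule Bochner_Integration.integrable_bound)
      show "integrable lborel (\<lambda>z::(real^'n) \<times> (real^'n). (K * L ^ ?N * (Kb * Kv)) * decay ?N z)"
        by (intro integrable_mult_right integrable_japanese) simp
      have "norm (\<psi> (\<epsilon> *\<^sub>R z) * ?W z) \<le> (K * L ^ ?N * (Kb * Kv)) * decay ?N z" for z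
      proof -
        obtain y \<eta> where z: "z = (y, \<eta>)" by (cases z)
        have "japanese z ^ ?N \<le> (L * japanese (\<epsilon> *\<^sub>R z)) ^ ?N"
          using L(2)[of "\<epsilon> *\<^sub>R z"] \<epsilon> by (intro power_mono) (auto simp: less_imp_le)
        then have "decay ?N (\<epsilon> *\<^sub>R z) \<le> L ^ ?N * decay ?N z"
          using L(1) by (simp add: field_simps power_mult_distrib)
        then have "norm (\<psi> (\<epsilon> *\<^sub>R z)) \<le> K * (L ^ ?N * decay ?N z)"
          using K(2)[of "\<epsilon> *\<^sub>R z"] mult_left_mono[OF _ K(1)] by (meson order_trans)
        moreover have "norm (?W z) \<le> Kb * Kv"
          unfolding z norm_weyl_integrand using Kb Kv by (intro mult_mono) auto
        ultimately have "norm (\<psi> (\<epsilon> *\<^sub>R z)) * norm (?W z) \<le> (K * (L ^ ?N * decay ?N z)) * (Kb * Kv)"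
          using K(1) L(1) by (intro mult_mono) (auto simp: less_imp_le)
        then show ?thesis by (simp add: norm_mult mult_ac)
      qed
      then show "AE z in lborel. norm (\<psi> (\<epsilon> *\<^sub>R z) * ?W z) \<le> norm ((K * L ^ ?N * (Kb * Kv)) * decay ?N z)"
        by (intro AE_I2 le_norm_real)
    qed measurable
  qed
  define J where "J \<epsilon> \<eta> = (\<integral>y. \<psi> (\<epsilon> *\<^sub>R (y, \<eta>)) * ?W (y, \<eta>) \<partial>lborel)" for \<epsilon> \<eta>
  have fub: "(\<integral>z. \<psi> (\<epsilon> *\<^sub>R z) * ?W z \<partial>lborel) = (\<integral>\<eta>. J \<epsilon> \<eta> \<partial>lborel)" if "\<epsilon> > 0" for \<epsilon>
    unfolding J_def by (rule lborel_integral_pair(1)[OF int[OF that]])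
  have J_meas [measurable]: "J \<epsilon> \<in> borel_measurable borel" for \<epsilon>
  proof -
    have "(\<lambda>(\<eta>, y). \<psi> (\<epsilon> *\<^sub>R (y, \<eta>)) * ?W (y, \<eta>)) \<in> borel_measurable (borel \<Otimes>\<^sub>M lborel)"
    proof -
      have "continuous_on UNIV (\<lambda>(\<eta>, y). \<psi> (\<epsilon> *\<^sub>R (y, \<eta>)) * ?W (y, \<eta>))"
        unfolding case_prod_unfold
        by (intro continuous_on_mult continuous_on_compose2[OF cW] continuous_on_compose2[OF c\<psi>] continuous_intros) auto
      then have "(\<lambda>(\<eta>, y). \<psi> (\<epsilon> *\<^sub>R (y, \<eta>)) * ?W (y, \<eta>)) \<in> borel_measurable borel"
        by (rule borel_measurable_continuous_onI)
      then show ?thesis unfolding borel_prod[symmetric] by (simp cong: measurable_cong_sets)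
    qed
    then show ?thesis unfolding J_def by (rule lborel.borel_measurable_lebesgue_integral)
  qed
  obtain K where K: "K \<ge> 0" "\<And>\<epsilon> \<eta>. \<bar>\<epsilon>\<bar> \<le> 1 \<Longrightarrow> norm (J \<epsilon> \<eta>) \<le> K * decay (2 * DIM(real^'n)) \<eta>"
    using weyl_cutoff_integral_decay[OF h b v schwartz_imp_symbol_class[OF \<psi>(1)], of "2 * DIM(real^'n)"] unfolding J_def by blast
  have seq: "(\<lambda>i. \<integral>\<eta>. J (X i) \<eta> \<partial>lborel) \<longlonglongrightarrow> weyl_value h b v x"
    if X: "\<And>i. 0 < X i" "\<And>i. X i \<le> 1" "X \<longlonglongrightarrow> 0" for X :: "nat \<Rightarrow> real"
    unfolding weyl_value_def
  proof (rule integral_dominated_convergence)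
    show "integrable lborel (\<lambda>\<eta>::real^'n. K * decay (2 * DIM(real^'n)) \<eta>)"
      by (intro integrable_mult_right integrable_japanese) simp
    show "AE \<eta> in lborel. norm (J (X i) \<eta>) \<le> K * decay (2 * DIM(real^'n)) \<eta>" for i
      using K(2)[of "X i"] X(1)[of i] X(2)[of i] by (intro AE_I2) simp
    show "AE \<eta> in lborel. (\<lambda>i. J (X i) \<eta>) \<longlonglongrightarrow> (\<integral>y. ?W (y, \<eta>) \<partial>lborel)"
    proof (intro AE_I2)
      fix \<eta> :: "real^'n"
      show "(\<lambda>i. J (X i) \<eta>) \<longlonglongrightarrow> (\<integral>y. ?W (y, \<eta>) \<partial>lborel)"
        unfolding J_def
      proof (rule integral_dominated_convergence)
        show "integrable lborel (\<lambda>y. (Kp * Kb) * norm (v y))"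
          using schwartz_integrable[OF v] by (intro integrable_mult_right integrable_norm)
        show "AE y in lborel. norm (\<psi> (X i *\<^sub>R (y, \<eta>)) * ?W (y, \<eta>)) \<le> (Kp * Kb) * norm (v y)" for i
        proof (intro AE_I2)
          fix y :: "real^'n"
          have "norm (\<psi> (X i *\<^sub>R (y, \<eta>))) * (norm (b ((1/2) *\<^sub>R (x + y), \<eta>)) * norm (v y)) \<le> Kp * (Kb * norm (v y))"
            using Kp Kb by (intro mult_mono) auto
          then show "norm (\<psi> (X i *\<^sub>R (y, \<eta>)) * ?W (y, \<eta>)) \<le> (Kp * Kb) * norm (v y)"
            unfolding norm_mult norm_weyl_integrand by (simp add: mult_ac)
        qed
        show "AE y in lborel. (\<lambda>i. \<psi> (X i *\<^sub>R (y, \<eta>)) * ?W (y, \<eta>)) \<longlonglongrightarrow> ?W (y, \<eta>)"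
        proof (intro AE_I2)
          fix y :: "real^'n"
          have "isCont \<psi> 0" using schwartz_continuous[OF \<psi>(1)]
            unfolding continuous_on_eq_continuous_at[OF open_UNIV] by blast
          moreover have "(\<lambda>i. X i *\<^sub>R (y, \<eta>)) \<longlonglongrightarrow> 0 *\<^sub>R (y, \<eta>)"
            by (rule tendsto_scaleR[OF X(3) tendsto_const])
          ultimately have "(\<lambda>i. \<psi> (X i *\<^sub>R (y, \<eta>))) \<longlonglongrightarrow> \<psi> 0"
            by (intro isCont_tendsto_compose[of 0 \<psi>]) (simp_all add: zero_prod_def)
          from tendsto_mult[OF this tendsto_const[of "?W (y, \<eta>)"]]
          show "(\<lambda>i. \<psi> (X i *\<^sub>R (y, \<eta>)) * ?W (y, \<eta>)) \<longlonglongrightarrow> ?W (y, \<eta>)" using \<psi>(2) by simp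
        qed
      qed measurable
    qed
    have "continuous_on UNIV (\<lambda>(\<eta>, y). ?W (y, \<eta>))"
      unfolding case_prod_unfold by (intro continuous_on_compose2[OF cW] continuous_intros) auto
    then have "(\<lambda>(\<eta>, y). ?W (y, \<eta>)) \<in> borel_measurable (borel \<Otimes>\<^sub>M lborel)"
      using borel_measurable_continuous_onI[of "\<lambda>(\<eta>, y). ?W (y, \<eta>)"]
      unfolding borel_prod[symmetric] by (simp cong: measurable_cong_sets)
    then show "(\<lambda>\<eta>. \<integral>y. ?W (y, \<eta>) \<partial>lborel) \<in> borel_measurable lborel"
      using lborel.borel_measurable_lebesgue_integral[of "\<lambda>\<eta> y. ?W (y, \<eta>)" borel] by simp
  qed simp
  show "((\<lambda>\<epsilon>. \<integral>z. \<psi> (\<epsilon> *\<^sub>R z) * ?W z \<partial>lborel) \<longlongrightarrow> weyl_value h b v x) (at_right 0)"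
    unfolding tendsto_at_iff_sequentially
  proof (intro allI impI)
    fix X :: "nat \<Rightarrow> real" assume X: "\<forall>i. X i \<in> {0<..} - {0}" "X \<longlonglongrightarrow> 0"
    have "\<forall>\<^sub>F i in sequentially. X i < 1" using X(2) by (rule order_tendstoD) simp
    then obtain N where N: "\<And>i. i \<ge> N \<Longrightarrow> X i < 1" by (auto simp: eventually_sequentially)
    have "(\<lambda>i. \<integral>\<eta>. J (X (i + N)) \<eta> \<partial>lborel) \<longlonglongrightarrow> weyl_value h b v x"
    proof (rule seq)
      show "0 < X (i + N)" for i using X(1) by simp
      show "X (i + N) \<le> 1" for i using N[of "i + N"] by simp
      show "(\<lambda>i. X (i + N)) \<longlonglongrightarrow> 0" using X(2) by (rule LIMSEQ_ignore_initial_segment)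
    qed
    moreover have "((\<lambda>\<epsilon>. \<integral>z. \<psi> (\<epsilon> *\<^sub>R z) * ?W z \<partial>lborel) \<circ> X) i = (\<integral>\<eta>. J (X i) \<eta> \<partial>lborel)" for i
      using X(1) fub[of "X i"] by simp
    ultimately have "(\<lambda>i. ((\<lambda>\<epsilon>. \<integral>z. \<psi> (\<epsilon> *\<^sub>R z) * ?W z \<partial>lborel) \<circ> X) (i + N)) \<longlonglongrightarrow> weyl_value h b v x" by simp
    then show "((\<lambda>\<epsilon>. \<integral>z. \<psi> (\<epsilon> *\<^sub>R z) * ?W z \<partial>lborel) \<circ> X) \<longlonglongrightarrow> weyl_value h b v x" by (rule LIMSEQ_offset)
  qed
qed

text \<open>A limit for one cutoff determines the value, and the Gaussian is a cutoff.\<close>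

lemma oscillatory_integral_unique:
  assumes "has_oscillatory_integral F I" "has_oscillatory_integral F J"
  shows "I = J"
proof -
  let ?\<psi> = "\<lambda>y::'a. exp (- complex_of_real (y \<bullet> y))"
  have "schwartz ?\<psi> \<and> ?\<psi> 0 = 1" using schwartz_standard_gaussian by auto
  then show ?thesis
    using assms tendsto_unique[OF trivial_limit_at_right_real] unfolding has_oscillatory_integral_def by blast
qed

section \<open>Reflections and the transform of a Schwartz function\<close>

context fbi_quadratic
begin

lemma continuous_on_phase [continuous_intros]:
  "continuous_on A f \<Longrightarrow> continuous_on A g \<Longrightarrow> continuous_on A (\<lambda>x. \<phi> (f x) (g x))"
  unfolding phase by (intro continuous_intros)

text \<open>This is the reason for the theorem: \<open>T\<close> carries the reflection of phase space in \<open>(w / 2, \<eta>)\<close> to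
  the reflection in \<open>\<kappa>\<^sub>T (w / 2, \<eta>)\<close>. The points \<open>(x, y)\<close> and \<open>(2 z - x, w - y)\<close> are symmetric about
  \<open>(z, w / 2)\<close>, so the values of the quadratic form \<open>\<phi>\<close> there differ by twice its linear part at the
  centre, whose coefficients are \<open>\<theta>\<close> and \<open>- \<eta>\<close>.\<close>

lemma reflection_identity:
  fixes x :: "complex^'n" and y w \<eta> :: "real^'n"
  defines "z \<equiv> base ((1/2) *\<^sub>R w, \<eta>)" and "\<theta> \<equiv> fibre ((1/2) *\<^sub>R w, \<eta>)"
  shows "\<phi> (2 *\<^sub>R z - x) (cvec (w - y)) + 2 * cdot (x - z) \<theta> = \<phi> x (cvec y) + of_real ((2 *\<^sub>R y - w) \<bullet> \<eta>)"
proof -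
  define t s c where "t = x - z" and "s = y - (1/2) *\<^sub>R w" and "c = cvec ((1/2) *\<^sub>R w)"
  have grad: "P *v z + Q *v c = \<theta>" "transpose Q *v z + R *v c = - cvec \<eta>"
    using base_eq[of "((1/2) *\<^sub>R w, \<eta>)"] by (simp_all add: z_def \<theta>_def c_def fibre_def)
  have "z + t = x" "z + - t = 2 *\<^sub>R z - x" by (simp_all add: t_def scaleR_2)
  moreover have "c + cvec s = cvec y" "c + - cvec s = cvec (w - y)"
  proof -
    have "w - y = (1/2) *\<^sub>R w - s" by (simp add: s_def vec_eq_iff)
    then show "c + - cvec s = cvec (w - y)" by (simp add: c_def cvec_diff)
  qed (simp add: c_def s_def cvec_diff)
  ultimately have "\<phi> x (cvec y) = \<phi> z c + \<phi> t (cvec s) + cdot t \<theta> - of_real (s \<bullet> \<eta>)"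
    "\<phi> (2 *\<^sub>R z - x) (cvec (w - y)) = \<phi> z c + \<phi> (- t) (- cvec s) - cdot t \<theta> + of_real (s \<bullet> \<eta>)"
    using phase_add[of z t c "cvec s"] phase_add[of z "- t" c "- cvec s"] unfolding grad
    by (simp_all add: cdot_minus_left cdot_minus_right cdot_cvec)
  moreover have "\<phi> (- t) (- cvec s) = \<phi> t (cvec s)"
    using phase_scale[of "-1" t "cvec s"] by (simp add: vector_sneg_minus1[symmetric])
  moreover have "(2 *\<^sub>R y - w) \<bullet> \<eta> = 2 * (s \<bullet> \<eta>)"
    by (simp add: s_def inner_diff_left)
  ultimately show ?thesis by (simp add: t_def)
qed

abbreviation fbi_kernel :: "real \<Rightarrow> complex^'n \<Rightarrow> real^'n \<Rightarrow> complex" where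
  "fbi_kernel h x y \<equiv> exp (\<i> * \<phi> x (cvec y) / complex_of_real h)"

text \<open>The kernel of \<open>T\<close> relative to its value at the critical point \<open>y\<close> over which \<open>x\<close> lies, with the
  real frequency there removed.\<close>

definition gaussian_factor :: "real \<Rightarrow> real^'n \<Rightarrow> complex" where
  "gaussian_factor h s = exp (\<i> / (2 * of_real h) * cdot (cvec s) (R *v cvec s))"

lemma schwartz_gaussian_factor:
  assumes h: "h > 0"
  shows "schwartz (gaussian_factor h)"
proof -
  obtain c where c: "c > 0" "\<And>v. c * (norm v)\<^sup>2 \<le> Im (cdot (cvec v) (R *v cvec v))" using Im_R_coercive by blast
  let ?B = "\<lambda>s t. cdot (cvec s) ((\<i> / (2 * of_real h)) *s (R *v cvec t))"
  have "linear (\<lambda>t. (\<i> / (2 * of_real h)) *s (R *v cvec t))"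
    by (rule linearI) (simp_all add: cvec_add cvec_scaleR matrix_vector_simps vector_add_ldistrib,
        simp add: vec_eq_iff)
  then have "bounded_bilinear ?B"
    using bounded_bilinear.comp[OF bounded_bilinear_cdot linear_conv_bounded_linear[THEN iffD1, OF linear_cvec]
        linear_conv_bounded_linear[THEN iffD1]] by blast
  moreover have "?B s t = ?B t s" for s t
    using R_sym[of "cvec s" "cvec t"] by (simp add: cdot_scale_right)
  moreover have "Re (?B s s) \<le> - (c / (2 * h)) * (norm s)\<^sup>2" for s
  proof -
    have "Re (?B s s) = - (1 / (2 * h)) * Im (cdot (cvec s) (R *v cvec s))"
      using h by (simp add: cdot_scale_right Re_divide_of_real[of _ "2 * h", simplified] field_simps)
    also have "\<dots> \<le> - (1 / (2 * h)) * (c * (norm s)\<^sup>2)"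
      using h c(2)[of s] by (intro mult_left_mono_neg) auto
    finally show ?thesis by simp
  qed
  moreover have "c / (2 * h) > 0" using c(1) h by simp
  ultimately have "schwartz (\<lambda>s. exp (?B s s))" by (intro schwartz_gaussian) auto
  then show ?thesis by (simp add: gaussian_factor_def[abs_def] cdot_scale_right)
qed

lemma fbi_kernel_centered:
  assumes "h \<noteq> 0"
  shows "fbi_kernel h x (fst (base_inv x) + s)
   = fbi_kernel h x (fst (base_inv x)) * (osc h (snd (base_inv x)) s * gaussian_factor h s)"
proof -
  have expansion: "\<phi> x (cvec (fst (base_inv x) + s)) = \<phi> x (cvec (fst (base_inv x))) - of_real (s \<bullet> snd (base_inv x))
     + (1/2) * cdot (cvec s) (R *v cvec s)"
    using phase_expansion[of "base_inv x" s] by simp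
  show ?thesis
    unfolding expansion osc_def gaussian_factor_def exp_add[symmetric]
    by (simp add: algebra_simps add_divide_distrib diff_divide_distrib)
qed

lemma norm_fbi_kernel_critical:
  "norm (fbi_kernel h x (fst (base_inv x))) = exp (\<Phi> x / h)"
  using weight_base[of "base_inv x"] by (simp add: Re_divide_of_real)

lemma fbi_kernel_decay:
  assumes h: "h > 0"
  shows "\<exists>K\<ge>0. \<forall>y. norm (fbi_kernel h x y) \<le> K * decay N y"
proof -
  let ?w = "fst (base_inv x)"
  obtain K where K: "K \<ge> 0" "\<And>s. norm (gaussian_factor h s) \<le> K * decay N s"
    using schwartz_bound[OF schwartz_gaussian_factor[OF h]] by blast
  have "norm (fbi_kernel h x y)
      \<le> (exp (\<Phi> x / h) * K * 2 ^ N * japanese ?w ^ N) * decay N y" for y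
  proof -
    have "norm (fbi_kernel h x (?w + (y - ?w))) = exp (\<Phi> x / h) * norm (gaussian_factor h (y - ?w))"
      unfolding fbi_kernel_centered[OF less_imp_neq[OF h, symmetric]] norm_mult norm_fbi_kernel_critical norm_osc by simp
    also have "\<dots> \<le> exp (\<Phi> x / h) * (K * decay N (y - ?w))"
      by (intro mult_left_mono K) simp
    also have "\<dots> \<le> exp (\<Phi> x / h) * (K * (2 ^ N * japanese ?w ^ N * decay N y))"
      using japanese_power_triangle[of y "- ?w" N] K(1)
      by (intro mult_left_mono) (auto simp: field_simps)
    finally show ?thesis by (simp add: mult_ac)
  qed
  with K(1) show ?thesis
    by (intro exI[of _ "exp (\<Phi> x / h) * K * 2 ^ N * japanese ?w ^ N"]) (auto simp: less_imp_le)
qed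

lemma continuous_fbi_kernel: "continuous_on UNIV (\<lambda>y. fbi_kernel h x y)"
  by (cases "h = 0") (auto intro!: continuous_intros)

text \<open>Centering the integral at the critical point leaves an oscillating integral whose frequency is
  the dual coordinate of \<open>x\<close>; decay in that coordinate comes from the smoothness of \<open>v\<close>, decay in the
  other from the decay of \<open>v\<close>.\<close>

lemma fbi_rapidly_decaying:
  assumes h: "h > 0" and v: "schwartz v"
  shows "rapidly_decaying \<Phi> h (fbi \<phi> C h v)"
  unfolding rapidly_decaying_def
proof
  fix N
  let ?d = "2 * DIM(real^'n)"
  let ?m = "\<lambda>y::real^'n. decay ?d y"
  let ?F = "\<lambda>w s. gaussian_factor h s * v (s + w)"
  have F: "controlled k UNIV (\<lambda>w s. decay N w * ?m s) ?F" for k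
  proof (rule controlled_weaken)
    show "controlled k UNIV (\<lambda>w s. decay (?d + N) s * decay N (s + w)) ?F"
    proof (rule controlled_mult[OF schwartz_controlled[OF schwartz_gaussian_factor[OF h]]])
      show "controlled k UNIV (\<lambda>w s. decay N (s + w)) (\<lambda>w s. v (s + w))"
        by (rule controlled_affine[OF schwartz_controlled[OF v], where K=1 and A="\<lambda>_ x. x"])
           (auto simp: linear_ident less_imp_le)
    qed
    show "decay (?d + N) s * decay N (s + w) \<le> 2 ^ N * (decay N w * ?m s)" for w s :: "real^'n"
    proof -
      have "decay N (s + w) * decay N s \<le> 2 ^ N * decay N w"
        using japanese_power_triangle[of w s N] by (simp add: add.commute)
      from mult_left_mono[OF this, of "?m s"] show ?thesis by (simp add: power_add mult_ac less_imp_le)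
    qed
  qed simp
  obtain K where K: "K \<ge> 0" "\<And>w \<eta>. norm (\<integral>s. osc h \<eta> s * ?F w s \<partial>lborel) \<le> K * decay N w * decay N \<eta>"
    using osc_integral_decay[OF F integrable_japanese[OF order_refl], of h N] h by (auto simp: less_imp_le)
  obtain L where L: "L > 0" "\<And>\<zeta>. japanese (base \<zeta>) \<le> L * japanese \<zeta>" using japanese_linear_le[OF linear_base] by blast
  let ?c = "norm (complex_of_real (C * h powr (- 3 * real CARD('n) / 4)))"
  have "norm (fbi \<phi> C h v x) \<le> (?c * (K * L ^ N)) * exp (\<Phi> x / h) / japanese x ^ N" for x
  proof -
    let ?w = "fst (base_inv x)" and ?\<eta> = "snd (base_inv x)"
    let ?E = "\<lambda>y. fbi_kernel h x y"
    have "(\<lambda>y. ?E y * v y) \<in> borel_measurable borel"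
      by (intro borel_measurable_continuous_onI continuous_on_mult continuous_fbi_kernel schwartz_continuous v)
    then have "(\<integral>y. ?E y * v y \<partial>lborel) = (\<integral>s. ?E (s + ?w) * v (s + ?w) \<partial>lborel)"
      by (rule integral_translation[symmetric])
    also have "\<dots> = (\<integral>s. ?E ?w * (osc h ?\<eta> s * ?F ?w s) \<partial>lborel)"
      using fbi_kernel_centered[of h x] h by (intro Bochner_Integration.integral_cong) (simp_all add: add.commute)
    also have "\<dots> = ?E ?w * (\<integral>s. osc h ?\<eta> s * ?F ?w s \<partial>lborel)" by simp
    finally have "norm (fbi \<phi> C h v x) = ?c * (exp (\<Phi> x / h) * norm (\<integral>s. osc h ?\<eta> s * ?F ?w s \<partial>lborel))"
      unfolding fbi_def norm_mult by (simp only: norm_mult norm_fbi_kernel_critical)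
    also have "\<dots> \<le> ?c * (exp (\<Phi> x / h) * (K * (decay N ?w * decay N ?\<eta>)))"
      using K(2)[of ?\<eta> ?w] by (intro mult_left_mono) (auto simp: mult.assoc)
    also have "\<dots> \<le> ?c * (exp (\<Phi> x / h) * (K * (L ^ N * decay N x)))"
    proof -
      have "japanese x \<le> L * japanese (?w, ?\<eta>)" using L(2)[of "base_inv x"] by simp
      also have "\<dots> \<le> L * (japanese ?w * japanese ?\<eta>)" using L(1) by (intro mult_left_mono japanese_Pair_le) simp
      finally have "japanese x ^ N \<le> (L * (japanese ?w * japanese ?\<eta>)) ^ N" by (intro power_mono) (auto simp: less_imp_le)
      then have "decay N ?w * decay N ?\<eta> \<le> L ^ N * decay N x"
        by (simp add: power_mult_distrib field_simps)
      then show ?thesis using K(1) by (intro mult_left_mono) auto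
    qed
    also have "\<dots> = (?c * (K * L ^ N)) * exp (\<Phi> x / h) / japanese x ^ N"
      by (simp only: divide_inverse mult_ac)
    finally show ?thesis .
  qed
  then show "\<exists>K. \<forall>x. norm (fbi \<phi> C h v x) \<le> K * exp (\<Phi> x / h) / japanese x ^ N" by blast
qed

end

section \<open>Weyl quantization and the transform\<close>

context fbi_quadratic
begin

lemma symbol_class_canonical:
  assumes "symbol_Lambda \<Phi> a"
  shows "symbol_class (a \<circ> canonical_trafo \<phi>)"
proof -
  let ?a = "\<lambda>x. a (x, Lambda_fibre \<Phi> x)"
  obtain K where K: "K > 0" "\<And>\<zeta>. norm (base \<zeta>) \<le> norm \<zeta> * K"
    using bounded_linear.pos_bounded[OF linear_conv_bounded_linear[THEN iffD1, OF linear_base]] by blast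
  have "controlled n (UNIV::unit set) (\<lambda>_ _. 1) (\<lambda>_ \<zeta>. ?a (base \<zeta> + 0))" for n
  proof (rule controlled_affine[OF symbol_class_controlled, where K=K])
    show "symbol_class ?a" using assms by (simp add: symbol_Lambda_def)
    show "norm (base b) \<le> K" if "b \<in> Basis" for b using K(2)[of b] that by simp
  qed (simp_all add: linear_base)
  moreover have "(a \<circ> canonical_trafo \<phi>) \<zeta> = ?a (base \<zeta> + 0)" for \<zeta>
    by (simp add: canonical_trafo_eq Lambda_fibre_base)
  then have "a \<circ> canonical_trafo \<phi> = (\<lambda>\<zeta>. ?a (base \<zeta> + 0))" by blast
  ultimately show ?thesis by (simp add: symbol_class_iff)
qed

lemma linear_Lambda_fibre: "linear (Lambda_fibre \<Phi>)"
  unfolding Lambda_fibre_eq[abs_def]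
  using linear_compose[OF linear_base_inv linear_fibre] by (simp add: o_def)

text \<open>Across a reflection the oscillating factor compensates exactly the change of the weight.\<close>

lemma norm_reflection_factor:
  fixes h :: real
  shows "norm (exp (\<i> / complex_of_real h * (2 * cdot (x - base \<zeta>) (fibre \<zeta>))))
    = exp ((\<Phi> x - \<Phi> (2 *\<^sub>R base \<zeta> - x)) / h)"
proof -
  define t where "t = x - base \<zeta>"
  have "base \<zeta> + t = x" "base \<zeta> + - t = 2 *\<^sub>R base \<zeta> - x" by (simp_all add: t_def scaleR_2)
  then have "\<Phi> x - \<Phi> (2 *\<^sub>R base \<zeta> - x) = - 2 * Im (cdot t (fibre \<zeta>))"
    using weight_add[of "base \<zeta>" t] weight_add[of "base \<zeta>" "- t"]
    by (simp add: weight_minus cdot_minus_right cdot_commute[of _ t])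
  moreover have "Re (\<i> / complex_of_real h * (2 * z)) = - 2 * Im z / h" for z
    by (simp add: Re_divide_of_real)
  ultimately show ?thesis unfolding t_def norm_exp_eq_Re by (simp only:)
qed

text \<open>The growth \<open>exp (\<Phi> / h)\<close> of \<open>u\<close> at the reflected point is turned into the constant
  \<open>exp (\<Phi> x / h)\<close>, which leaves the rapid decay of \<open>u\<close> in the reflected point, an invertible affine
  function of \<open>(w, \<eta>)\<close>.\<close>

lemma integrable_reflections:
  fixes x :: "complex^'n" and u :: "complex^'n \<Rightarrow> complex" and b :: "(real^'n) \<times> (real^'n) \<Rightarrow> complex"
  assumes u: "rapidly_decaying \<Phi> h u" and G: "G \<in> borel_measurable borel"
    and b: "\<And>\<zeta>. norm (b \<zeta>) \<le> Kb"
    and G_eq: "\<And>w \<eta>. G (w, \<eta>) = exp (\<i> / complex_of_real h * (2 * cdot (x - base ((1/2) *\<^sub>R w, \<eta>)) (fibre ((1/2) *\<^sub>R w, \<eta>))))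
       * b ((1/2) *\<^sub>R w, \<eta>) * u (2 *\<^sub>R base ((1/2) *\<^sub>R w, \<eta>) - x)"
  shows "integrable lborel G"
proof -
  let ?N = "2 * DIM((real^'n) \<times> (real^'n))"
  obtain K where K: "\<And>x. norm (u x) \<le> K * exp (\<Phi> x / h) / japanese x ^ ?N"
    using u unfolding rapidly_decaying_def by blast
  have K0: "K \<ge> 0"
    using order_trans[OF norm_ge_zero K[of 0]] by (simp add: zero_le_mult_iff japanese_def)
  define inverse_param where "inverse_param y = (2 *\<^sub>R fst (base_inv ((1/2) *\<^sub>R y)), snd (base_inv ((1/2) *\<^sub>R y)))" for y
  have "linear inverse_param"
    by (rule linearI) (simp_all add: inverse_param_def scaleR_add_right linear_add[OF linear_base_inv] linear_cmul[OF linear_base_inv])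
  then obtain L where L: "L > 0" "\<And>y. japanese (inverse_param y) \<le> L * japanese y"
    using japanese_linear_le by blast
  have Kb: "Kb \<ge> 0" using b[of 0] norm_ge_zero order_trans by blast
  let ?M = "Kb * exp (\<Phi> x / h) * K * (L * (2 * japanese x)) ^ ?N"
  show ?thesis
  proof (rule Bochner_Integration.integrable_bound)
    show "integrable lborel (\<lambda>\<zeta>::(real^'n) \<times> (real^'n). ?M * decay ?N \<zeta>)"
      by (intro integrable_mult_right integrable_japanese) simp
    have "norm (G \<zeta>) \<le> ?M * decay ?N \<zeta>" for \<zeta>
    proof -
      obtain w \<eta> where \<zeta>: "\<zeta> = (w, \<eta>)" by (cases \<zeta>)
      define z where "z = base ((1/2) *\<^sub>R w, \<eta>)"
      have inv: "inverse_param (2 *\<^sub>R z) = \<zeta>" by (simp add: inverse_param_def z_def \<zeta>)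
      have "norm (G \<zeta>) = exp ((\<Phi> x - \<Phi> (2 *\<^sub>R z - x)) / h) * norm (b ((1/2) *\<^sub>R w, \<eta>)) * norm (u (2 *\<^sub>R z - x))"
        unfolding \<zeta> G_eq norm_mult norm_reflection_factor z_def ..
      also have "\<dots> \<le> exp ((\<Phi> x - \<Phi> (2 *\<^sub>R z - x)) / h) * Kb * (K * exp (\<Phi> (2 *\<^sub>R z - x) / h) / japanese (2 *\<^sub>R z - x) ^ ?N)"
        using b Kb by (intro mult_mono K) auto
      also have "\<dots> = Kb * exp (\<Phi> x / h) * K * decay ?N (2 *\<^sub>R z - x)"
        by (simp add: divide_inverse diff_divide_distrib exp_diff left_diff_distrib)
      also have "\<dots> \<le> Kb * exp (\<Phi> x / h) * K * ((L * (2 * japanese x)) ^ ?N * decay ?N \<zeta>)"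
      proof (rule mult_left_mono)
        have "japanese \<zeta> \<le> L * japanese (2 *\<^sub>R z)" using L(2)[of "2 *\<^sub>R z"] by (simp add: inv)
        also have "\<dots> \<le> L * (2 * japanese (2 *\<^sub>R z - x) * japanese x)"
          using japanese_triangle[of "2 *\<^sub>R z - x" x] L(1) by (intro mult_left_mono) auto
        finally have "japanese \<zeta> ^ ?N \<le> (L * (2 * japanese (2 *\<^sub>R z - x) * japanese x)) ^ ?N"
          by (intro power_mono) (auto simp: less_imp_le)
        then have "japanese \<zeta> ^ ?N \<le> (L * (2 * japanese x)) ^ ?N * japanese (2 *\<^sub>R z - x) ^ ?N"
          unfolding power_mult_distrib[symmetric] by (simp only: mult_ac)
        then show "decay ?N (2 *\<^sub>R z - x) \<le> (L * (2 * japanese x)) ^ ?N * decay ?N \<zeta>"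
          using zero_less_power[OF japanese_pos[of \<zeta>]] zero_less_power[OF japanese_pos[of "2 *\<^sub>R z - x"]]
          by (simp add: field_simps)
      qed (use Kb K0 in auto)
      finally show ?thesis by (simp only: mult_ac)
    qed
    then show "AE \<zeta> in lborel. norm (G \<zeta>) \<le> norm (?M * decay ?N \<zeta>)"
      by (intro AE_I2 le_norm_real)
  qed (use G in simp)
qed

text \<open>Parametrizing the contour turns the left-hand side into an integral of reflections of \<open>T v\<close>, and
  each of them is \<open>T\<close> of a reflection of \<open>v\<close>. What remains is to integrate over \<open>w\<close> and \<open>\<eta>\<close> before
  \<open>y\<close>: Fubini's theorem applies to \<open>(y, w)\<close> for fixed \<open>\<eta>\<close>, and to \<open>(y, \<eta>)\<close> once the integral over \<open>w\<close>
  has produced decay in \<open>\<eta>\<close>.\<close>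

lemma weyl_integral_fbi:
  assumes h: "h > 0" and v: "schwartz v" and a: "symbol_Lambda \<Phi> a"
    and cont: "continuous_on UNIV (fbi \<phi> C h v)"
  shows "weyl_integral_Cn h \<Phi> a (fbi \<phi> C h v) x =
    fbi \<phi> C h (\<lambda>y. weyl_value h (a \<circ> canonical_trafo \<phi>) v y / complex_of_real ((2 * pi * h) ^ CARD('n))) x"
proof -
  define b where "b = a \<circ> canonical_trafo \<phi>"
  have b: "symbol_class b" unfolding b_def using a by (rule symbol_class_canonical)
  have b_eq: "b \<zeta> = a (base \<zeta>, fibre \<zeta>)" for \<zeta> by (simp add: b_def canonical_trafo_eq)
  obtain Kb where Kb: "Kb \<ge> 0" "\<And>\<zeta>. norm (b \<zeta>) \<le> Kb" using symbol_class_bounded[OF b] by blast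
  define c where "c = complex_of_real (C * h powr (- 3 * real CARD('n) / 4))"
  define u where "u = fbi \<phi> C h v"
  define E where "E y = fbi_kernel h x y" for y
  define k where "k y = exp (\<i> / complex_of_real h * cdot (x - y) (Lambda_fibre \<Phi> ((1/2) *\<^sub>R (x + y))))
      * a ((1/2) *\<^sub>R (x + y), Lambda_fibre \<Phi> ((1/2) *\<^sub>R (x + y))) * u y" for y
  define G where "G \<zeta> = k (midpoint_param \<zeta> - x)" for \<zeta>
  define H where "H y w \<eta> = E y * (b ((1/2) *\<^sub>R w, \<eta>) * exp (\<i> / complex_of_real h * complex_of_real ((2 *\<^sub>R y - w) \<bullet> \<eta>)) * v (w - y))" for y w \<eta>
  define J where "J y \<eta> = (\<integral>y'. weyl_integrand_Rn h b v y (y', \<eta>) \<partial>lborel)" for y \<eta>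
  \<comment> \<open>Twice the dimension of \<open>\<real>\<^sup>n \<times> \<real>\<^sup>n\<close>, for integrability in two variables at once.\<close>
  let ?M = "4 * DIM(real^'n)"
  have cE: "continuous_on UNIV E" unfolding E_def[abs_def] by (rule continuous_fbi_kernel)
  have cb: "continuous_on UNIV b" using b by (rule symbol_class_continuous)
  have cv: "continuous_on UNIV v" using v by (rule schwartz_continuous)
  have ca: "continuous_on UNIV (\<lambda>x. a (x, Lambda_fibre \<Phi> x))"
    using a by (intro symbol_class_continuous) (simp add: symbol_Lambda_def)
  have "continuous_on UNIV k"
    unfolding k_def[abs_def] u_def
  proof (intro continuous_on_mult cont continuous_on_exp continuous_on_cdot continuous_on_const continuous_on_diff continuous_on_id
      continuous_on_linear_comp[OF linear_Lambda_fibre] continuous_on_scaleR continuous_on_add)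
    show "continuous_on UNIV (\<lambda>y. a ((1/2) *\<^sub>R (x + y), Lambda_fibre \<Phi> ((1/2) *\<^sub>R (x + y))))"
      by (rule continuous_on_compose2[OF ca]) (auto intro!: continuous_intros)
  qed
  then have k_meas [measurable]: "k \<in> borel_measurable borel" by (rule borel_measurable_continuous_onI)
  have [measurable]: "midpoint_param \<in> borel_measurable borel" by (rule borel_measurable_linear[OF linear_midpoint_param])
  have G_meas: "G \<in> borel_measurable borel" unfolding G_def[abs_def] by measurable

  have G_reflection: "G (w, \<eta>) = exp (\<i> / complex_of_real h * (2 * cdot (x - base ((1/2) *\<^sub>R w, \<eta>)) (fibre ((1/2) *\<^sub>R w, \<eta>))))
       * b ((1/2) *\<^sub>R w, \<eta>) * u (2 *\<^sub>R base ((1/2) *\<^sub>R w, \<eta>) - x)" for w \<eta>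
  proof -
    let ?z = "base ((1/2) *\<^sub>R w, \<eta>)"
    have "x - (2 *\<^sub>R ?z - x) = 2 *\<^sub>R (x - ?z)" by (simp add: scaleR_2)
    moreover have "(1/2) *\<^sub>R (x + (2 *\<^sub>R ?z - x)) = ?z" by simp
    ultimately show ?thesis
      by (simp only: G_def k_def midpoint_param_def fst_conv snd_conv Lambda_fibre_base b_eq cdot_scaleR_left of_real_numeral)
  qed
  have G_int: "integrable lborel G"
    by (rule integrable_reflections[OF fbi_rapidly_decaying[OF h v] G_meas Kb(2) G_reflection[unfolded u_def]])
  have G_eq: "G (w, \<eta>) = c * (\<integral>y. H y w \<eta> \<partial>lborel)" for w \<eta>
  proof -
    let ?z = "base ((1/2) *\<^sub>R w, \<eta>)" and ?\<theta> = "fibre ((1/2) *\<^sub>R w, \<eta>)"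
    let ?e = "exp (\<i> / complex_of_real h * (2 * cdot (x - ?z) ?\<theta>))"
    let ?f = "\<lambda>y. fbi_kernel h (2 *\<^sub>R ?z - x) y * v y"
    have "?f \<in> borel_measurable borel"
      by (intro borel_measurable_continuous_onI continuous_on_mult continuous_fbi_kernel cv)
    then have "(\<integral>y. ?f y \<partial>lborel) = (\<integral>y. ?f (w - y) \<partial>lborel)" by (rule integral_reflect[symmetric])
    then have "u (2 *\<^sub>R ?z - x) = c * (\<integral>y. ?f (w - y) \<partial>lborel)"
      unfolding u_def fbi_def c_def by (simp only:)
    then have "G (w, \<eta>) = c * (\<integral>y. ?e * b ((1/2) *\<^sub>R w, \<eta>) * ?f (w - y) \<partial>lborel)"
      unfolding G_reflection by simp
    also have "(\<lambda>y. ?e * b ((1/2) *\<^sub>R w, \<eta>) * ?f (w - y)) = (\<lambda>y. H y w \<eta>)"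
    proof
      fix y
      have "?e * fbi_kernel h (2 *\<^sub>R ?z - x) (w - y)
          = exp (\<i> * (\<phi> (2 *\<^sub>R ?z - x) (cvec (w - y)) + 2 * cdot (x - ?z) ?\<theta>) / complex_of_real h)"
        unfolding exp_add[symmetric] by (simp add: distrib_left add_divide_distrib add.commute)
      also have "\<dots> = E y * exp (\<i> / complex_of_real h * complex_of_real ((2 *\<^sub>R y - w) \<bullet> \<eta>))"
        unfolding reflection_identity E_def exp_add[symmetric] by (simp add: distrib_left add_divide_distrib)
      finally show "?e * b ((1/2) *\<^sub>R w, \<eta>) * ?f (w - y) = H y w \<eta>"
        unfolding H_def by (simp only: mult_ac)
    qed
    finally show ?thesis .
  qed
  obtain KE where KE: "KE \<ge> 0" "\<And>y. norm (E y) \<le> KE * decay (?M + ?M) y"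
    using fbi_kernel_decay[OF h, of x "?M + ?M"] unfolding E_def by blast
  obtain Kv where Kv: "Kv \<ge> 0" "\<And>y. norm (v y) \<le> Kv * decay ?M y" using schwartz_bound[OF v] by blast

  have H_int: "integrable (lborel \<Otimes>\<^sub>M lborel) (\<lambda>(y, w). H y w \<eta>)" for \<eta>
  proof (rule integrable_pair_japanese)
    have "continuous_on UNIV (\<lambda>p. b ((1/2) *\<^sub>R snd p, \<eta>))"
      by (rule continuous_on_compose2[OF cb]) (auto intro!: continuous_intros)
    moreover have "continuous_on UNIV (\<lambda>p::(real^'n) \<times> (real^'n). v (snd p - fst p))"
      by (rule continuous_on_compose2[OF cv]) (auto intro!: continuous_intros)
    moreover have "continuous_on UNIV (\<lambda>p::(real^'n) \<times> (real^'n). E (fst p))"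
      by (rule continuous_on_compose2[OF cE]) (auto intro!: continuous_intros)
    ultimately show "(\<lambda>(y, w). H y w \<eta>) \<in> borel_measurable borel"
      unfolding H_def case_prod_unfold
      by (intro borel_measurable_continuous_onI continuous_on_mult continuous_on_exp) (auto intro!: continuous_intros)
    fix y w
    have "norm (H y w \<eta>) = norm (E y) * (norm (b ((1/2) *\<^sub>R w, \<eta>)) * norm (v (w - y)))"
      unfolding H_def norm_mult norm_exp_i_real by simp
    also have "\<dots> \<le> (KE * decay (?M + ?M) y) * (Kb * (Kv * decay ?M (w - y)))"
      using KE(1) Kb(1) Kv(1) by (intro mult_mono KE Kb Kv) (auto simp: less_imp_le)
    also have "\<dots> = (KE * Kb * Kv) * decay ?M y * (decay ?M (w + - y) * decay ?M (- y))"
      by (simp only: power_add inverse_mult_distrib japanese_minus diff_conv_add_uminus mult_ac)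
    also have "\<dots> \<le> (KE * Kb * Kv) * decay ?M y * (2 ^ ?M * decay ?M w)"
      using KE(1) Kb(1) Kv(1) by (intro mult_left_mono japanese_power_triangle) (auto simp: less_imp_le)
    also have "\<dots> = (KE * Kb * Kv * 2 ^ ?M) * (decay ?M y * decay ?M w)"
      by (simp only: mult_ac)
    finally show "norm (case (y, w) of (y, w) \<Rightarrow> H y w \<eta>) \<le> (KE * Kb * Kv * 2 ^ ?M) * (decay ?M y * decay ?M w)"
      by simp
  qed
  have inner: "(\<integral>w. H y w \<eta> \<partial>lborel) = E y * J y \<eta>" for y \<eta>
  proof -
    let ?f = "\<lambda>w. b ((1/2) *\<^sub>R w, \<eta>) * exp (\<i> / complex_of_real h * complex_of_real ((2 *\<^sub>R y - w) \<bullet> \<eta>)) * v (w - y)"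
    have "continuous_on UNIV (\<lambda>w. b ((1/2) *\<^sub>R w, \<eta>))"
      by (rule continuous_on_compose2[OF cb]) (auto intro!: continuous_intros)
    moreover have "continuous_on UNIV (\<lambda>w. v (w - y))"
      by (rule continuous_on_compose2[OF cv]) (auto intro!: continuous_intros)
    ultimately have "?f \<in> borel_measurable borel"
      by (intro borel_measurable_continuous_onI continuous_on_mult continuous_on_exp) (auto intro!: continuous_intros)
    then have "(\<integral>w. ?f w \<partial>lborel) = (\<integral>y'. ?f (y' + y) \<partial>lborel)" by (rule integral_translation[symmetric])
    also have "\<dots> = J y \<eta>"
      unfolding J_def weyl_integrand_Rn_def
      by (intro Bochner_Integration.integral_cong refl) (simp add: scaleR_2 algebra_simps)
    finally show ?thesis unfolding H_def by simp
  qed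
  have J_meas: "(\<lambda>(y, \<eta>). J y \<eta>) \<in> borel_measurable borel"
    unfolding J_def by (rule borel_measurable_weyl_inner_integral[OF b v])
  obtain KJ where KJ: "KJ \<ge> 0" "\<And>y \<eta>. norm (J y \<eta>) \<le> KJ * decay ?M \<eta>"
    using weyl_inner_integral_decay[OF _ b v, of h ?M] h unfolding J_def by blast
  have EJ_int: "integrable (lborel \<Otimes>\<^sub>M lborel) (\<lambda>(y, \<eta>). E y * J y \<eta>)"
  proof (rule integrable_pair_japanese)
    have "continuous_on UNIV (\<lambda>p::(real^'n) \<times> (real^'n). E (fst p))"
      by (rule continuous_on_compose2[OF cE]) (auto intro!: continuous_intros)
    from borel_measurable_times[OF borel_measurable_continuous_onI[OF this] J_meas]
    show "(\<lambda>(y, \<eta>). E y * J y \<eta>) \<in> borel_measurable borel" by (simp add: case_prod_unfold)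
    fix y \<eta>
    have "norm (E y * J y \<eta>) \<le> (KE * decay (?M + ?M) y) * (KJ * decay ?M \<eta>)"
      unfolding norm_mult using KE(1) by (intro mult_mono KE KJ) (auto simp: less_imp_le)
    also have "\<dots> \<le> (KE * decay ?M y) * (KJ * decay ?M \<eta>)"
    proof -
      have "japanese y ^ ?M \<le> japanese y ^ (?M + ?M)" using japanese_ge_1 by (intro power_increasing) auto
      then show ?thesis using KE(1) KJ(1) by (intro mult_right_mono mult_left_mono le_imp_inverse_le) (auto simp: less_imp_le)
    qed
    finally show "norm (case (y, \<eta>) of (y, \<eta>) \<Rightarrow> E y * J y \<eta>) \<le> (KE * KJ) * (decay ?M y * decay ?M \<eta>)"
      by (simp add: mult_ac)
  qed

  have "(\<integral>\<zeta>. G \<zeta> \<partial>lborel) = (\<integral>\<eta>. (\<integral>w. G (w, \<eta>) \<partial>lborel) \<partial>lborel)"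
    by (rule lborel_integral_pair(1)[OF G_int])
  also have "\<dots> = (\<integral>\<eta>. c * (\<integral>w. (\<integral>y. H y w \<eta> \<partial>lborel) \<partial>lborel) \<partial>lborel)"
    unfolding G_eq by simp
  also have "\<dots> = (\<integral>\<eta>. c * (\<integral>y. (\<integral>w. H y w \<eta> \<partial>lborel) \<partial>lborel) \<partial>lborel)"
    unfolding lborel_pair.Fubini_integral[OF H_int] ..
  also have "\<dots> = c * (\<integral>\<eta>. (\<integral>y. E y * J y \<eta> \<partial>lborel) \<partial>lborel)"
    unfolding inner by simp
  also have "(\<integral>\<eta>. (\<integral>y. E y * J y \<eta> \<partial>lborel) \<partial>lborel) = (\<integral>y. (\<integral>\<eta>. E y * J y \<eta> \<partial>lborel) \<partial>lborel)"
    by (rule lborel_pair.Fubini_integral[OF EJ_int])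
  also have "\<dots> = (\<integral>y. E y * weyl_value h b v y \<partial>lborel)"
    unfolding J_def weyl_value_def by simp
  finally have G_value: "(\<integral>\<zeta>. G \<zeta> \<partial>lborel) = c * (\<integral>y. E y * weyl_value h b v y \<partial>lborel)" .
  have "weyl_integral_Cn h \<Phi> a u x = (\<integral>\<zeta>. G \<zeta> \<partial>lborel) / complex_of_real ((2 * pi * h) ^ CARD('n))"
    unfolding weyl_integral_Cn_def graph_contour_integral_def G_def contour_integral_eq[OF k_meas, symmetric]
    unfolding k_def ..
  also have "\<dots> = c * (\<integral>y. E y * (weyl_value h b v y / complex_of_real ((2 * pi * h) ^ CARD('n))) \<partial>lborel)"
    unfolding G_value by simp
  also have "\<dots> = fbi \<phi> C h (\<lambda>y. weyl_value h b v y / complex_of_real ((2 * pi * h) ^ CARD('n))) x"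
    unfolding fbi_def E_def c_def ..
  finally show ?thesis unfolding u_def b_def .
qed

end

section \<open>Injectivity of the transform\<close>

lemma laplace_transform:
  fixes a :: complex
  assumes a: "Re a > 0"
  shows "integrable lborel (\<lambda>t::real. indicator {0..} t * exp (- a * of_real t))"
    and "(\<integral>t. indicator {0..} t * exp (- a * of_real t) \<partial>lborel) = inverse a"
proof -
  have nz: "a \<noteq> 0" using a by auto
  have lim: "((\<lambda>t. - exp (- (Re a) * t) / Re a) \<longlongrightarrow> 0) at_top"
  proof -
    have "filterlim (\<lambda>t. Re a * t) at_top at_top"
      by (rule filterlim_tendsto_pos_mult_at_top[OF tendsto_const a filterlim_ident])
    then have "((\<lambda>t. exp (- (Re a * t))) \<longlongrightarrow> 0) at_top"
      by (intro filterlim_compose[OF exp_at_bot]) (simp add: filterlim_uminus_at_bot)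
    from tendsto_mult_right[OF this, of "- inverse (Re a)"] show ?thesis by (simp add: field_simps)
  qed
  have "(\<integral>\<^sup>+t. ennreal (exp (- (Re a) * t)) * indicator {0..} t \<partial>lborel) = ennreal (0 - (- exp (- (Re a) * 0) / Re a))"
  proof (rule nn_integral_FTC_atLeast[OF _ _ _ lim])
    show "((\<lambda>t. - exp (- (Re a) * t) / Re a) has_real_derivative exp (- (Re a) * t)) (at t)" for t
      using a by (auto intro!: derivative_eq_intros)
  qed auto
  note half_line = this
  have fin: "(\<integral>\<^sup>+t. ennreal (norm (indicator {0..} t * exp (- a * of_real t))) \<partial>lborel) < \<infinity>"
  proof -
    have "ennreal (norm (indicator {0..} t * exp (- a * of_real t))) = ennreal (exp (- (Re a) * t)) * indicator {0..} t"
      for t :: real by (simp add: norm_mult indicator_def)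
    then show ?thesis
      using half_line by (simp only:) simp
  qed
  show int: "integrable lborel (\<lambda>t::real. indicator {0..} t * exp (- a * of_real t))"
    using fin by (intro integrableI_bounded) auto
  let ?F = "\<lambda>t. - exp (- a * of_real t) / a"
  have lim': "(\<lambda>n. ?F (real n)) \<longlonglongrightarrow> 0"
  proof (rule tendsto_norm_zero_cancel)
    have "(\<lambda>n. - (- exp (- (Re a) * real n) / Re a) * (Re a / norm a)) \<longlonglongrightarrow> - 0 * (Re a / norm a)"
      by (intro tendsto_intros filterlim_compose[OF lim filterlim_real_sequentially])
    then show "(\<lambda>n. norm (?F (real n))) \<longlonglongrightarrow> 0" using a by (simp add: norm_divide)
  qed
  have "(\<lambda>n::nat. \<integral>t. indicator {0..real n} t *\<^sub>R exp (- a * of_real t) \<partial>lborel) \<longlonglongrightarrow>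
      (\<integral>t. indicator {0..} t * exp (- a * of_real t) \<partial>lborel)"
  proof (rule integral_dominated_convergence)
    show "integrable lborel (\<lambda>t. norm (indicator {0..} t * exp (- a * of_real t)))" using int by (rule integrable_norm)
    show "AE t in lborel. norm (indicator {0..real n} t *\<^sub>R exp (- a * of_real t)) \<le> norm (indicator {0..} t * exp (- a * of_real t))" for n
      by (intro AE_I2) (auto simp: indicator_def)
    show "AE t in lborel. (\<lambda>n. indicator {0..real n} t *\<^sub>R exp (- a * of_real t)) \<longlonglongrightarrow> indicator {0..} t * exp (- a * of_real t)"
    proof (intro AE_I2)
      fix t :: real
      have "\<forall>\<^sub>F n in sequentially. indicator {0..real n} t *\<^sub>R exp (- a * of_real t) = indicator {0..} t * exp (- a * of_real t)"
        using eventually_ge_at_top[of "nat \<lceil>t\<rceil>"] by eventually_elim (auto simp: indicator_def nat_le_iff ceiling_le_iff)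
      then show "(\<lambda>n. indicator {0..real n} t *\<^sub>R exp (- a * of_real t)) \<longlonglongrightarrow> indicator {0..} t * exp (- a * of_real t)"
        by (rule tendsto_eventually)
    qed
  qed measurable
  moreover have "(\<integral>t. indicator {0..real n} t *\<^sub>R exp (- a * of_real t) \<partial>lborel) = ?F (real n) - ?F 0" for n
  proof (rule integral_FTC_atLeastAtMost)
    fix t :: real
    have "((\<lambda>t. - exp (- a * of_real t) / a) has_vector_derivative - (of_real 1 * - a * exp (- a * of_real t)) / a) (at t within {0..real n})"
      by (rule has_vector_derivative_real_field derivative_eq_intros refl | simp)+
    then show "(?F has_vector_derivative exp (- a * of_real t)) (at t within {0..real n})"
      using nz by simp
  qed (auto intro!: continuous_intros)
  ultimately have "(\<lambda>n. ?F (real n) - ?F 0) \<longlonglongrightarrow> (\<integral>t. indicator {0..} t * exp (- a * of_real t) \<partial>lborel)" by simp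
  moreover have "(\<lambda>n. ?F (real n) - ?F 0) \<longlonglongrightarrow> 0 - ?F 0" by (intro tendsto_diff lim' tendsto_const)
  ultimately show "(\<integral>t. indicator {0..} t * exp (- a * of_real t) \<partial>lborel) = inverse a"
    using LIMSEQ_unique by (fastforce simp: divide_inverse)
qed

context fbi_quadratic
begin

text \<open>As \<open>\<phi>''\<^sub>x\<^sub>y\<close> is invertible, some translation of \<open>x\<close> adds any prescribed linear function of \<open>y\<close> to
  the phase.\<close>

lemma fbi_kernel_shift:
  fixes \<xi> :: "real^'n"
  assumes h: "h \<noteq> 0"
  obtains x' c where "c \<noteq> 0" "\<And>y. fbi_kernel h x y * exp (- \<i> * complex_of_real (y \<bullet> \<xi>))
     = c * fbi_kernel h x' y"
proof -
  \<comment> \<open>The solution of \<open>Q\<^sup>T t = - h \<xi>\<close>.\<close>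
  define t where "t = - (Qt_inv *v (cvec (h *\<^sub>R \<xi>)))"
  define d where "d = \<phi> t 0 + cdot t (P *v x)"
  have "transpose Q *v t = - cvec (h *\<^sub>R \<xi>)"
    by (simp add: t_def matrix_vector_uminus Qt_Qt_inv)
  then have "cdot t (Q *v cvec y) = - complex_of_real h * complex_of_real (y \<bullet> \<xi>)" for y
    using cdot_cvec[of "h *\<^sub>R \<xi>" y] by (simp add: cdot_transpose cdot_minus_left inner_commute)
  then have shift: "\<phi> (x + t) (cvec y) = \<phi> x (cvec y) + d - complex_of_real h * complex_of_real (y \<bullet> \<xi>)" for y
    using phase_add[of x t "cvec y" 0] by (simp add: d_def cdot_add_right cdot_zero_left)
  have "fbi_kernel h x y * exp (- \<i> * complex_of_real (y \<bullet> \<xi>))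
     = exp (- \<i> * d / complex_of_real h) * fbi_kernel h (x + t) y" for y
    unfolding exp_add[symmetric] shift using h by (intro arg_cong[where f=exp]) (simp add: field_simps)
  then show thesis by (intro that[of "exp (- \<i> * d / complex_of_real h)" "x + t"]) auto
qed

text \<open>Multiplying by \<open>1 / (1 + \<i> y \<bullet> e)\<close> averages over the characters \<open>exp (- \<i> t y \<bullet> e)\<close>, and a character
  amounts to a translation of \<open>x\<close>.\<close>

lemma fbi_vanishing_step:
  fixes f :: "real^'n \<Rightarrow> complex"
  assumes h: "h \<noteq> 0"
    and int: "\<And>x. integrable lborel (\<lambda>y. fbi_kernel h x y * f y)"
    and zero: "\<And>x. (\<integral>y. fbi_kernel h x y * f y \<partial>lborel) = 0"
  shows "integrable lborel (\<lambda>y. fbi_kernel h x y * (inverse (1 + \<i> * complex_of_real (y \<bullet> e)) * f y))"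
    and "(\<integral>y. fbi_kernel h x y * (inverse (1 + \<i> * complex_of_real (y \<bullet> e)) * f y) \<partial>lborel) = 0"
proof -
  define g where "g y = fbi_kernel h x y * f y" for y
  have g: "integrable lborel g" using int[of x] by (simp add: g_def[abs_def])
  then have g_meas [measurable]: "g \<in> borel_measurable borel" by auto
  let ?K = "\<lambda>(t::real) y. indicator {0..} t * exp (- (1 + \<i> * complex_of_real (y \<bullet> e)) * of_real t) * g y"
  have norm_K: "norm (?K t y) = norm (indicator {0..} t * exp (- (1::complex) * of_real t)) * norm (g y)" for t y
    by (simp add: norm_mult)
  have exp1: "integrable lborel (\<lambda>t::real. indicator {0..} t * exp (- (1::complex) * of_real t))"
    by (rule laplace_transform) simp
  have K_meas: "(\<lambda>(t, y). ?K t y) \<in> borel_measurable (lborel \<Otimes>\<^sub>M lborel)"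
  proof -
    have "(\<lambda>y. complex_of_real (y \<bullet> e)) \<in> borel_measurable borel"
      by (intro borel_measurable_continuous_onI continuous_intros)
    then show ?thesis by measurable
  qed
  have K_int: "integrable (lborel \<Otimes>\<^sub>M lborel) (\<lambda>(t, y). ?K t y)"
  proof (rule lborel_pair.Fubini_integrable[OF K_meas])
    show "integrable lborel (\<lambda>t. \<integral>y. norm (case (t, y) of (t, y) \<Rightarrow> ?K t y) \<partial>lborel)"
      unfolding split norm_K using integrable_norm[OF exp1] by simp
    have "integrable lborel (\<lambda>y. ?K t y)" for t
    proof (rule Bochner_Integration.integrable_bound)
      show "integrable lborel (\<lambda>y. norm (indicator {0..} t * exp (- (1::complex) * of_real t)) * norm (g y))"
        using g by (intro integrable_mult_right integrable_norm)
      show "AE y in lborel. norm (?K t y) \<le> norm (norm (indicator {0..} t * exp (- (1::complex) * of_real t)) * norm (g y))"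
        unfolding norm_K by simp
    qed (use measurable_Pair2[OF K_meas, of t] in simp)
    then show "AE t in lborel. integrable lborel (\<lambda>y. case (t, y) of (t, y) \<Rightarrow> ?K t y)" by simp
  qed
  have lap: "(\<integral>t. ?K t y \<partial>lborel) = inverse (1 + \<i> * complex_of_real (y \<bullet> e)) * g y" for y
    using laplace_transform(2)[of "1 + \<i> * complex_of_real (y \<bullet> e)"] by simp
  have zero_t: "(\<integral>y. ?K t y \<partial>lborel) = 0" for t
  proof -
    obtain x' c where c: "\<And>y. fbi_kernel h x y * exp (- \<i> * complex_of_real (y \<bullet> (t *\<^sub>R e)))
        = c * fbi_kernel h x' y"
      using fbi_kernel_shift[OF h] by metis
    have "?K t y = indicator {0..} t * exp (- of_real t) * (c * (fbi_kernel h x' y * f y))" for y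
    proof -
      have "exp (- (1 + \<i> * complex_of_real (y \<bullet> e)) * of_real t) = exp (- of_real t) * exp (- \<i> * complex_of_real (y \<bullet> (t *\<^sub>R e)))"
        unfolding exp_add[symmetric] by (simp add: algebra_simps)
      then have "?K t y = indicator {0..} t * exp (- of_real t)
          * ((fbi_kernel h x y * exp (- \<i> * complex_of_real (y \<bullet> (t *\<^sub>R e)))) * f y)"
        unfolding g_def by (simp only: mult_ac)
      then show ?thesis unfolding c by (simp only: mult.assoc)
    qed
    then have "(\<integral>y. ?K t y \<partial>lborel) = (\<integral>y. indicator {0..} t * exp (- of_real t) * (c * (fbi_kernel h x' y * f y)) \<partial>lborel)"
      by (simp only:)
    then show ?thesis using zero[of x'] by simp
  qed
  have "integrable lborel (\<lambda>y. \<integral>t. ?K t y \<partial>lborel)"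
    using lborel_pair.integrable_snd[OF K_int] .
  then show "integrable lborel (\<lambda>y. fbi_kernel h x y * (inverse (1 + \<i> * complex_of_real (y \<bullet> e)) * f y))"
    unfolding lap unfolding g_def by (simp add: mult.left_commute)
  have "(\<integral>y. (\<integral>t. ?K t y \<partial>lborel) \<partial>lborel) = (\<integral>t. (\<integral>y. ?K t y \<partial>lborel) \<partial>lborel)"
    by (rule lborel_pair.Fubini_integral[OF K_int])
  then show "(\<integral>y. fbi_kernel h x y * (inverse (1 + \<i> * complex_of_real (y \<bullet> e)) * f y) \<partial>lborel) = 0"
    unfolding lap zero_t unfolding g_def by (simp add: mult.left_commute)
qed

end

section \<open>The exact Egorov theorem\<close>

lemma holomorphic_Cn_continuous: "holomorphic_Cn f \<Longrightarrow> continuous_on UNIV f"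
  unfolding holomorphic_Cn_def by (meson continuous_at_imp_continuous_on has_derivative_continuous)

lemma H_weight_lincomb:
  assumes u: "u \<in> H_weight \<Phi> h" and v: "v \<in> H_weight \<Phi> h"
  shows "(\<lambda>x. c * u x + d * v x) \<in> H_weight \<Phi> h"
proof -
  have "\<exists>D. ((\<lambda>x. c * u x + d * v x) has_derivative D) (at x) \<and> (\<forall>k w. D (k *s w) = k * D w)" for x
  proof -
    obtain Du where Du: "(u has_derivative Du) (at x)" "\<And>k w. Du (k *s w) = k * Du w"
      using u by (auto simp: H_weight_def holomorphic_Cn_def) metis
    obtain Dv where Dv: "(v has_derivative Dv) (at x)" "\<And>k w. Dv (k *s w) = k * Dv w"
      using v by (auto simp: H_weight_def holomorphic_Cn_def) metis
    have "((\<lambda>x. c * u x + d * v x) has_derivative (\<lambda>w. c * Du w + d * Dv w)) (at x)"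
      by (intro has_derivative_add has_derivative_mult_right Du Dv)
    then show ?thesis by (intro exI[of _ "\<lambda>w. c * Du w + d * Dv w"]) (simp add: Du(2) Dv(2) algebra_simps)
  qed
  then show ?thesis using u v by (auto simp: H_weight_def holomorphic_Cn_def intro!: L2_lincomb)
qed

context fbi_quadratic
begin

lemma fbi_kernel_L2:
  assumes h: "h > 0"
  shows "(\<lambda>y. fbi_kernel h x y) \<in> L2 lborel"
proof -
  obtain K where "\<And>y. norm (fbi_kernel h x y) \<le> K * inverse (japanese y ^ DIM(real^'n))"
    using fbi_kernel_decay[OF h] by blast
  then show ?thesis by (intro L2_of_decay borel_measurable_continuous_onI continuous_fbi_kernel)
qed

lemma fbi_kernel_integrable:
  assumes h: "h > 0"
  shows "integrable lborel (\<lambda>y. fbi_kernel h x y)"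
proof -
  let ?N = "2 * DIM(real^'n)"
  obtain K where K: "K \<ge> 0" "\<And>y. norm (fbi_kernel h x y) \<le> K * decay ?N y"
    using fbi_kernel_decay[OF h] by blast
  show ?thesis
  proof (rule Bochner_Integration.integrable_bound)
    show "integrable lborel (\<lambda>y::real^'n. K * decay ?N y)"
      by (intro integrable_mult_right integrable_japanese) simp
    show "AE y in lborel. norm (fbi_kernel h x y) \<le> norm (K * decay ?N y)"
      by (intro AE_I2 le_norm_real K)
  qed (simp add: borel_measurable_continuous_onI continuous_fbi_kernel)
qed

text \<open>Dividing by the factors \<open>1 + \<i> y\<^sub>j\<close> often enough moves a function with vanishing transform into
  \<open>L\<^sup>2\<close>, where the unitarity of \<open>T\<close> applies.\<close>

lemma fbi_injective:
  assumes h: "h > 0" and C: "C > 0"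
    and T: "unitary_operator lborel (L2 lborel) (weight_measure \<Phi> h) W (fbi \<phi> C h)"
    and u: "u \<in> L2 lborel" and g: "g \<in> borel_measurable borel" "\<And>y. norm (g y) \<le> K"
    and eq: "fbi \<phi> C h u = fbi \<phi> C h g"
  shows "AE y in lborel. u y = g y"
proof -
  let ?E = "\<lambda>x y. fbi_kernel h x y"
  define f where "f y = u y - g y" for y
  have intu: "integrable lborel (\<lambda>y. ?E x y * u y)" for x
    by (intro L2_mult_integrable fbi_kernel_L2 h u)
  have intg: "integrable lborel (\<lambda>y. ?E x y * g y)" for x
  proof (rule Bochner_Integration.integrable_bound)
    show "integrable lborel (\<lambda>y. K * norm (?E x y))"
      using fbi_kernel_integrable[OF h] by (intro integrable_mult_right integrable_norm)
    show "(\<lambda>y. ?E x y * g y) \<in> borel_measurable lborel"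
      using borel_measurable_times[OF borel_measurable_continuous_onI[OF continuous_fbi_kernel] g(1)] by simp
    have "norm (?E x y) * norm (g y) \<le> K * norm (?E x y)" for y
      using mult_left_mono[OF g(2)[of y], of "norm (?E x y)"] by (simp add: mult.commute)
    then show "AE y in lborel. norm (?E x y * g y) \<le> norm (K * norm (?E x y))"
      unfolding norm_mult[of "?E x _"] by (intro AE_I2 le_norm_real)
  qed
  have intf: "integrable lborel (\<lambda>y. ?E x y * f y)" for x
    using intu intg by (simp add: f_def right_diff_distrib)
  have const: "complex_of_real (C * h powr (- 3 * real CARD('n) / 4)) \<noteq> 0" using h C by simp
  have zerof: "(\<integral>y. ?E x y * f y \<partial>lborel) = 0" for x
  proof -
    have "(\<integral>y. ?E x y * u y \<partial>lborel) = (\<integral>y. ?E x y * g y \<partial>lborel)"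
      using fun_cong[OF eq, of x] const unfolding fbi_def by simp
    then show ?thesis using intu[of x] intg[of x] by (simp add: f_def right_diff_distrib)
  qed
  obtain bs :: "(real^'n) list" where bs: "\<And>y. japanese y ^ DIM(real^'n) \<le> (\<Prod>e\<leftarrow>bs. sqrt (1 + (y \<bullet> e)\<^sup>2))"
    using japanese_power_le_prod_list[where k="DIM(real^'n)" and 'a="real^'n"] by blast
  define q where "q es y = (\<Prod>e\<leftarrow>es. inverse (1 + \<i> * complex_of_real (y \<bullet> e)))" for es and y :: "real^'n"
  have q: "integrable lborel (\<lambda>y. ?E x y * (q es y * f y)) \<and> (\<integral>y. ?E x y * (q es y * f y) \<partial>lborel) = 0" for x es
  proof (induction es arbitrary: x)
    case Nil
    then show ?case using intf zerof by (simp add: q_def)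
  next
    case (Cons e es)
    have step: "q (e # es) y * f y = inverse (1 + \<i> * complex_of_real (y \<bullet> e)) * (q es y * f y)" for y
      by (simp add: q_def)
    show ?case
      unfolding step
      using fbi_vanishing_step[of h "\<lambda>y. q es y * f y", OF less_imp_neq[OF h, symmetric]] Cons.IH by blast
  qed
  have norm_factor: "norm (inverse (1 + \<i> * complex_of_real t)) = inverse (sqrt (1 + t\<^sup>2))" for t
  proof -
    have "norm (1 + \<i> * complex_of_real t) = sqrt (1 + t\<^sup>2)" by (simp add: cmod_def)
    then show ?thesis by (simp only: norm_inverse)
  qed
  have norm_q: "norm (q es y) = inverse (\<Prod>e\<leftarrow>es. sqrt (1 + (y \<bullet> e)\<^sup>2))" for es y
    unfolding q_def by (induction es) (simp_all add: norm_mult norm_factor)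
  have q_decay: "norm (q bs y) \<le> inverse (japanese y ^ DIM(real^'n))" for y
    unfolding norm_q by (intro le_imp_inverse_le bs) simp
  have q_cont: "continuous_on UNIV (q es)" for es
  proof -
    have "1 + \<i> * complex_of_real t \<noteq> 0" for t by (simp add: complex_eq_iff)
    then show ?thesis
      unfolding q_def[abs_def] by (induction es) (auto intro!: continuous_intros)
  qed
  then have [measurable]: "q es \<in> borel_measurable borel" for es by (rule borel_measurable_continuous_onI)
  have "norm (q bs y) \<le> 1" for y
    using q_decay[of y] one_le_power[OF japanese_ge_1[of y], of "DIM(real^'n)"]
    by (meson inverse_le_1_iff order_trans)
  then have "(\<lambda>y. q bs y * u y) \<in> L2 lborel" by (intro L2_bounded_mult[OF u]) auto
  moreover have "(\<lambda>y. q bs y * g y) \<in> L2 lborel"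
  proof (rule L2_of_decay)
    show "norm (q bs y * g y) \<le> K * inverse (japanese y ^ DIM(real^'n))" for y
      using mult_mono[OF q_decay[of y] g(2)[of y]] by (simp add: norm_mult mult.commute less_imp_le)
    show "(\<lambda>y. q bs y * g y) \<in> borel_measurable borel" using g(1) by measurable
  qed
  ultimately have "(\<lambda>y. 1 * (q bs y * u y) + (-1) * (q bs y * g y)) \<in> L2 lborel" by (rule L2_lincomb)
  then have qf: "(\<lambda>y. q bs y * f y) \<in> L2 lborel" by (simp add: f_def right_diff_distrib)
  have "fbi \<phi> C h (\<lambda>y. q bs y * f y) = (\<lambda>_. 0)"
    unfolding fbi_def using q by auto
  then have "l2_norm lborel (\<lambda>y. q bs y * f y) = 0"
    using unitary_norm[OF T qf] by (simp add: l2_norm_zero)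
  then have "AE y in lborel. q bs y * f y = 0" by (rule l2_norm_eq_0_imp[OF qf])
  moreover have "q bs y \<noteq> 0" for y
  proof -
    have "1 + \<i> * complex_of_real t \<noteq> 0" for t by (simp add: complex_eq_iff)
    then show ?thesis by (simp add: q_def prod_list_zero_iff image_iff)
  qed
  ultimately show ?thesis by (simp add: f_def)
qed

text \<open>Surjectivity of \<open>T\<close> gives a square integrable \<open>u\<close> with \<open>T u = Op(a) T v\<close>. The intertwining relation
  gives the same transform to \<open>Op(b) v\<close>; both transforms are holomorphic, so they agree everywhere and
  injectivity applies.\<close>

lemma egorov_exact:
  assumes T: "unitarily_normalized \<phi> C" and h: "0 < h" "h \<le> 1"
    and a: "symbol_Lambda \<Phi> a" and A: "is_weyl_H h \<Phi> a A" and v: "schwartz v"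
  shows "AE y in lborel. (fbi_adjoint \<phi> C h \<circ> A \<circ> fbi \<phi> C h) v y
    = weyl_value h (a \<circ> canonical_trafo \<phi>) v y / complex_of_real ((2 * pi * h) ^ CARD('n))"
proof -
  let ?T = "fbi \<phi> C h" and ?N = "weight_measure \<Phi> h" and ?W = "H_weight \<Phi> h"
  let ?g = "\<lambda>y. weyl_value h (a \<circ> canonical_trafo \<phi>) v y / complex_of_real ((2 * pi * h) ^ CARD('n))"
  have C: "C > 0" and U: "unitary_operator lborel (L2 lborel) ?N ?W ?T"
    using T h by (auto simp: unitarily_normalized_def)
  have W: "?W \<subseteq> L2 ?N" by (auto simp: H_weight_def)
  have TW: "?T u \<in> ?W" if "u \<in> L2 lborel" for u
    using U that by (auto simp: unitary_operator_def linear_operator_def)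
  have W_cont: "continuous_on UNIV w" if "w \<in> ?W" for w
    using that by (auto simp: H_weight_def intro: holomorphic_Cn_continuous)
  have b: "symbol_class (a \<circ> canonical_trafo \<phi>)" using a by (rule symbol_class_canonical)
  note Tv = TW[OF schwartz_L2[OF v]]
  have "A (?T v) = weyl_integral_Cn h \<Phi> a (?T v)"
    using A Tv fbi_rapidly_decaying[OF h(1) v] by (auto simp: is_weyl_H_def H_weight_def)
  also have "\<dots> = ?T ?g"
    using weyl_integral_fbi[OF h(1) v a W_cont[OF Tv]] by blast
  finally have ATv: "A (?T v) = ?T ?g" .
  have AW: "A (?T v) \<in> ?W"
    using A Tv by (auto simp: is_weyl_H_def bounded_operator_def linear_operator_def)
  obtain u where u: "u \<in> L2 lborel" "AE x in ?N. ?T u x = A (?T v) x"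
    using U AW by (auto simp: unitary_operator_def)
  have "AE x in lborel. ?T u x = A (?T v) x"
  proof -
    have "(\<lambda>x. ennreal (exp (- 2 * \<Phi> x / h))) \<in> borel_measurable lborel"
    proof -
      have "continuous_on UNIV \<Phi>"
        using has_derivative_weight by (meson continuous_at_imp_continuous_on has_derivative_continuous)
      then have "\<Phi> \<in> borel_measurable borel" by (rule borel_measurable_continuous_onI)
      then show ?thesis by measurable
    qed
    from u(2) show ?thesis
      unfolding weight_measure_def AE_density[OF \<open>_ \<in> borel_measurable lborel\<close>] by simp
  qed
  then have "?T u = A (?T v)"
    by (rule continuous_AE_eq_imp_eq[OF W_cont[OF TW[OF u(1)]] W_cont[OF AW]])
  then have Tu: "?T u = ?T ?g" using ATv by simp
  obtain K where K: "\<And>y. norm (weyl_value h (a \<circ> canonical_trafo \<phi>) v y) \<le> K"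
    using weyl_value_bounded(2)[OF _ b v, of h] h by auto
  have "AE y in lborel. u y = ?g y"
  proof (rule fbi_injective[OF h(1) C U u(1) _ _ Tu])
    show "?g \<in> borel_measurable borel"
      using weyl_value_bounded(1)[OF _ b v, of h] h by (intro borel_measurable_divide) auto
    show "norm (?g y) \<le> K / norm (complex_of_real ((2 * pi * h) ^ CARD('n)))" for y
      unfolding norm_divide using K by (intro divide_right_mono) auto
  qed
  moreover have "AE y in lborel. fbi_adjoint \<phi> C h (A (?T v)) y = u y"
    unfolding fbi_adjoint_def using AW W by (intro l2_adjoint_unitary(2)[OF U W u(1) _ u(2)]) auto
  ultimately show ?thesis by eventually_elim simp
qed

end

theorem theorem1p4p2:
  fixes \<phi> :: "complex^'n \<Rightarrow> complex^'n \<Rightarrow> complex"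
    and C h :: real
    and a :: "(complex^'n) \<times> (complex^'n) \<Rightarrow> complex"
    and A :: "(complex^'n \<Rightarrow> complex) \<Rightarrow> complex^'n \<Rightarrow> complex"
  assumes "fbi_phase \<phi>"
    and "unitarily_normalized \<phi> C"
    and "0 < h" and "h \<le> 1"
    and "symbol_Lambda (fbi_weight \<phi>) a"
    and "is_weyl_H h (fbi_weight \<phi>) a A"
  shows "symbol_class (a \<circ> canonical_trafo \<phi>) \<and>
    is_weyl_L2 h (a \<circ> canonical_trafo \<phi>) (fbi_adjoint \<phi> C h \<circ> A \<circ> fbi \<phi> C h) \<and>
    (\<forall>B. is_weyl_L2 h (a \<circ> canonical_trafo \<phi>) B \<longrightarrow>
      (\<forall>v\<in>L2 lborel. AE y in lborel. (fbi_adjoint \<phi> C h \<circ> A \<circ> fbi \<phi> C h) v y = B v y))"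
proof -
  obtain P Q R where "fbi_quadratic P Q R \<phi>" using assms(1) by (rule fbi_phase_imp_quadratic)
  then interpret fbi_quadratic P Q R \<phi> .
  let ?b = "a \<circ> canonical_trafo \<phi>" and ?S = "fbi_adjoint \<phi> C h \<circ> A \<circ> fbi \<phi> C h"
  have b: "symbol_class ?b" using assms(5) by (rule symbol_class_canonical)
  have U: "unitary_operator lborel (L2 lborel) (weight_measure \<Phi> h) (H_weight \<Phi> h) (fbi \<phi> C h)"
    using assms(2-4) by (simp add: unitarily_normalized_def)
  have S: "bounded_operator lborel (L2 lborel) ?S"
    unfolding fbi_adjoint_def
    using assms(6) by (intro bounded_operator_unitary_conj[OF U] H_weight_lincomb)
      (auto simp: H_weight_def is_weyl_H_def)
  have S_value: "AE y in lborel. ?S v y = weyl_value h ?b v y / complex_of_real ((2 * pi * h) ^ CARD('n))"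
    if "schwartz v" for v
    using assms(2-6) that by (rule egorov_exact)
  have osc: "has_oscillatory_integral (weyl_integrand_Rn h ?b v y) (weyl_value h ?b v y)" if "schwartz v" for v y
    using assms(3) b that by (intro has_oscillatory_integral_weyl) auto
  have "AE y in lborel. \<exists>I. has_oscillatory_integral (weyl_integrand_Rn h ?b v y) I \<and>
      ?S v y = I / complex_of_real ((2 * pi * h) ^ CARD('n))" if v: "schwartz v" for v
    using S_value[OF v] by eventually_elim (use osc[OF v] in blast)
  then have weyl_S: "is_weyl_L2 h ?b ?S" using S by (simp add: is_weyl_L2_def)
  have "AE y in lborel. ?S v y = B v y" if B: "is_weyl_L2 h ?b B" and v: "v \<in> L2 lborel" for B v
  proof (rule bounded_operators_eq_on_schwartz[OF S _ _ v])
    show "bounded_operator lborel (L2 lborel) B" using B by (simp add: is_weyl_L2_def)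
    fix s :: "real^'n \<Rightarrow> complex" assume s: "schwartz s"
    have "AE y in lborel. \<exists>I. has_oscillatory_integral (weyl_integrand_Rn h ?b s y) I \<and>
        B s y = I / complex_of_real ((2 * pi * h) ^ CARD('n))"
      using B s by (simp add: is_weyl_L2_def)
    then show "AE y in lborel. ?S s y = B s y"
      using S_value[OF s]
    proof eventually_elim
      case (elim y)
      then show ?case using oscillatory_integral_unique[OF osc[OF s]] by metis
    qed
  qed
  with b weyl_S show ?thesis by blast
qed

end
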